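(* The $\Pi(Q)$-modules $N(\gamma)$, for $\gamma\in P$, satisfy the following. (i) If $\gamma$ is antidominant, then $N(\gamma)=0$. (ii) Let $i\in I$ and let $\gamma$ be a $W$-conjugate of $-\omega_i$, with $\gamma\neq-\omega_i$. Then $\underline{\dim}\,N(\gamma)=\gamma+\omega_i$ and $\operatorname{soc}N(\gamma)\cong S_i$. Moreover these conditions characterize $N(\gamma)$ up to isomorphism: any $\Pi(Q)$-module $N$ with $\underline{\dim}\,N=\gamma+\omega_i$ and $\operatorname{soc}N\cong S_i$ is isomorphic to $N(\gamma)$. (iii) If $\gamma$ and $\delta$ belong to the same Weyl chamber, then $N(\gamma+\delta)\cong N(\gamma)\oplus N(\delta)$.
   Context: $K$ is a field. $Q=(I,E)$ is a quiver obtained by orienting a Dynkin diagram of type $ADE$; $s,t$ denote source and target. For each $a\in E$ let $a^*$ be the reversed arrow; $H=E\sqcup E^*$, $(a^* )^*=a$, $\varepsilon(a)=1$ for $a\in E$ and $\varepsilon(a)=-1$ for $a\in E^*$. The preprojective algebra $\Pi(Q)$ is the path algebra of $(I,H)$ over $K$ modulo the ideal generated by $\sum_{a\in H}\varepsilon(a)aa^*$; a $\Pi(Q)$-module $M$ is an $I$-graded vector space $\bigoplus_{i\in I}M_i$ with linear maps $M_a:M_{s(a)}\to M_{t(a)}$ ($a\in H$) such that $\sum_{a\in H,t(a)=i}\varepsilon(a)M_aM_{a^*}=0$ for each $i\in I$. All modules are finite-dimensional; $\underline{\dim}\,M=(\dim M_i)\in\mathbb N^I\subseteq\mathbb Z^I$.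 $S_i$ is the one-dimensional module concentrated at vertex $i$. The root lattice is $\mathbb Z^I$ with basis the simple roots $(\alpha_i)$ and symmetric form $\langle\mu,\nu\rangle=2\sum_i\mu_i\nu_i-\sum_{a\in H}\nu_{s(a)}\mu_{t(a)}$. $P$ is the dual (weight) lattice, with basis the fundamental weights $(\omega_i)$, $\langle\omega_i,\alpha_j\rangle=\delta_{ij}$; $\mathbb Z^I$ embeds in $P$ through the form. $s_i(\mu)=\mu-\langle\alpha_i,\mu\rangle\alpha_i$, acting also on $P$; $W$ is the Weyl group generated by the $s_i$. A weight is antidominant if it is a combination of the $-\omega_i$ with nonnegative coefficients; Weyl chambers are closed, i.e. $\gamma$ and $\delta$ are in the same chamber if $\gamma=w\lambda$ and $\delta=w\mu$ for some $w\in W$ and antidominant $\lambda,\mu$. Definition of $N(\gamma)$: let $\widehat Q$ be $Q$ with an extra vertex $i'$ and an extra arrow $d_i:i\to i'$ for each $i\in I$. A $\Pi(\widehat Q)$-module $M$ consists of spaces $M_i,M_{i'}$ ($i\in I$) and maps $M_a$ ($a\in H$), $M_{d_i}:M_i\to M_{i'}$, $M_{d_i^*}:M_{i'}\to M_i$ with $\sum_{a\in H,t(a)=i}\varepsilon(a)M_aM_{a^*}=M_{d_i^*}M_{d_i}$ and $M_{d_i}M_{d_i^*}=0$ for all $i\in I$. Its dimension-vector is the pair $(\nu,\lambda)$, $\nu_i=\dim M_i$, $\lambda_{i'}=\dim M_{i'}$, with $\lambda$ identified with the antidominant weight $-\sum_i\lambda_{i'}\omega_i$. $M$ is stable if for each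 $i\in I$ the map $M_i\to\bigl(\bigoplus_{a\in H,s(a)=i}M_{t(a)}\bigr)\oplus M_{i'}$ with components $M_a$ and $M_{d_i}$ is injective. For $\lambda$ antidominant and $w\in W$ there is a unique up to isomorphism stable $\Pi(\widehat Q)$-module of dimension-vector $(w\lambda-\lambda,\lambda)$, denoted $\widehat N(w\lambda)$; the arrows $d_i^*$ act on it by zero. $N(w\lambda)$ is the quotient of $\widehat N(w\lambda)$ by the submodule formed by its spaces at the primed vertices (which is $\widehat N(\lambda)$); being supported on unprimed vertices, it is a $\Pi(Q)$-module. Every weight is of the form $w\lambda$. *)

theory Defs
  imports
    "Graph_Theory.Digraph"
    "HOL-Library.FuncSet"
    "HOL-Library.Function_Algebras"
    "HOL-Library.Product_Plus"
begin

section \<open>Quivers of type ADE\<close>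

definition path_edges :: "nat \<Rightarrow> nat set set" where
  "path_edges m = {{k, Suc k} | k. Suc k < m}"

text \<open>
  \<open>ade_diagram n F\<close>: the vertices \<open>0, \<dots>, n - 1\<close> with the edge set \<open>F\<close> form a (connected)
  Dynkin diagram of type A, D or E.
\<close>

inductive ade_diagram :: "nat \<Rightarrow> nat set set \<Rightarrow> bool" where
  A: "n \<ge> 1 \<Longrightarrow> ade_diagram n (path_edges n)"
| D: "n \<ge> 4 \<Longrightarrow> ade_diagram n (insert {n - 3, n - 1} (path_edges (n - 1)))"
| E: "n \<in> {6, 7, 8} \<Longrightarrow> ade_diagram n (insert {2, n - 1} (path_edges (n - 1)))"

text \<open>
  The vertex set \<open>I\<close> is the whole (finite) vertex type. The arrows are a set, which may be empty
  (type \<open>A\<close> with one vertex). Every edge of the diagram carries exactly one arrow, in an arbitrary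
  direction.
\<close>

definition ade_quiver :: "('i::finite, 'e) pre_digraph \<Rightarrow> bool" where
  "ade_quiver Q \<longleftrightarrow> verts Q = UNIV \<and>
     (\<exists>n F \<phi>. ade_diagram n F \<and> bij_betw \<phi> (verts Q) {..<n} \<and>
        bij_betw (\<lambda>a. {\<phi> (tail Q a), \<phi> (head Q a)}) (arcs Q) F)"

text \<open>The quiver \<open>(I, H)\<close>: \<open>Inl a\<close> is the arrow \<open>a\<close> and \<open>Inr a\<close> is \<open>a\<^sup>*\<close>.\<close>

definition double_quiver :: "('i, 'e) pre_digraph \<Rightarrow> ('i, 'e + 'e) pre_digraph" where
  "double_quiver Q = \<lparr>verts = verts Q, arcs = arcs Q <+> arcs Q,
     tail = case_sum (tail Q) (head Q), head = case_sum (head Q) (tail Q)\<rparr>"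

fun star :: "'e + 'e \<Rightarrow> 'e + 'e" where
  "star (Inl a) = Inr a"
| "star (Inr a) = Inl a"

fun arrow_sign :: "'e + 'e \<Rightarrow> 'k::field" where
  "arrow_sign (Inl a) = 1"
| "arrow_sign (Inr a) = -1"

text \<open>
  The quiver \<open>Q\<close> with hat: \<open>Inl i\<close> is the vertex \<open>i\<close>, \<open>Inr i\<close> is the vertex \<open>i'\<close>,
  and the arrow \<open>Inr i\<close> is \<open>d\<^sub>i : i \<rightarrow> i'\<close>.
\<close>

definition framed_quiver :: "('i, 'e) pre_digraph \<Rightarrow> ('i + 'i, 'e + 'i) pre_digraph" where
  "framed_quiver Q = \<lparr>verts = verts Q <+> verts Q, arcs = arcs Q <+> verts Q,
     tail = case_sum (\<lambda>a. Inl (tail Q a)) Inl, head = case_sum (\<lambda>a. Inl (head Q a)) Inr\<rparr>"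


section \<open>Finite-dimensional representations of quivers\<close>

text \<open>
  The spaces \<open>M\<^sub>i\<close> are subspaces of a common ambient vector space \<open>'v\<close>, with no independence
  required. The maps \<open>M\<^sub>a\<close> matter only on the space at the source of \<open>a\<close>.
\<close>

record ('k, 'v, 'i, 'h) rep =
  scalar :: "'k \<Rightarrow> 'v \<Rightarrow> 'v"
  vspace :: "'i \<Rightarrow> 'v set"
  act :: "'h \<Rightarrow> 'v \<Rightarrow> 'v"

definition linear_between ::
  "('k \<Rightarrow> 'v::ab_group_add \<Rightarrow> 'v) \<Rightarrow> 'v set \<Rightarrow> ('k \<Rightarrow> 'w::ab_group_add \<Rightarrow> 'w) \<Rightarrow> 'w set \<Rightarrow> ('v \<Rightarrow> 'w) \<Rightarrow> bool"
  where "linear_between s V t W f \<longleftrightarrow> f \<in> V \<rightarrow> W \<and>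
    (\<forall>x\<in>V. \<forall>y\<in>V. f (x + y) = f x + f y) \<and> (\<forall>c. \<forall>x\<in>V. f (s c x) = t c (f x))"

definition is_rep ::
  "('i, 'h) pre_digraph \<Rightarrow> ('k::field, 'v::ab_group_add, 'i, 'h) rep \<Rightarrow> bool" where
  "is_rep G M \<longleftrightarrow> vector_space (scalar M) \<and>
     (\<forall>i\<in>verts G. module.subspace (scalar M) (vspace M i) \<and>
        (\<exists>B. finite B \<and> vspace M i = module.span (scalar M) B)) \<and>
     (\<forall>a\<in>arcs G. linear_between (scalar M) (vspace M (tail G a))
        (scalar M) (vspace M (head G a)) (act M a))"

definition dim_vector ::
  "('k::field, 'v::ab_group_add, 'i, 'h) rep \<Rightarrow> 'i \<Rightarrow> int" where
  "dim_vector M i = int (vector_space.dim (scalar M) (vspace M i))"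

definition rep_hom ::
  "('i, 'h) pre_digraph \<Rightarrow> ('k::field, 'v::ab_group_add, 'i, 'h) rep \<Rightarrow>
   ('k, 'w::ab_group_add, 'i, 'h) rep \<Rightarrow> ('i \<Rightarrow> 'v \<Rightarrow> 'w) \<Rightarrow> bool" where
  "rep_hom G M N f \<longleftrightarrow>
     (\<forall>i\<in>verts G. linear_between (scalar M) (vspace M i) (scalar N) (vspace N i) (f i)) \<and>
     (\<forall>a\<in>arcs G. \<forall>x\<in>vspace M (tail G a).
        f (head G a) (act M a x) = act N a (f (tail G a) x))"

definition rep_isomorphic ::
  "('i, 'h) pre_digraph \<Rightarrow> ('k::field, 'v::ab_group_add, 'i, 'h) rep \<Rightarrow>
   ('k, 'w::ab_group_add, 'i, 'h) rep \<Rightarrow> bool" where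
  "rep_isomorphic G M N \<longleftrightarrow>
     (\<exists>f. rep_hom G M N f \<and> (\<forall>i\<in>verts G. bij_betw (f i) (vspace M i) (vspace N i)))"

definition zero_rep ::
  "('i, 'h) pre_digraph \<Rightarrow> ('k::field, 'v::ab_group_add, 'i, 'h) rep \<Rightarrow> bool" where
  "zero_rep G M \<longleftrightarrow> (\<forall>i\<in>verts G. vspace M i = {0})"

definition direct_sum ::
  "('k, 'v, 'i, 'h) rep \<Rightarrow> ('k, 'w, 'i, 'h) rep \<Rightarrow> ('k, 'v \<times> 'w, 'i, 'h) rep" where
  "direct_sum M N = \<lparr>scalar = \<lambda>c. map_prod (scalar M c) (scalar N c),
     vspace = \<lambda>i. vspace M i \<times> vspace N i, act = \<lambda>a. map_prod (act M a) (act N a)\<rparr>"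

definition subrep ::
  "('i, 'h) pre_digraph \<Rightarrow> ('k::field, 'v::ab_group_add, 'i, 'h) rep \<Rightarrow> ('i \<Rightarrow> 'v set) \<Rightarrow> bool"
  where "subrep G M U \<longleftrightarrow>
    (\<forall>i\<in>verts G. module.subspace (scalar M) (U i) \<and> U i \<subseteq> vspace M i) \<and>
    (\<forall>a\<in>arcs G. act M a ` U (tail G a) \<subseteq> U (head G a))"

definition simple_subrep ::
  "('i, 'h) pre_digraph \<Rightarrow> ('k::field, 'v::ab_group_add, 'i, 'h) rep \<Rightarrow> ('i \<Rightarrow> 'v set) \<Rightarrow> bool"
  where "simple_subrep G M U \<longleftrightarrow> subrep G M U \<and> (\<exists>i\<in>verts G. U i \<noteq> {0}) \<and>
    (\<forall>V. subrep G M V \<and> (\<forall>i\<in>verts G. V i \<subseteq> U i) \<longrightarrow>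
       (\<forall>i\<in>verts G. V i = {0}) \<or> (\<forall>i\<in>verts G. V i = U i))"

definition socle ::
  "('i, 'h) pre_digraph \<Rightarrow> ('k::field, 'v::ab_group_add, 'i, 'h) rep \<Rightarrow> ('k, 'v, 'i, 'h) rep"
  where "socle G M =
    M\<lparr>vspace := \<lambda>i. module.span (scalar M) (\<Union>{U i | U. simple_subrep G M U})\<rparr>"

definition is_quotient ::
  "('i, 'h) pre_digraph \<Rightarrow> ('k::field, 'v::ab_group_add, 'i, 'h) rep \<Rightarrow> ('i \<Rightarrow> 'v set) \<Rightarrow>
   ('k, 'w::ab_group_add, 'i, 'h) rep \<Rightarrow> bool" where
  "is_quotient G M U L \<longleftrightarrow> subrep G M U \<and> is_rep G L \<and>
     (\<exists>f. rep_hom G M L f \<and>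
        (\<forall>i\<in>verts G. f i ` vspace M i = vspace L i \<and> {x \<in> vspace M i. f i x = 0} = U i))"


section \<open>Modules over preprojective algebras\<close>

definition preprojective_module ::
  "('i, 'e) pre_digraph \<Rightarrow> ('k::field, 'v::ab_group_add, 'i, 'e + 'e) rep \<Rightarrow> bool" where
  "preprojective_module Q M \<longleftrightarrow> is_rep (double_quiver Q) M \<and>
     (\<forall>i\<in>verts Q. \<forall>x\<in>vspace M i.
        (\<Sum>a\<in>in_arcs (double_quiver Q) i. scalar M (arrow_sign a) (act M a (act M (star a) x))) = 0)"

text \<open>
  A module over the preprojective algebra of the framed quiver satisfies the expected relations.
\<close>

lemma preprojective_module_framed_iff:
  fixes Q :: "('i::finite, 'e) pre_digraph"
    and M :: "('k::field, 'v::ab_group_add, 'i + 'i, ('e + 'i) + ('e + 'i)) rep"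
  assumes "verts Q = UNIV" "finite (arcs Q)"
  shows "preprojective_module (framed_quiver Q) M \<longleftrightarrow>
    is_rep (double_quiver (framed_quiver Q)) M \<and>
    (\<forall>i. \<forall>x\<in>vspace M (Inl i).
       (\<Sum>a\<in>in_arcs (double_quiver Q) i. scalar M (arrow_sign a)
          (act M (map_sum Inl Inl a) (act M (map_sum Inl Inl (star a)) x)))
       = act M (Inr (Inr i)) (act M (Inl (Inr i)) x)) \<and>
    (\<forall>i. \<forall>y\<in>vspace M (Inr i). act M (Inl (Inr i)) (act M (Inr (Inr i)) y) = 0)"
proof -
  let ?G = "double_quiver (framed_quiver Q)"
  show ?thesis
  proof (cases "is_rep ?G M")
    case True
    then have vs: "vector_space (scalar M)" by (simp add: is_rep_def)
    interpret vector_space "scalar M" by (fact vs)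
    have fin: "finite (in_arcs (double_quiver Q) i)" for i
      using assms by (simp add: in_arcs_def double_quiver_def)
    have inj: "inj_on (map_sum Inl Inl) S" for S :: "('e + 'e) set"
      by (auto intro!: inj_onI simp: map_sum_def split: sum.splits)
    have in_Q: "in_arcs (double_quiver Q) i =
      Inl ` {e \<in> arcs Q. head Q e = i} \<union> Inr ` {e \<in> arcs Q. tail Q e = i}" for i
      by (auto simp: in_arcs_def double_quiver_def)
    have in_l: "in_arcs ?G (Inl i) =
      insert (Inr (Inr i)) (map_sum Inl Inl ` in_arcs (double_quiver Q) i)" for i
      unfolding in_Q using assms(1)
      by (auto simp: in_arcs_def double_quiver_def framed_quiver_def image_Un image_image)
    have in_r: "in_arcs ?G (Inr i) = {Inl (Inr i)}" for i
      using assms(1)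
      by (auto simp: in_arcs_def double_quiver_def framed_quiver_def elim!: PlusE)
    have st: "star (map_sum Inl Inl a) = map_sum Inl Inl (star a)" for a :: "'e + 'e"
      by (cases a) auto
    have sg: "arrow_sign (map_sum Inl Inl a) = (arrow_sign a :: 'k)" for a :: "'e + 'e"
      by (cases a) auto
    have notin: "Inr (Inr i) \<notin> map_sum Inl Inl ` S" for i :: 'i and S :: "('e + 'e) set"
      by (auto simp: map_sum_def split: sum.splits)
    have "(\<Sum>a\<in>in_arcs ?G (Inl i). scalar M (arrow_sign a) (act M a (act M (star a) x))) =
        (\<Sum>a\<in>in_arcs (double_quiver Q) i. scalar M (arrow_sign a)
          (act M (map_sum Inl Inl a) (act M (map_sum Inl Inl (star a)) x)))
       - act M (Inr (Inr i)) (act M (Inl (Inr i)) x)" for i x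
      unfolding in_l
      by (subst sum.insert[OF finite_imageI[OF fin] notin])
        (simp add: sum.reindex[OF inj] st sg o_def)
    moreover have "(\<Sum>a\<in>in_arcs ?G (Inr i). scalar M (arrow_sign a) (act M a (act M (star a) x)))
       = act M (Inl (Inr i)) (act M (Inr (Inr i)) x)" for i x
      unfolding in_r by simp
    moreover have "verts (framed_quiver Q) = Inl ` UNIV \<union> Inr ` UNIV"
      using assms(1) by (auto simp: framed_quiver_def Plus_def)
    ultimately show ?thesis
      using True by (simp add: preprojective_module_def ball_Un)
  qed (simp add: preprojective_module_def)
qed

definition simple_module :: "'i \<Rightarrow> ('k::field, 'k, 'i, 'h) rep" where
  "simple_module i = \<lparr>scalar = (*), vspace = \<lambda>j. if j = i then UNIV else {0}, act = \<lambda>_ _. 0\<rparr>"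

text \<open>
  The arrows leaving \<open>Inl i\<close> in the double of the framed quiver are those of \<open>H\<close> with source \<open>i\<close>,
  and \<open>d\<^sub>i\<close>.
\<close>

definition stable ::
  "('i, 'e) pre_digraph \<Rightarrow>
   ('k::field, 'v::ab_group_add, 'i + 'i, ('e + 'i) + ('e + 'i)) rep \<Rightarrow> bool" where
  "stable Q M \<longleftrightarrow> (\<forall>i\<in>verts Q.
     inj_on (\<lambda>x. \<lambda>a\<in>out_arcs (double_quiver (framed_quiver Q)) (Inl i). act M a x)
       (vspace M (Inl i)))"


section \<open>Roots, weights and the Weyl group\<close>

text \<open>
  Elements of the root lattice are given by their coordinates on the simple roots; weights are
  given by their coordinates on the fundamental weights, so that the \<open>i\<close>-th coordinate of
  a weight \<open>\<mu>\<close> is \<open>\<langle>\<mu>, \<alpha>\<^sub>i\<rangle>\<close>.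
\<close>

type_synonym 'i root_vec = "'i \<Rightarrow> int"
type_synonym 'i weight = "'i \<Rightarrow> int"

definition root_form ::
  "('i::finite, 'e) pre_digraph \<Rightarrow> 'i root_vec \<Rightarrow> 'i root_vec \<Rightarrow> int" where
  "root_form Q \<mu> \<nu> = 2 * (\<Sum>i\<in>verts Q. \<mu> i * \<nu> i) -
     (\<Sum>a\<in>arcs (double_quiver Q). \<nu> (tail (double_quiver Q) a) * \<mu> (head (double_quiver Q) a))"

definition simple_root :: "'i \<Rightarrow> 'i root_vec" where
  "simple_root i = (\<lambda>j. if j = i then 1 else 0)"

definition fundamental_weight :: "'i \<Rightarrow> 'i weight" where
  "fundamental_weight i = (\<lambda>j. if j = i then 1 else 0)"

text \<open>The embedding of the root lattice into the weight lattice.\<close>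

definition root_to_weight ::
  "('i::finite, 'e) pre_digraph \<Rightarrow> 'i root_vec \<Rightarrow> 'i weight" where
  "root_to_weight Q \<nu> = (\<lambda>j. root_form Q \<nu> (simple_root j))"

definition simple_reflection ::
  "('i::finite, 'e) pre_digraph \<Rightarrow> 'i \<Rightarrow> 'i weight \<Rightarrow> 'i weight" where
  "simple_reflection Q i \<mu> = (\<lambda>j. \<mu> j - \<mu> i * root_to_weight Q (simple_root i) j)"

text \<open>The simple reflections are involutions, so closure under inverses is automatic.\<close>

inductive_set weyl_group ::
  "('i::finite, 'e) pre_digraph \<Rightarrow> ('i weight \<Rightarrow> 'i weight) set"
  for Q :: "('i::finite, 'e) pre_digraph" where
  "id \<in> weyl_group Q"
| "w \<in> weyl_group Q \<Longrightarrow> i \<in> verts Q \<Longrightarrow> simple_reflection Q i \<circ> w \<in> weyl_group Q"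

definition antidominant :: "'i weight \<Rightarrow> bool" where
  "antidominant \<kappa> \<longleftrightarrow> (\<forall>i. \<kappa> i \<le> 0)"

definition same_chamber ::
  "('i::finite, 'e) pre_digraph \<Rightarrow> 'i weight \<Rightarrow> 'i weight \<Rightarrow> bool" where
  "same_chamber Q \<gamma> \<delta> \<longleftrightarrow> (\<exists>w\<in>weyl_group Q. \<exists>\<kappa> \<mu>.
     antidominant \<kappa> \<and> antidominant \<mu> \<and> \<gamma> = w \<kappa> \<and> \<delta> = w \<mu>)"


section \<open>The modules \<open>N(\<gamma>)\<close>\<close>

definition is_N_hat ::
  "('i::finite, 'e) pre_digraph \<Rightarrow> 'i weight \<Rightarrow>
   ('k::field, 'v::ab_group_add, 'i + 'i, ('e + 'i) + ('e + 'i)) rep \<Rightarrow> bool" where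
  "is_N_hat Q \<gamma> M \<longleftrightarrow> (\<exists>\<kappa>. \<exists>w\<in>weyl_group Q. antidominant \<kappa> \<and> \<gamma> = w \<kappa> \<and>
     preprojective_module (framed_quiver Q) M \<and> stable Q M \<and>
     root_to_weight Q (\<lambda>i. dim_vector M (Inl i)) = w \<kappa> - \<kappa> \<and>
     - (\<lambda>i. dim_vector M (Inr i)) = \<kappa>)"

text \<open>
  The modules are determined up to isomorphism, and a representative is chosen inside
  the ambient space \<open>nat \<Rightarrow> 'k\<close>, which contains spaces of every finite dimension.
\<close>

definition N_hat ::
  "('i::finite, 'e) pre_digraph \<Rightarrow> 'i weight \<Rightarrow>
   ('k::field, nat \<Rightarrow> 'k, 'i + 'i, ('e + 'i) + ('e + 'i)) rep" where
  "N_hat Q \<gamma> = (SOME M. is_N_hat Q \<gamma> M)"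

definition primed_part ::
  "('k, 'v::zero, 'i + 'i, 'h) rep \<Rightarrow> 'i + 'i \<Rightarrow> 'v set" where
  "primed_part M = case_sum (\<lambda>i. {0}) (\<lambda>i. vspace M (Inr i))"

definition unprimed_rep ::
  "('k, 'v, 'i + 'i, ('e + 'i) + ('e + 'i)) rep \<Rightarrow> ('k, 'v, 'i, 'e + 'e) rep" where
  "unprimed_rep M = \<lparr>scalar = scalar M, vspace = \<lambda>i. vspace M (Inl i),
     act = \<lambda>a. act M (map_sum Inl Inl a)\<rparr>"

definition N_module ::
  "('i::finite, 'e) pre_digraph \<Rightarrow> 'i weight \<Rightarrow> ('k::field, nat \<Rightarrow> 'k, 'i, 'e + 'e) rep" where
  "N_module Q \<gamma> = unprimed_rep (SOME L.
     is_quotient (double_quiver (framed_quiver Q)) (N_hat Q \<gamma>) (primed_part (N_hat Q \<gamma>)) L)"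

end

theory Submission
  imports Defs
begin

text \<open>
  For a vertex \<open>i\<close> of the framed quiver let \<open>T\<^sub>i\<close> be the product of the spaces at the heads of the arrows
  leaving \<open>i\<close>, with the maps \<open>out : M\<^sub>i \<rightarrow> T\<^sub>i\<close> and \<open>in : T\<^sub>i \<rightarrow> M\<^sub>i\<close>, so that \<open>in \<circ> out = 0\<close>. In a stable
  module, \<open>M\<^sub>i\<close> can be replaced by any subspace of \<open>T\<^sub>i\<close> between \<open>im (out \<circ> in)\<close> and \<open>ker in\<close> without
  losing the relations or stability. Hence the set of dimension vectors of stable modules is invariant
  under the Weyl group, and all its elements are nonnegative. For \<open>\<gamma> = w \<lambda>\<close> with \<open>\<langle>\<gamma>, \<alpha>\<^sub>i\<rangle> > 0\<close> this
  forces \<open>im out = ker in\<close>, since otherwise both \<open>c w\<^sup>-\<^sup>1 \<alpha>\<^sub>i\<close> and \<open>- c' w\<^sup>-\<^sup>1 \<alpha>\<^sub>i\<close> would be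
  dimension vectors up to the framing, for some \<open>c, c' > 0\<close>. So \<open>M\<close> is recovered from the submodule with
  \<open>im in\<close> at \<open>i\<close>, which is stable of weight \<open>s\<^sub>i \<gamma>\<close>; positive definiteness of the form provides such an \<open>i\<close>
  whenever \<open>\<gamma> \<noteq> \<lambda>\<close>, and uniqueness follows by induction on the dimension.

  With framing zero the same descent shows that a nonzero module over the preprojective algebra is never
  stable, hence has some \<open>S\<^sub>j\<close> in its socle. A module with socle \<open>S\<^sub>i\<close> becomes stable after adding a line
  at \<open>i'\<close> and a functional that does not vanish on the socle, and a direct sum of stable modules is stable:
  parts (ii) and (iii) then follow from uniqueness.
\<close>

section \<open>Finite-dimensional subspaces\<close>

text \<open>No theory of root systems is assumed. What is needed of the dichotomy between positive
  and negative roots, and of the antidominant cone as a fundamental domain, comes from the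
  nonnegativity of dimension vectors of stable modules; an antidominant conjugate is found from a
  quantitative form of positive definiteness, without finiteness of the Weyl group.

  The arguments are made for a quiver without loops and a set \<open>J\<close> of vertices at which
  stability is imposed and reflections take place, the others being frozen. \<open>J\<close>
  consists of the unprimed vertices of the framed quiver in the study of \<open>N_hat\<close>, and
  of all vertices of \<open>Q\<close> in that of socles.

  A reflection replaces the ambient type by a type of functions into it, so that its iterates would
  live in different types; each reflected module is therefore copied into \<open>nat => 'k\<close>.
  The descent in the uniqueness proof takes subspaces and stays in the given types. The same descent
  shows that the arrows from \<open>i'\<close> to \<open>i\<close> act by zero, so that the primed
  part is a submodule.\<close>

definition fin_dim :: "('k::field \<Rightarrow> 'v::ab_group_add \<Rightarrow> 'v) \<Rightarrow> 'v set \<Rightarrow> bool" where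
  "fin_dim s V \<longleftrightarrow> module.subspace s V \<and> (\<exists>B. finite B \<and> V = module.span s B)"

lemma fin_dim_subspace: "fin_dim s V \<Longrightarrow> module.subspace s V"
  by (simp add: fin_dim_def)

context vector_space
begin

lemma fin_dim_basis:
  assumes "fin_dim scale V"
  obtains B where "finite B" "independent B" "span B = V" "card B = dim V"
proof -
  obtain B where B: "B \<subseteq> V" "independent B" "V \<subseteq> span B" "card B = dim V"
    by (rule basis_exists)
  obtain C where "finite C" "V = span C" using assms by (auto simp: fin_dim_def)
  then have "finite B" using independent_span_bound[of C B] B by blast
  moreover have "span B = V"
    using B assms by (simp add: span_subspace fin_dim_def)
  ultimately show ?thesis using that B by blast
qed

lemma fin_dim_span: "finite B \<Longrightarrow> fin_dim scale (span B)"
  by (auto simp: fin_dim_def)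

lemma fin_dim_subset:
  assumes V: "fin_dim scale V" and U: "subspace U" "U \<subseteq> V"
  shows "fin_dim scale U" "dim U \<le> dim V"
proof -
  obtain B where B: "finite B" "span B = V" "card B = dim V"
    using V by (rule fin_dim_basis)
  obtain C where C: "C \<subseteq> U" "independent C" "U \<subseteq> span C" "card C = dim U"
    by (rule basis_exists)
  have "C \<subseteq> span B" using B C U by auto
  then have "finite C \<and> card C \<le> card B" by (intro independent_span_bound B C)
  moreover have "span C = U" using C U by (simp add: span_subspace)
  ultimately show "fin_dim scale U" "dim U \<le> dim V"
    using fin_dim_span B C by auto
qed

text \<open>A basis of \<open>U\<close> is extended to one of \<open>V\<close> and cut down to
  \<open>m\<close> vectors. This provides the space of prescribed dimension that is put at a
  reflected vertex.\<close>

lemma fin_dim_between: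
  assumes V: "fin_dim scale V" and U: "subspace U" "U \<subseteq> V" and m: "dim U \<le> m" "m \<le> dim V"
  obtains X where "subspace X" "U \<subseteq> X" "X \<subseteq> V" "dim X = m"
proof -
  obtain A where A: "finite A" "independent A" "span A = U" "card A = dim U"
    using fin_dim_subset(1)[OF V U] by (rule fin_dim_basis)
  have "A \<subseteq> V" using A U span_superset by blast
  then obtain B where B: "A \<subseteq> B" "B \<subseteq> V" "independent B" "V \<subseteq> span B"
    using maximal_independent_subset_extend A(2) by metis
  have spB: "span B = V" using B V by (simp add: span_subspace fin_dim_def)
  have "card B = dim V" using B by (simp add: basis_card_eq_dim)
  moreover obtain D where "finite D" "V = span D" using V by (auto simp: fin_dim_def)
  then have "finite B" using independent_span_bound[of D B] B by blast
  ultimately obtain C where C: "A \<subseteq> C" "C \<subseteq> B" "card C = m"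
    using exists_subset_between[of A m B] A m B by auto
  show ?thesis
  proof
    show "subspace (span C)" by simp
    show "U \<subseteq> span C" using A C span_mono by blast
    show "span C \<subseteq> V" using C spB span_mono by blast
    show "dim (span C) = m" using B C independent_mono dim_span_eq_card_independent by blast
  qed
qed

lemma fin_dim_eqI:
  assumes V: "fin_dim scale V" and U: "subspace U" "U \<subseteq> V" and m: "dim U = dim V"
  shows "U = V"
proof -
  obtain A where A: "finite A" "independent A" "span A = U" "card A = dim U"
    using fin_dim_subset(1)[OF V U] by (rule fin_dim_basis)
  have "A \<subseteq> V" using A U span_superset by blast
  then obtain B where B: "A \<subseteq> B" "B \<subseteq> V" "independent B" "V \<subseteq> span B"
    using maximal_independent_subset_extend A(2) by metis
  have "card B = dim V" using B by (simp add: basis_card_eq_dim)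
  moreover obtain D where "finite D" "V = span D" using V by (auto simp: fin_dim_def)
  then have "finite B" using independent_span_bound[of D B] B by blast
  ultimately have "A = B" using card_subset_eq B A m by metis
  then show ?thesis using A B U by blast
qed

text \<open>The default value of \<open>dim\<close> on a space without finite basis is 0 as well,
  hence the hypothesis \<open>fin_dim\<close>.\<close>

lemma dim_0_imp_eq_0:
  assumes V: "fin_dim scale V" and "dim V = 0"
  shows "V = {0}"
  using fin_dim_basis[OF V] assms by (metis card_0_eq span_empty)

lemma dim_eq_0_iff: "fin_dim scale V \<Longrightarrow> dim V = 0 \<longleftrightarrow> V = {0}"
  using dim_0_imp_eq_0 dim_eq_card_independent[OF independent_empty] dim_span[of "{}"] by auto

lemma fin_dim_zero: "fin_dim scale {0}"
  using fin_dim_span[of "{}"] by simp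

end

subsection \<open>Linear maps between subspaces\<close>

lemma linear_betweenD:
  assumes "linear_between s V t W f"
  shows "x \<in> V \<Longrightarrow> f x \<in> W" "x \<in> V \<Longrightarrow> y \<in> V \<Longrightarrow> f (x + y) = f x + f y"
    "x \<in> V \<Longrightarrow> f (s c x) = t c (f x)"
  using assms by (auto simp: linear_between_def)

lemma linear_betweenI:
  assumes "\<And>x. x \<in> V \<Longrightarrow> f x \<in> W" "\<And>x y. x \<in> V \<Longrightarrow> y \<in> V \<Longrightarrow> f (x + y) = f x + f y"
    "\<And>c x. x \<in> V \<Longrightarrow> f (s c x) = t c (f x)"
  shows "linear_between s V t W f"
  using assms by (auto simp: linear_between_def)

lemma linear_between_compose:
  "linear_between s V t W f \<Longrightarrow> linear_between t W u X g \<Longrightarrow> linear_between s V u X (\<lambda>x. g (f x))"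
  by (rule linear_betweenI) (auto simp: linear_betweenD)

lemma linear_between_mono:
  "linear_between s V t W f \<Longrightarrow> U \<subseteq> V \<Longrightarrow> f ` U \<subseteq> X \<Longrightarrow> linear_between s U t X f"
  unfolding linear_between_def by blast

text \<open>The maps of a representation are linear on the space at the source and arbitrary
  elsewhere, whereas the library treats maps that are linear on a whole type. \<open>extend\<close>
  links the two, by extending from a basis of \<open>V\<close>.\<close>

locale sub_hom = vector_space_pair s t
  for s :: "'k::field \<Rightarrow> 'v::ab_group_add \<Rightarrow> 'v" and t :: "'k \<Rightarrow> 'w::ab_group_add \<Rightarrow> 'w" +
  fixes V W f
  assumes lin: "linear_between s V t W f" and sub: "module.subspace s V"
begin

lemma extend: obtains g where "Vector_Spaces.linear s t g" "\<And>x. x \<in> V \<Longrightarrow> g x = f x"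
proof -
  obtain B where B: "B \<subseteq> V" "vs1.independent B" "V \<subseteq> vs1.span B" by (rule vs1.basis_exists)
  obtain g where g: "Vector_Spaces.linear s t g" "\<forall>x\<in>B. g x = f x"
    using linear_independent_extend[OF B(2), of f] by blast
  interpret g: Vector_Spaces.linear s t g by (rule g(1))
  have f0: "f 0 = 0"
    using linear_betweenD(3)[OF lin vs1.subspace_0[OF sub], of 0] by simp
  have "x \<in> vs1.span B \<Longrightarrow> x \<in> V \<and> g x = f x" for x
  proof (induction rule: vs1.span_induct_alt)
    case base
    show ?case using f0 g.zero vs1.subspace_0[OF sub] by simp
  next
    case (step c x y)
    then have "x \<in> V" "y \<in> V" "s c x \<in> V" using B sub by (auto simp: vs1.subspace_scale)
    then show ?case using step sub g lin
      by (simp add: vs1.subspace_add g.add g.scale linear_betweenD)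
  qed
  then show ?thesis using that g(1) B by blast
qed

lemma map_zero: "f 0 = 0"
  using linear_betweenD(3)[OF lin vs1.subspace_0[OF sub], of 0] by simp

lemma map_diff: "x \<in> V \<Longrightarrow> y \<in> V \<Longrightarrow> f (x - y) = f x - f y"
  using linear_betweenD(2)[OF lin, of "x - y" y] vs1.subspace_diff[OF sub, of x y] by simp

lemma map_sum: "(\<And>a. a \<in> A \<Longrightarrow> h a \<in> V) \<Longrightarrow> f (\<Sum>a\<in>A. h a) = (\<Sum>a\<in>A. f (h a))"
  by (induction A rule: infinite_finite_induct)
    (auto simp: map_zero linear_betweenD(2)[OF lin] vs1.subspace_sum[OF sub])

lemma inj_iff: "inj_on f V \<longleftrightarrow> (\<forall>x\<in>V. f x = 0 \<longrightarrow> x = 0)"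
proof
  show "\<forall>x\<in>V. f x = 0 \<longrightarrow> x = 0" if "inj_on f V"
    using that map_zero vs1.subspace_0[OF sub] by (metis inj_onD)
  show "inj_on f V" if "\<forall>x\<in>V. f x = 0 \<longrightarrow> x = 0"
  proof (rule inj_onI)
    fix x y assume "x \<in> V" "y \<in> V" "f x = f y"
    then have "f (x - y) = 0" "x - y \<in> V" using vs1.subspace_diff[OF sub] by (auto simp: map_diff)
    with that show "x = y" by force
  qed
qed

lemma ker_inj: "inj_on f V \<Longrightarrow> {x \<in> V. f x = 0} = {0}"
  unfolding inj_iff using map_zero vs1.subspace_0[OF sub] by blast

lemma subspace_ker: "vs1.subspace {x \<in> V. f x = 0}"
proof (rule vs1.subspaceI)
qed (use sub lin in \<open>auto simp: map_zero linear_betweenD vs1.subspace_0 vs1.subspace_add vs1.subspace_scale\<close>)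

lemma subspace_img: assumes "vs1.subspace U" "U \<subseteq> V" shows "vs2.subspace (f ` U)"
proof -
  obtain g where g: "Vector_Spaces.linear s t g" "\<And>x. x \<in> V \<Longrightarrow> g x = f x" using extend by blast
  interpret g: Vector_Spaces.linear s t g by (rule g(1))
  have "f ` U = g ` U" using g(2) assms(2) by (intro image_cong) auto
  then show ?thesis using g.subspace_image assms by simp
qed

text \<open>Finite dimension of \<open>V\<close> is concluded from that of the kernel and of the
  image: a basis \<open>K\<close> of the kernel and lifts of a basis \<open>C\<close> of the image
  form a basis. In this form the lemma builds products and handles spaces that inject into known
  ones.\<close>

lemma rank_nullity':
  assumes K: "fin_dim s {x \<in> V. f x = 0}" and I: "fin_dim t (f ` V)"
  shows "fin_dim s V" "vs1.dim V = vs1.dim {x \<in> V. f x = 0} + vs2.dim (f ` V)"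
proof -
  obtain g where g: "Vector_Spaces.linear s t g" "\<And>x. x \<in> V \<Longrightarrow> g x = f x" using extend by blast
  interpret g: Vector_Spaces.linear s t g by (rule g(1))
  obtain K where K: "finite K" "vs1.independent K" "vs1.span K = {x \<in> V. f x = 0}"
      "card K = vs1.dim {x \<in> V. f x = 0}"
    using K by (rule vs1.fin_dim_basis)
  obtain C where C: "finite C" "vs2.independent C" "vs2.span C = f ` V"
      "card C = vs2.dim (f ` V)"
    using I by (rule vs2.fin_dim_basis)
  have "C \<subseteq> f ` V" using C(3) vs2.span_superset by blast
  then have "\<forall>c\<in>C. \<exists>x. x \<in> V \<and> g x = c" using g(2) by (metis imageE subset_iff)
  then obtain h where "\<forall>c\<in>C. h c \<in> V \<and> g (h c) = c" using bchoice by metis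
  then have h: "\<And>c. c \<in> C \<Longrightarrow> h c \<in> V" "\<And>c. c \<in> C \<Longrightarrow> g (h c) = c" by auto
  have injh: "inj_on h C" using h(2) by (rule inj_on_inverseI)
  have KV: "K \<subseteq> V" and gK: "\<And>x. x \<in> K \<Longrightarrow> g x = 0" using K vs1.span_superset[of K] g(2) by auto
  have disj: "K \<inter> h ` C = {}"
  proof -
    have False if "c \<in> C" "h c \<in> K" for c
    proof -
      have "c = 0" using h(2)[OF that(1)] gK[OF that(2)] by simp
      then show False using C(2) that vs2.dependent_zero by blast
    qed
    then show ?thesis by auto
  qed
  let ?B = "K \<union> h ` C"
  have BV: "?B \<subseteq> V" using KV h by auto
  have span: "vs1.span ?B = V"
  proof
    show "vs1.span ?B \<subseteq> V" using BV sub by (rule vs1.span_minimal)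
    show "V \<subseteq> vs1.span ?B"
    proof
      fix x assume x: "x \<in> V"
      have "g ` vs1.span (h ` C) = vs2.span (g ` h ` C)" by (simp add: g.span_image)
      also have "g ` h ` C = C" using h by force
      finally have "g x \<in> g ` vs1.span (h ` C)" using C x g by auto
      then obtain z where z: "z \<in> vs1.span (h ` C)" "g x = g z" by auto
      have zV: "z \<in> V" using z(1) vs1.span_minimal[of "h ` C" V] h sub by auto
      have "x - z \<in> vs1.span K"
        unfolding K using x zV z(2) g(2) sub by (auto simp: vs1.subspace_diff map_diff)
      then have "(x - z) + z \<in> vs1.span ?B"
        using z(1) by (intro vs1.span_add) (auto intro: vs1.span_mono[THEN subsetD])
      then show "x \<in> vs1.span ?B" by simp
    qed
  qed
  have fB: "finite ?B" using K C by simp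
  have ind: "vs1.independent ?B"
  proof (rule vs1.independent_if_scalars_zero[OF fB])
    fix u x assume 0: "(\<Sum>x\<in>?B. s (u x) x) = 0" and x: "x \<in> ?B"
    have split: "(\<Sum>x\<in>?B. s (u x) x) = (\<Sum>x\<in>K. s (u x) x) + (\<Sum>c\<in>C. s (u (h c)) (h c))"
      using K C disj by (subst sum.union_disjoint) (auto simp: sum.reindex[OF injh])
    have "g (\<Sum>x\<in>?B. s (u x) x) = (\<Sum>c\<in>C. t (u (h c)) c)"
      unfolding split by (simp add: g.add g.sum g.scale gK h)
    then have s0: "(\<Sum>c\<in>C. t (u (h c)) c) = 0" using 0 g.zero by simp
    have uC: "u (h c) = 0" if "c \<in> C" for c
      using vs2.independentD[OF C(2,1) _ s0] that by blast
    have K0: "(\<Sum>x\<in>K. s (u x) x) = 0" using 0 split uC by simp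
    show "u x = 0"
      using x uC vs1.independentD[OF K(2,1) subset_refl K0] by auto
  qed
  show "fin_dim s V" using vs1.fin_dim_span[OF fB] span by simp
  show "vs1.dim V = vs1.dim {x \<in> V. f x = 0} + vs2.dim (f ` V)"
    using vs1.dim_span_eq_card_independent[OF ind] span K C disj
    by (simp add: card_Un_disjoint card_image[OF injh])
qed

lemma fin_dim_img: assumes "fin_dim s V" shows "fin_dim t (f ` V)"
proof -
  obtain g where g: "Vector_Spaces.linear s t g" "\<And>x. x \<in> V \<Longrightarrow> g x = f x" using extend by blast
  interpret g: Vector_Spaces.linear s t g by (rule g(1))
  obtain B where B: "finite B" "vs1.span B = V" using assms by (rule vs1.fin_dim_basis)
  have "f ` V = g ` V" using g by auto
  also have "\<dots> = vs2.span (g ` B)" using B by (simp add: g.span_image)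
  finally show ?thesis using B vs2.fin_dim_span by simp
qed

lemma rank_nullity:
  assumes "fin_dim s V"
  shows "vs1.dim V = vs1.dim {x \<in> V. f x = 0} + vs2.dim (f ` V)"
  using fin_dim_img[OF assms] vs1.fin_dim_subset(1)[OF assms subspace_ker]
  by (intro rank_nullity'(2)) blast+

lemma dim_img_inj:
  assumes "fin_dim s V" "inj_on f V"
  shows "vs2.dim (f ` V) = vs1.dim V"
proof -
  have "{x \<in> V. f x = 0} = {0}" by (rule ker_inj[OF assms(2)])
  then show ?thesis
    using rank_nullity[OF assms(1)] vs1.dim_eq_0_iff[OF vs1.fin_dim_zero] by simp
qed

lemma fin_dim_inj:
  assumes "fin_dim t W" "inj_on f V"
  shows "fin_dim s V" "vs1.dim V \<le> vs2.dim W"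
proof -
  have "{x \<in> V. f x = 0} = {0}" by (rule ker_inj[OF assms(2)])
  moreover have fW: "f ` V \<subseteq> W" "vs2.subspace (f ` V)"
    using linear_betweenD(1)[OF lin] subspace_img[OF sub] by auto
  ultimately show "fin_dim s V"
    using vs1.fin_dim_zero vs2.fin_dim_subset[OF assms(1)] by (intro rank_nullity') auto
  then show "vs1.dim V \<le> vs2.dim W"
    using dim_img_inj assms(2) vs2.fin_dim_subset(2)[OF assms(1) fW(2,1)] by simp
qed

lemma inverse:
  assumes "bij_betw f V W"
  shows "linear_between t W s V (inv_into V f)"
proof (rule linear_betweenI)
  note i = bij_betw_inv_into_right[OF assms] bij_betw_inv_into_left[OF assms]
  have inW: "inv_into V f x \<in> V" if "x \<in> W" for x
    using assms that by (metis bij_betw_imp_surj_on inv_into_into)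
  show "inv_into V f x \<in> V" if "x \<in> W" for x by (rule inW[OF that])
  show "inv_into V f (x + y) = inv_into V f x + inv_into V f y" if "x \<in> W" "y \<in> W" for x y
  proof -
    have "f (inv_into V f x + inv_into V f y) = x + y"
      using that inW by (simp add: i linear_betweenD(2)[OF lin])
    then show ?thesis using i(2) that inW vs1.subspace_add[OF sub] by metis
  qed
  show "inv_into V f (t c x) = s c (inv_into V f x)" if "x \<in> W" for c x
  proof -
    have "f (s c (inv_into V f x)) = t c x"
      using that inW by (simp add: i linear_betweenD(3)[OF lin])
    then show ?thesis using i(2) that inW vs1.subspace_scale[OF sub] by metis
  qed
qed

end

lemma sub_homI:
  "vector_space s \<Longrightarrow> vector_space t \<Longrightarrow> linear_between s V t W f \<Longrightarrow> module.subspace s V \<Longrightarrow>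
    sub_hom s t V W f"
  by (simp add: sub_hom_def vector_space_pair_def sub_hom_axioms_def)

lemma fin_dim_isomorphic:
  assumes s: "vector_space s" and t: "vector_space t" and V: "fin_dim s V" and W: "fin_dim t W"
    and d: "vector_space.dim s V = vector_space.dim t W"
  obtains f where "linear_between s V t W f" "bij_betw f V W"
proof -
  interpret vector_space_pair s t using s t by (simp add: vector_space_pair_def)
  obtain B where B: "finite B" "vs1.independent B" "vs1.span B = V" "card B = vs1.dim V"
    using V by (rule vs1.fin_dim_basis)
  obtain C where C: "finite C" "vs2.independent C" "vs2.span C = W" "card C = vs2.dim W"
    using W by (rule vs2.fin_dim_basis)
  have "card B = card C" using d B C by simp
  then obtain b where b: "bij_betw b B C" using finite_same_card_bij B(1) C(1) by blast
  obtain g where g: "Vector_Spaces.linear s t g" "\<forall>x\<in>B. g x = b x"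
    using linear_independent_extend[OF B(2), of b] by blast
  interpret g: Vector_Spaces.linear s t g by (rule g(1))
  have gB: "g ` B = C" using g b by (auto simp: bij_betw_def)
  have "inj_on g B" using g b by (metis bij_betw_def inj_on_cong)
  then have inj: "inj_on g V"
    using g.inj_on_span_iff_independent_image[of B] gB C B by simp
  have img: "g ` V = W" using g.span_image[of B] B C gB by simp
  have "linear_between s V t W g"
    using img by (auto simp: linear_between_def g.add g.scale)
  then show ?thesis using that inj img by (auto simp: bij_betw_def)
qed

subsection \<open>Functions, products and coordinate spaces\<close>

definition fun_scale :: "('k \<Rightarrow> 'v \<Rightarrow> 'v) \<Rightarrow> 'k \<Rightarrow> ('h \<Rightarrow> 'v) \<Rightarrow> 'h \<Rightarrow> 'v" where
  "fun_scale s c y = (\<lambda>a. s c (y a))"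

lemma vector_space_fun_scale:
  assumes "vector_space s" shows "vector_space (fun_scale s)"
proof -
  interpret vector_space s by fact
  show ?thesis
    by unfold_locales (auto simp: fun_scale_def fun_eq_iff scale_right_distrib scale_left_distrib)
qed

lemma vector_space_map_prod:
  assumes "vector_space s" "vector_space t" shows "vector_space (\<lambda>c. map_prod (s c) (t c))"
proof -
  interpret s: vector_space s by fact
  interpret t: vector_space t by fact
  show ?thesis
    by unfold_locales (auto simp: s.scale_right_distrib s.scale_left_distrib
      t.scale_right_distrib t.scale_left_distrib)
qed

lemma vector_space_times: "vector_space ((*) :: 'k::field \<Rightarrow> 'k \<Rightarrow> 'k)"
  by unfold_locales (auto simp: algebra_simps)

lemma fin_dim_UNIV_times:
  "fin_dim ((*) :: 'k::field \<Rightarrow> 'k \<Rightarrow> 'k) UNIV" "vector_space.dim ((*) :: 'k::field \<Rightarrow> 'k \<Rightarrow> 'k) UNIV = 1"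
proof -
  interpret vector_space "(*) :: 'k \<Rightarrow> 'k \<Rightarrow> 'k" by (rule vector_space_times)
  have "span {1::'k} = UNIV" by (auto simp: span_singleton)
  then show "fin_dim ((*) :: 'k \<Rightarrow> 'k \<Rightarrow> 'k) UNIV" "dim (UNIV :: 'k set) = 1"
    using fin_dim_span[of "{1}"] dim_span_eq_card_independent[of "{1}"] by auto
qed

text \<open>The value 0 outside \<open>A\<close>, where \<open>PiE\<close> would have
  \<open>undefined\<close>, makes this a subspace of the function space when the factors are
  subspaces.\<close>

definition pi_space :: "'h set \<Rightarrow> ('h \<Rightarrow> 'v::zero set) \<Rightarrow> ('h \<Rightarrow> 'v) set" where
  "pi_space A V = {y. (\<forall>a\<in>A. y a \<in> V a) \<and> (\<forall>a. a \<notin> A \<longrightarrow> y a = 0)}"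

lemma subspace_pi_space:
  fixes s :: "'k::field \<Rightarrow> 'v::ab_group_add \<Rightarrow> 'v" and A :: "'h set"
  assumes s: "vector_space s" and V: "\<And>a. a \<in> A \<Longrightarrow> module.subspace s (V a)"
  shows "module.subspace (fun_scale s) (pi_space A V)"
proof -
  interpret vector_space s by fact
  interpret f: vector_space "fun_scale s :: 'k \<Rightarrow> ('h \<Rightarrow> 'v) \<Rightarrow> _"
    using s by (rule vector_space_fun_scale)
  show ?thesis
    by (rule f.subspaceI)
      (auto simp: pi_space_def fun_scale_def V subspace_0 subspace_add subspace_scale)
qed

lemma fin_dim_pi_space:
  fixes s :: "'k::field \<Rightarrow> 'v::ab_group_add \<Rightarrow> 'v" and A :: "'h set"
  assumes s: "vector_space s" and A: "finite A" and V: "\<And>a. a \<in> A \<Longrightarrow> fin_dim s (V a)"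
  shows "fin_dim (fun_scale s) (pi_space A V) \<and>
    vector_space.dim (fun_scale s) (pi_space A V) = (\<Sum>a\<in>A. vector_space.dim s (V a))"
  using A V
proof (induction A rule: finite_induct)
  case empty
  interpret f: vector_space "fun_scale s :: 'k \<Rightarrow> ('h \<Rightarrow> 'v) \<Rightarrow> _"
    using s by (rule vector_space_fun_scale)
  have "pi_space {} V = {0}" by (auto simp: pi_space_def fun_eq_iff)
  then show ?case using f.fin_dim_zero f.dim_eq_0_iff[OF f.fin_dim_zero] by simp
next
  case (insert a A)
  interpret s: vector_space s by fact
  interpret f: vector_space "fun_scale s :: 'k \<Rightarrow> ('h \<Rightarrow> 'v) \<Rightarrow> _"
    using s by (rule vector_space_fun_scale)
  have IH: "fin_dim (fun_scale s) (pi_space A V)"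
    "f.dim (pi_space A V) = (\<Sum>a\<in>A. s.dim (V a))"
    using insert by auto
  have Va: "fin_dim s (V a)" using insert by simp
  interpret sub_hom "fun_scale s" s "pi_space (insert a A) V" "V a" "\<lambda>y. y a"
  proof (rule sub_homI)
    show "linear_between (fun_scale s) (pi_space (insert a A) V) s (V a) (\<lambda>y. y a)"
      by (rule linear_betweenI) (auto simp: pi_space_def fun_scale_def)
    show "f.subspace (pi_space (insert a A) V)"
      using insert(4) fin_dim_subspace by (intro subspace_pi_space s) blast
  qed unfold_locales
  have ker: "{y \<in> pi_space (insert a A) V. y a = 0} = pi_space A V"
    using insert(2) s.subspace_0[OF fin_dim_subspace[OF Va]] by (fastforce simp: pi_space_def)
  have img: "(\<lambda>y. y a) ` pi_space (insert a A) V = V a"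
  proof
    show "V a \<subseteq> (\<lambda>y. y a) ` pi_space (insert a A) V"
    proof
      fix x assume "x \<in> V a"
      moreover have "0 \<in> V b" if "b \<in> A" for b
        using insert(4)[of b] that by (simp add: s.subspace_0 fin_dim_subspace)
      ultimately have "(\<lambda>b. if b = a then x else 0) \<in> pi_space (insert a A) V"
        unfolding pi_space_def by simp
      then have "(\<lambda>b. if b = a then x else 0) a \<in> (\<lambda>y. y a) ` pi_space (insert a A) V"
        by (rule imageI)
      then show "x \<in> (\<lambda>y. y a) ` pi_space (insert a A) V" by simp
    qed
    show "(\<lambda>y. y a) ` pi_space (insert a A) V \<subseteq> V a"
      unfolding pi_space_def by blast
  qed
  show ?case
    using rank_nullity' insert IH Va by (simp add: ker img)
qed

lemma coordinate_space_exists: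
  fixes d :: nat
  obtains V :: "(nat \<Rightarrow> 'k::field) set"
  where "fin_dim (fun_scale (*)) V" "vector_space.dim (fun_scale (*)) V = d"
proof -
  have "fin_dim (fun_scale (*)) (pi_space {..<d} (\<lambda>_. UNIV) :: (nat \<Rightarrow> 'k) set) \<and>
    vector_space.dim (fun_scale (*)) (pi_space {..<d} (\<lambda>_. UNIV) :: (nat \<Rightarrow> 'k) set)
      = (\<Sum>a\<in>{..<d}. vector_space.dim ((*) :: 'k \<Rightarrow> 'k \<Rightarrow> 'k) UNIV)"
    by (rule fin_dim_pi_space[OF vector_space_times]) (auto simp: fin_dim_UNIV_times)
  then show ?thesis using that by (auto simp: fin_dim_UNIV_times)
qed

lemma fin_dim_Times:
  assumes s: "vector_space s" and t: "vector_space t" and V: "fin_dim s V" and W: "fin_dim t W"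
  shows "fin_dim (\<lambda>c. map_prod (s c) (t c)) (V \<times> W)"
    "vector_space.dim (\<lambda>c. map_prod (s c) (t c)) (V \<times> W) = vector_space.dim s V + vector_space.dim t W"
proof -
  let ?p = "\<lambda>c. map_prod (s c) (t c)"
  interpret s: vector_space s by fact
  interpret t: vector_space t by fact
  interpret p: vector_space ?p using s t by (rule vector_space_map_prod)
  note VW = fin_dim_subspace[OF V] fin_dim_subspace[OF W]
  interpret fst: sub_hom ?p s "V \<times> W" V fst
  proof (rule sub_homI)
    show "linear_between ?p (V \<times> W) s V fst" by (rule linear_betweenI) auto
    show "p.subspace (V \<times> W)"
      by (rule p.subspaceI) (use VW in \<open>auto simp: s.subspace_0 s.subspace_add s.subspace_scale
        t.subspace_0 t.subspace_add t.subspace_scale zero_prod_def\<close>)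
  qed unfold_locales
  interpret k: sub_hom t ?p W "{x \<in> V \<times> W. fst x = 0}" "\<lambda>y. (0, y)"
  proof (rule sub_homI)
    show "linear_between t W ?p {x \<in> V \<times> W. fst x = 0} (\<lambda>y. (0, y))"
      by (rule linear_betweenI) (use VW in \<open>auto simp: s.subspace_0\<close>)
  qed (use t p.vector_space_axioms VW in auto)
  have ker: "{x \<in> V \<times> W. fst x = 0} = (\<lambda>y. (0, y)) ` W" using s.subspace_0[OF VW(1)] by force
  have img: "fst ` (V \<times> W) = V" using t.subspace_0[OF VW(2)] by force
  have K: "fin_dim ?p ((\<lambda>y. (0, y)) ` W)" "p.dim ((\<lambda>y. (0, y)) ` W) = t.dim W"
    using k.fin_dim_img[OF W] k.dim_img_inj[OF W] by (auto simp: inj_on_def)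
  show "fin_dim ?p (V \<times> W)" "p.dim (V \<times> W) = s.dim V + t.dim W"
    using fst.rank_nullity'[unfolded ker img] K V by simp_all
qed

section \<open>Reflections of dimension vectors\<close>

lemma star_star [simp]: "star (star a) = a"
  by (cases a) auto

lemma inj_star: "inj_on star A"
  by (rule inj_on_inverseI[of _ star]) simp

text \<open>Instantiated both with \<open>Q\<close> and with its framed quiver. Without loops a
  vertex is not its own neighbour, so changing the space at \<open>i\<close> leaves the product of
  the neighbouring spaces unchanged.\<close>

locale loopfree_quiver =
  fixes G :: "('i::finite, 'e) pre_digraph"
  assumes verts_UNIV: "verts G = UNIV" and finite_arcs: "finite (arcs G)"
    and no_loops: "\<And>a. a \<in> arcs G \<Longrightarrow> tail G a \<noteq> head G a"
begin

abbreviation "H \<equiv> double_quiver G"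

lemma verts_double [simp]: "verts H = UNIV"
  by (simp add: double_quiver_def verts_UNIV)

lemma star_double [simp]:
  "tail H (star a) = head H a" "head H (star a) = tail H a"
  "star a \<in> arcs H \<longleftrightarrow> a \<in> arcs H"
  by (cases a; force simp: double_quiver_def)+

lemma finite_arcs_double [simp]: "finite (arcs H)"
  by (simp add: double_quiver_def finite_arcs)

lemma finite_out_arcs_double [simp]: "finite (out_arcs H i)"
  by (simp add: out_arcs_def)

lemma tail_neq_head: "a \<in> arcs H \<Longrightarrow> tail H a \<noteq> head H a"
  by (cases a) (auto simp: double_quiver_def no_loops dest: no_loops[symmetric])

lemma in_arcs_double: "in_arcs H i = star ` out_arcs H i"
proof (rule set_eqI)
  fix a show "a \<in> in_arcs H i \<longleftrightarrow> a \<in> star ` out_arcs H i"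
    by (auto simp: in_arcs_def out_arcs_def image_iff intro!: exI[of _ "star a"])
qed

lemma root_to_weight_eq:
  "root_to_weight G \<nu> j = 2 * \<nu> j - (\<Sum>a\<in>out_arcs H j. \<nu> (head H a))"
proof -
  have "(\<Sum>a\<in>arcs H. simple_root j (tail H a) * \<nu> (head H a)) =
      (\<Sum>a\<in>{a \<in> arcs H. tail H a = j}. \<nu> (head H a))"
    by (rule sum.mono_neutral_cong_right) (auto simp: simple_root_def)
  moreover have "(\<Sum>i\<in>UNIV. \<nu> i * simple_root j i) = \<nu> j"
    by (simp add: simple_root_def if_distrib cong: if_cong)
  ultimately show ?thesis
    by (simp add: root_to_weight_def root_form_def verts_UNIV out_arcs_def)
qed

lemma root_form_eq: "root_form G x y = (\<Sum>j\<in>UNIV. y j * root_to_weight G x j)"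
proof -
  have "(\<Sum>j\<in>UNIV. \<Sum>a\<in>out_arcs H j. y j * x (head H a)) =
      (\<Sum>a\<in>arcs H. y (tail H a) * x (head H a))"
    using sum.group[of "arcs H" UNIV "tail H" "\<lambda>a. y (tail H a) * x (head H a)"]
    by (simp add: out_arcs_def)
  then show ?thesis
    by (simp add: root_to_weight_eq root_form_def verts_UNIV right_diff_distrib sum_subtractf
        sum_distrib_left mult.assoc mult.left_commute mult.commute)
qed

lemma root_form_commute: "root_form G x y = root_form G y x"
proof -
  have "(\<Sum>a\<in>arcs H. y (tail H a) * x (head H a)) = (\<Sum>a\<in>arcs H. y (head H a) * x (tail H a))"
    by (rule sum.reindex_bij_witness[of _ star star]) auto
  then show ?thesis by (simp add: root_form_def mult.commute)
qed

lemma root_to_weight_add: "root_to_weight G (x + y) j = root_to_weight G x j + root_to_weight G y j"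
  by (simp add: root_to_weight_eq sum.distrib)

lemma root_to_weight_cmult:
  "root_to_weight G (\<lambda>k. c * x k) j = c * root_to_weight G x j"
  by (simp add: root_to_weight_eq sum_distrib_left right_diff_distrib)

lemma root_to_weight_diff:
  "root_to_weight G (x - y) j = root_to_weight G x j - root_to_weight G y j"
  by (simp add: root_to_weight_eq sum_subtractf)

lemma root_to_weight_simple_root_self: "root_to_weight G (simple_root i) i = 2"
proof -
  have "(\<Sum>a\<in>out_arcs H i. simple_root i (head H a)) = 0"
    using tail_neq_head by (intro sum.neutral) (auto simp: simple_root_def out_arcs_def)
  then show ?thesis by (simp add: root_to_weight_eq) (simp add: simple_root_def)
qed

lemma root_form_linear:
  "root_form G x (y + z) = root_form G x y + root_form G x z"
  "root_form G (y + z) x = root_form G y x + root_form G z x"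
  "root_form G x (y - z) = root_form G x y - root_form G x z"
  "root_form G (y - z) x = root_form G y x - root_form G z x"
  "root_form G x (\<lambda>k. c * y k) = c * root_form G x y"
  "root_form G (\<lambda>k. c * y k) x = c * root_form G y x"
proof -
  show *: "root_form G x (y + z) = root_form G x y + root_form G x z"
    "root_form G x (y - z) = root_form G x y - root_form G x z"
    "root_form G x (\<lambda>k. c * y k) = c * root_form G x y" for x y z c
    by (simp_all add: root_form_eq algebra_simps sum.distrib sum_subtractf sum_distrib_left)
  then show "root_form G (y + z) x = root_form G y x + root_form G z x"
    "root_form G (y - z) x = root_form G y x - root_form G z x"
    "root_form G (\<lambda>k. c * y k) x = c * root_form G y x"
    by (metis root_form_commute)+
qed

section \<open>Simple reflections of dimension vectors, with frozen vertices outside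
  \<open>J\<close>\<close>

definition refl :: "'i \<Rightarrow> ('i \<Rightarrow> int) \<Rightarrow> 'i \<Rightarrow> int" where
  "refl i n = n(i := n i - root_to_weight G n i)"

lemma refl_eq: "refl i n = n - (\<lambda>k. root_to_weight G n i * simple_root i k)"
  by (auto simp: refl_def simple_root_def fun_eq_iff)

lemma refl_self: "refl i n i = (\<Sum>a\<in>out_arcs H i. n (head H a)) - n i"
  by (simp add: refl_def root_to_weight_eq)

lemma refl_add: "refl i (x + y) = refl i x + refl i y"
  by (auto simp: refl_def fun_eq_iff root_to_weight_add)

lemma refl_cmult: "refl i (\<lambda>k. c * x k) = (\<lambda>k. c * refl i x k)"
  by (auto simp: refl_def fun_eq_iff root_to_weight_cmult algebra_simps)

lemma refl_refl [simp]: "refl i (refl i x) = x"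
proof -
  have "root_to_weight G (refl i x) i = - root_to_weight G x i"
    by (simp add: refl_eq[of i x] root_to_weight_diff root_to_weight_cmult root_to_weight_simple_root_self)
  then show ?thesis by (auto simp: refl_def fun_eq_iff)
qed

abbreviation "refls is \<equiv> foldr refl is"

lemma refls_add: "refls is (x + y) = refls is x + refls is y"
  by (induction "is") (simp_all only: foldr.simps id_apply o_apply refl_add)

lemma refls_cmult: "refls is (\<lambda>k. c * x k) = (\<lambda>k. c * refls is x k)"
  by (induction "is") (simp_all only: foldr.simps id_apply o_apply refl_cmult)

lemma refls_rev [simp]: "refls (rev is) (refls is x) = x"
  by (induction "is") auto

lemma refls_outside: "j \<notin> set is \<Longrightarrow> refls is x j = x j"
  by (induction "is") (auto simp: refl_def)

text \<open>For the framed quiver and \<open>J\<close> the unprimed vertices, \<open>m\<close> is a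
  framing \<lambda> and \<open>n\<close> is the pair
  \<open>(w \<lambda> - \<lambda>, \<lambda>)\<close>, where \<open>w\<close> is the product of the
  reflections in \<open>is\<close>.\<close>

definition extremal :: "'i set \<Rightarrow> ('i \<Rightarrow> int) \<Rightarrow> bool" where
  "extremal J n \<longleftrightarrow> (\<exists>is m. set is \<subseteq> J \<and> (\<forall>j\<in>J. m j = 0) \<and> n = refls is m)"

lemma extremal_refl: "extremal J n \<Longrightarrow> i \<in> J \<Longrightarrow> extremal J (refl i n)"
  unfolding extremal_def
proof (elim exE conjE)
  fix "is" m assume *: "set is \<subseteq> J" "\<forall>j\<in>J. m j = 0" "n = refls is m" "i \<in> J"
  then show "\<exists>is m. set is \<subseteq> J \<and> (\<forall>j\<in>J. m j = 0) \<and> refl i n = refls is m"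
    by (intro exI[of _ "i # is"] exI[of _ m]) auto
qed

text \<open>The \<open>W\<close>-translates of a root cannot be both nonnegative and nonpositive.\<close>

lemma extremal_maximal:
  assumes n: "extremal J n" and i: "i \<in> J" and c: "c > 0" and p: "root_to_weight G n i \<ge> 0"
    and S: "\<And>x k. x \<in> S \<Longrightarrow> k \<in> J \<Longrightarrow> refl k x \<in> S" "\<And>x k. x \<in> S \<Longrightarrow> k \<in> J \<Longrightarrow> x k \<ge> 0"
  shows "n + (\<lambda>k. c * simple_root i k) \<notin> S"
proof
  assume x: "n + (\<lambda>k. c * simple_root i k) \<in> S" (is "?x \<in> S")
  obtain "is" m where m: "set is \<subseteq> J" "\<And>j. j \<in> J \<Longrightarrow> m j = 0" "n = refls is m"
    using n unfolding extremal_def by blast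
  have S': "refls js y \<in> S" if "set js \<subseteq> J" "y \<in> S" for js y
    using that by (induction js) (auto intro: S)
  \<comment> \<open>With \<open>n = w m\<close>, this is the inverse of \<open>w\<close> applied to
    the simple root at \<open>i\<close>. As \<open>m\<close> vanishes on \<open>J\<close>, moving a
    vector of \<open>S\<close> back by \<open>w\<close> leaves only a multiple of
    \<open>\<beta>\<close> on \<open>J\<close>.\<close>
  define \<beta> where "\<beta> = refls (rev is) (simple_root i)"
  have "refls (rev is) ?x = m + (\<lambda>k. c * \<beta> k)"
    unfolding refls_add m(3) refls_rev refls_cmult \<beta>_def ..
  then have "m + (\<lambda>k. c * \<beta> k) \<in> S" using S'[of "rev is" ?x] x m by simp
  then have "c * \<beta> k \<ge> 0" if "k \<in> J" for k using S(2) m(2) that by fastforce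
  then have pos: "\<beta> k \<ge> 0" if "k \<in> J" for k using c that by (simp add: zero_le_mult_iff)
  \<comment> \<open>The reflection at \<open>i\<close> takes \<open>n\<close> plus \<open>c\<close>
    times the simple root to \<open>n\<close> minus \<open>d\<close> times it, and \<open>d\<close>
    is positive since the pairing in \<open>p\<close> is nonnegative.\<close>
  define d where "d = c + root_to_weight G n i"
  have "root_to_weight G ?x i = d + c"
    unfolding root_to_weight_add root_to_weight_cmult root_to_weight_simple_root_self d_def by simp
  then have "refl i ?x = n + (\<lambda>k. (- d) * simple_root i k)"
    unfolding refl_eq by (auto simp: fun_eq_iff algebra_simps)
  then have "n + (\<lambda>k. (- d) * simple_root i k) \<in> S" using S(1)[OF x i] by simp
  then have "refls (rev is) (n + (\<lambda>k. (- d) * simple_root i k)) \<in> S"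
    using S' m(1) by simp
  also have "refls (rev is) (n + (\<lambda>k. (- d) * simple_root i k)) = m + (\<lambda>k. (- d) * \<beta> k)"
    unfolding refls_add m(3) refls_rev refls_cmult \<beta>_def ..
  finally have "(- d) * \<beta> k \<ge> 0" if "k \<in> J" for k using S(2) m(2) that by fastforce
  then have "d * \<beta> k \<le> 0" if "k \<in> J" for k using that by simp
  moreover have "d > 0" using c p by (simp add: d_def)
  ultimately have "\<beta> k \<le> 0" if "k \<in> J" for k
    using that by (meson linorder_not_le mult_pos_pos)
  \<comment> \<open>On \<open>J\<close> the entries are both nonnegative and nonpositive; elsewhere
    the reflections change nothing and the simple root at \<open>i\<close> vanishes. But a product
    of reflections is linear and invertible, so it cannot kill a simple root.\<close>
  then have "\<beta> k = 0" for k
  proof (cases "k \<in> J")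
    case False
    then have "\<beta> k = simple_root i k" unfolding \<beta>_def using m(1) by (intro refls_outside) auto
    then show ?thesis using False i by (auto simp: simple_root_def)
  qed (use pos in \<open>simp add: antisym\<close>)
  then have "(\<lambda>k. 0 * \<beta> k) = \<beta>" by auto
  then have "refls is \<beta> = (\<lambda>k. 0 * refls is \<beta> k)" using refls_cmult[of "is" 0 \<beta>] by simp
  moreover have "refls is \<beta> = simple_root i"
    unfolding \<beta>_def using refls_rev[of "rev is"] by simp
  ultimately have "simple_root i = (\<lambda>k. 0 * refls is \<beta> k)" by (simp only:)
  then have "simple_root i i = (0 :: int)" by (metis mult_zero_left)
  then show False by (simp add: simple_root_def)
qed

definition restr :: "'i set \<Rightarrow> ('i \<Rightarrow> int) \<Rightarrow> 'i \<Rightarrow> int" where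
  "restr J n = (\<lambda>j. if j \<in> J then n j else 0)"

text \<open>With \<open>x\<close> and \<open>y\<close> the parts of \<open>n\<close> inside and
  outside \<open>J\<close>, this is \<open>(x, x) + 2 (x, y)\<close>, that is
  \<open>(n, n) - (y, y)\<close>. For the framed quiver, where \<open>n\<close> has weight \<gamma>
  and framing \<lambda>, it equals the difference of the squared norms of \<gamma> and \<lambda>,
  written without the form on weights, which takes rational values.\<close>

definition defect :: "'i set \<Rightarrow> ('i \<Rightarrow> int) \<Rightarrow> int" where
  "defect J n = root_form G (restr J n) n + root_form G (restr J n) (restr (- J) n)"

lemma root_form_simple_root: "root_form G x (simple_root i) = root_to_weight G x i"
  by (simp add: root_to_weight_def)

text \<open>
  The difference of the squared norms of a weight and of its framing is invariant under \<open>W\<close>.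
\<close>

lemma defect_refl:
  assumes "i \<in> J" shows "defect J (refl i n) = defect J n"
proof -
  define p where "p = root_to_weight G n i"
  define x where "x = restr J n"
  define y where "y = restr (- J) n"
  have n: "n = x + y" by (auto simp: x_def y_def restr_def)
  have e: "restr J (refl i n) = x - (\<lambda>k. p * simple_root i k)"
    "restr (- J) (refl i n) = y" "refl i n = n - (\<lambda>k. p * simple_root i k)"
    using assms by (auto simp: refl_eq x_def y_def restr_def p_def simple_root_def fun_eq_iff)
  have "p = root_to_weight G x i + root_to_weight G y i"
    unfolding p_def n by (rule root_to_weight_add)
  then have "p * p = p * root_to_weight G x i + p * root_to_weight G y i"
    by (metis distrib_left)
  moreover have "defect J n = root_form G x n + root_form G x y"
    by (simp add: defect_def x_def y_def)
  moreover have "root_form G (simple_root i) z = root_to_weight G z i" for z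
    by (simp add: root_form_commute[of _ z] root_form_simple_root)
  ultimately show ?thesis
    unfolding defect_def e(1,2) unfolding e(3)
    by (simp add: root_form_linear root_form_simple_root p_def[symmetric]
        root_to_weight_simple_root_self root_to_weight_diff root_to_weight_cmult right_diff_distrib)
qed

lemma defect_refls: "set is \<subseteq> J \<Longrightarrow> defect J (refls is n) = defect J n"
  by (induction "is") (auto simp: defect_refl)

lemma defect_alt:
  "defect J n = root_form G (restr J n) (restr J n) + 2 * root_form G (restr J n) (restr (- J) n)"
proof -
  have "n = restr J n + restr (- J) n" by (auto simp: restr_def)
  then have "root_form G (restr J n) n = root_form G (restr J n) (restr J n) + root_form G (restr J n) (restr (- J) n)"
    by (metis root_form_linear(1))
  then show ?thesis by (simp add: defect_def)
qed

text \<open>Only vectors supported on \<open>J\<close> are tested: the framed quiver is in general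
  not of finite type and its full form may be indefinite.\<close>

definition pos_def :: "'i set \<Rightarrow> bool" where
  "pos_def J \<longleftrightarrow> (\<forall>x. restr J x = x \<and> x \<noteq> 0 \<longrightarrow> root_form G x x > 0)"

text \<open>The defect is 0 because it vanishes on \<open>m\<close>, so
  \<open>(x, x) + 2 (x, y) = 0\<close> and \<open>(n, x) = (x, x) / 2 > 0\<close>. As
  \<open>(n, x)\<close> is the sum of the pairings of \<open>n\<close> with the simple roots,
  weighted by the nonnegative entries of \<open>x\<close>, one of these pairings is
  positive.\<close>

lemma extremal_descent:
  assumes J: "pos_def J" and n: "extremal J n" and nonneg: "\<And>j. j \<in> J \<Longrightarrow> n j \<ge> 0"
    and nz: "j \<in> J" "n j \<noteq> 0"
  obtains i where "i \<in> J" "root_to_weight G n i > 0"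
proof -
  define x where "x = restr J n"
  define y where "y = restr (- J) n"
  have xy: "n = x + y" by (auto simp: x_def y_def restr_def)
  obtain "is" m where m: "set is \<subseteq> J" "\<And>j. j \<in> J \<Longrightarrow> m j = 0" "n = refls is m"
    using n unfolding extremal_def by blast
  have "restr J m = (\<lambda>k. 0 * m k)" using m(2) by (auto simp: restr_def)
  then have "defect J m = 0"
    unfolding defect_def by (simp only: root_form_linear)
  then have "defect J n = 0" using m defect_refls by simp
  then have "root_form G x x + 2 * root_form G x y = 0" by (simp add: defect_alt x_def y_def)
  moreover have "root_form G x x > 0"
  proof -
    have "restr J x = x" "x \<noteq> 0" using nz by (auto simp: x_def restr_def fun_eq_iff)
    then show ?thesis using J unfolding pos_def_def by blast
  qed
  moreover have "root_form G n x = root_form G x x + root_form G x y"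
    unfolding xy by (simp add: root_form_linear root_form_commute)
  ultimately have "0 < (\<Sum>j\<in>UNIV. x j * root_to_weight G n j)"
    by (simp add: root_form_eq[of n x])
  moreover have "(\<Sum>j\<in>UNIV. x j * root_to_weight G n j) \<le> 0"
    if "\<And>j. x j * root_to_weight G n j \<le> 0"
    using that by (intro sum_nonpos)
  ultimately obtain i where i: "0 < x i * root_to_weight G n i"
    by (meson linorder_not_le)
  then have iJ: "i \<in> J" by (auto simp: x_def restr_def split: if_splits)
  then have "x i \<ge> 0" using nonneg by (simp add: x_def restr_def)
  with i have "root_to_weight G n i > 0" by (auto simp: zero_less_mult_iff)
  then show ?thesis using that iJ by blast
qed

end

section \<open>Positive definiteness in type ADE\<close>

lemma path_edges_eq: "path_edges m = (\<lambda>k. {k, Suc k}) ` {..<m - 1}"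
  by (auto simp: path_edges_def)

lemma sum_path_edges:
  fixes x :: "nat \<Rightarrow> real"
  shows "(\<Sum>e\<in>path_edges m. \<Prod>v\<in>e. x v) = (\<Sum>k<m - 1. x k * x (Suc k))"
proof -
  have "inj_on (\<lambda>k::nat. {k, Suc k}) A" for A
    by (rule inj_onI) (auto simp: doubleton_eq_iff)
  then show ?thesis by (simp add: path_edges_eq sum.reindex)
qed

text \<open>
  A positive vector \<open>d\<close> on which the Cartan matrix takes positive values certifies that the
  Tits form is positive definite: apply the inequality of the means on each edge with the weights
  given by \<open>d\<close>. The vectors used below are proportional to the sum of the positive roots.
\<close>

lemma weighted_am_gm:
  fixes x y a b :: real assumes "a > 0" "b > 0"
  shows "2 * (x * y) \<le> b / a * x\<^sup>2 + a / b * y\<^sup>2"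
proof -
  have "0 \<le> (b * x - a * y)\<^sup>2 / (a * b)" using assms by simp
  also have "\<dots> = b / a * x\<^sup>2 + a / b * y\<^sup>2 - 2 * (x * y)"
    using assms by (simp add: power2_eq_square field_simps)
  finally show ?thesis by simp
qed

text \<open>On a path with \<open>m\<close> vertices this adds up \<open>d\<close> over the
  neighbours of \<open>k\<close>: the Cartan matrix of the path sends \<open>d\<close> to
  \<open>2 * d k - path_sum m d k\<close>.\<close>

definition path_sum :: "nat \<Rightarrow> (nat \<Rightarrow> real) \<Rightarrow> nat \<Rightarrow> real" where
  "path_sum m d k = (if Suc k < m then d (Suc k) else 0) + (if 0 < k then d (k - 1) else 0)"

lemma path_form_le:
  fixes d x :: "nat \<Rightarrow> real"
  assumes d: "\<And>k. k < m \<Longrightarrow> d k > 0"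
  shows "2 * (\<Sum>k<m - 1. x k * x (Suc k)) \<le> (\<Sum>k<m. path_sum m d k / d k * (x k)\<^sup>2)"
proof (cases m)
  case (Suc l)
  define A where "A k = d (Suc k) / d k * (x k)\<^sup>2" for k
  define B where "B k = d (k - 1) / d k * (x k)\<^sup>2" for k
  have "2 * (\<Sum>k<l. x k * x (Suc k)) \<le> (\<Sum>k<l. A k + B (Suc k))"
    unfolding sum_distrib_left
  proof (rule sum_mono)
    fix k assume "k \<in> {..<l}"
    then show "2 * (x k * x (Suc k)) \<le> A k + B (Suc k)"
      using weighted_am_gm[of "d k" "d (Suc k)" "x k" "x (Suc k)"] d[of k] d[of "Suc k"] Suc
      by (simp add: A_def B_def)
  qed
  also have "\<dots> = (\<Sum>k<m. if Suc k < m then A k else 0) + (\<Sum>k<m. if 0 < k then B k else 0)"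
    unfolding Suc sum.distrib sum.lessThan_Suc_shift[of "\<lambda>k. if 0 < k then B k else 0"] by simp
  also have "\<dots> = (\<Sum>k<m. path_sum m d k / d k * (x k)\<^sup>2)"
    unfolding sum.distrib[symmetric]
    by (rule sum.cong) (auto simp: path_sum_def A_def B_def add_divide_distrib distrib_right)
  finally show ?thesis using Suc by simp
qed simp

lemma div_le_2_minus_inverse:
  fixes a d :: real assumes "d > 0" "a + 1 \<le> 2 * d"
  shows "a / d \<le> 2 - 1 / d"
  using assms by (simp add: field_simps)

text \<open>The second hypothesis says that the Cartan matrix takes \<open>d\<close> to values at
  least 1. This slack leaves the margin \<open>1 / d k\<close>, which yields coercivity and not only
  positivity.\<close>

lemma path_bound:
  fixes d x :: "nat \<Rightarrow> real"
  assumes d: "\<And>k. k < m \<Longrightarrow> d k > 0" "\<And>k. k < m \<Longrightarrow> path_sum m d k + 1 \<le> 2 * d k"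
  shows "2 * (\<Sum>e\<in>path_edges m. \<Prod>v\<in>e. x v) \<le> (\<Sum>k<m. (2 - 1 / d k) * (x k)\<^sup>2)"
proof -
  have "2 * (\<Sum>e\<in>path_edges m. \<Prod>v\<in>e. x v) \<le> (\<Sum>k<m. path_sum m d k / d k * (x k)\<^sup>2)"
    unfolding sum_path_edges by (rule path_form_le[OF d(1)])
  also have "\<dots> \<le> (\<Sum>k<m. (2 - 1 / d k) * (x k)\<^sup>2)"
  proof (intro sum_mono mult_right_mono)
    fix k assume "k \<in> {..<m}"
    then show "path_sum m d k / d k \<le> 2 - 1 / d k" using d[of k] by (simp add: div_le_2_minus_inverse)
  qed auto
  finally show ?thesis .
qed

text \<open>Diagrams of types D and E are a path on \<open>m\<close> vertices with one more vertex
  \<open>m\<close> joined to \<open>b\<close>. The inequality of the means on the extra edge charges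
  \<open>d m / d b\<close> to \<open>b\<close> and \<open>d b / d m\<close> to \<open>m\<close>,
  which the hypotheses on \<open>d\<close> absorb.\<close>

lemma pendant_bound:
  fixes d x :: "nat \<Rightarrow> real"
  assumes b: "b < m" and d: "\<And>k. k \<le> m \<Longrightarrow> d k > 0"
    "\<And>k. k < m \<Longrightarrow> path_sum m d k + (if k = b then d m else 0) + 1 \<le> 2 * d k"
    "d b + 1 \<le> 2 * d m"
  shows "2 * (\<Sum>e\<in>insert {b, m} (path_edges m). \<Prod>v\<in>e. x v) \<le> (\<Sum>k<Suc m. (2 - 1 / d k) * (x k)\<^sup>2)"
proof -
  have "{b, m} \<notin> path_edges m" by (auto simp: path_edges_eq doubleton_eq_iff)
  moreover have "finite (path_edges m)" by (simp add: path_edges_eq)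
  ultimately have "2 * (\<Sum>e\<in>insert {b, m} (path_edges m). \<Prod>v\<in>e. x v) =
      2 * (x b * x m) + 2 * (\<Sum>k<m - 1. x k * x (Suc k))"
    using b by (simp add: sum_path_edges)
  also have "\<dots> \<le> (d m / d b * (x b)\<^sup>2 + d b / d m * (x m)\<^sup>2) +
      (\<Sum>k<m. path_sum m d k / d k * (x k)\<^sup>2)"
    using b d(1) by (intro add_mono weighted_am_gm path_form_le) auto
  also have "d m / d b * (x b)\<^sup>2 = (\<Sum>k<m. (if k = b then d m / d k * (x k)\<^sup>2 else 0))"
    using b by (simp add: sum.delta)
  also have "\<dots> + d b / d m * (x m)\<^sup>2 + (\<Sum>k<m. path_sum m d k / d k * (x k)\<^sup>2) =
      d b / d m * (x m)\<^sup>2 + (\<Sum>k<m. (path_sum m d k + (if k = b then d m else 0)) / d k * (x k)\<^sup>2)"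
  proof -
    have "(\<Sum>k<m. (if k = b then d m / d k * (x k)\<^sup>2 else 0)) + (\<Sum>k<m. path_sum m d k / d k * (x k)\<^sup>2) =
        (\<Sum>k<m. (path_sum m d k + (if k = b then d m else 0)) / d k * (x k)\<^sup>2)"
      unfolding sum.distrib[symmetric]
      by (rule sum.cong) (auto simp: add_divide_distrib distrib_right)
    then show ?thesis by linarith
  qed
  also have "\<dots> \<le> (2 - 1 / d m) * (x m)\<^sup>2 + (\<Sum>k<m. (2 - 1 / d k) * (x k)\<^sup>2)"
  proof (intro add_mono sum_mono mult_right_mono)
    show "d b / d m \<le> 2 - 1 / d m" using d(1)[of m] d(3) by (simp add: div_le_2_minus_inverse)
    fix k assume "k \<in> {..<m}"
    then show "(path_sum m d k + (if k = b then d m else 0)) / d k \<le> 2 - 1 / d k"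
      using d(1,2)[of k] by (intro div_le_2_minus_inverse) auto
  qed auto
  finally show ?thesis by simp
qed

lemma ade_diagram_bound:
  assumes "ade_diagram n F"
  obtains d :: "nat \<Rightarrow> real" where "\<And>k. k < n \<Longrightarrow> d k > 0"
    "\<And>x. 2 * (\<Sum>e\<in>F. \<Prod>v\<in>e. x v) \<le> (\<Sum>k<n. (2 - 1 / d k) * (x k)\<^sup>2)"
  using assms
proof cases
  case A
  \<comment> \<open>The coefficients of the sum of the positive roots, on which the Cartan matrix
    takes the value 2. The formula vanishes at -1 and at \<open>n\<close>, so the ends of the path
    obey the same identity as the inner vertices.\<close>
  define d :: "nat \<Rightarrow> real" where "d k = (real k + 1) * (real n - real k)" for k
  have "d k > 0" if "k < n" for k using that by (simp add: d_def)
  moreover have "path_sum n d k + 1 \<le> 2 * d k" if "k < n" for k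
  proof -
    consider "Suc k < n" | "n = Suc k" using \<open>k < n\<close> by linarith
    then show ?thesis
      by cases (cases k; auto simp: path_sum_def d_def algebra_simps)+
  qed
  ultimately show ?thesis using that[of d] path_bound[of n d] A by blast
next
  case D
  define m where "m = n - 1"
  \<comment> \<open>Twice the sum of the positive roots, which clears the denominator of
    \<open>m * (m + 1) / 2\<close>, its coefficient at the two vertices \<open>m - 1\<close> and
    \<open>m\<close> that hang on \<open>m - 2\<close>.\<close>
  define d :: "nat \<Rightarrow> real" where
    "d k = (if k < m - 1 then 2 * (real k + 1) * (2 * real m - real k) else real m * (real m + 1))" for k
  have n: "n = Suc m" "n - 3 = m - 2" "n - 1 = m" "m \<ge> 3" using D by (auto simp: m_def)
  have pos: "d k > 0" if "k \<le> m" for k using that n by (simp add: d_def)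
  have F: "F = insert {m - 2, m} (path_edges m)" using D n(2,3) by simp
  show ?thesis
  proof (rule that)
    show "d k > 0" if "k < n" for k using that pos n by simp
    show "2 * (\<Sum>e\<in>F. \<Prod>v\<in>e. x v) \<le> (\<Sum>k<n. (2 - 1 / d k) * (x k)\<^sup>2)" for x
      unfolding F n(1)
    proof (rule pendant_bound)
      obtain l where l: "m = l + 3" using n(4) le_Suc_ex by (metis add.commute)
      show "path_sum m d k + (if k = m - 2 then d m else 0) + 1 \<le> 2 * d k" if "k < m" for k
      proof -
        consider "k < l" | "k = l" | "k = l + 1" | "k = l + 2" using \<open>k < m\<close> l by linarith
        then show ?thesis
          by cases (cases k; auto simp: path_sum_def d_def l algebra_simps)+
      qed
      show "d (m - 2) + 1 \<le> 2 * d m" by (simp add: d_def l algebra_simps)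
    qed (use pos n in auto)
  qed
next
  case E
  define m where "m = n - 1"
  have n: "n = Suc m" "n - 1 = m" "m \<in> {5, 6, 7}" using E by (auto simp: m_def)
  \<comment> \<open>The coefficients of the sum of the positive roots of E6, E7 and E8, along the
    path first and at the pendant vertex last.\<close>
  define d :: "nat \<Rightarrow> real" where
    "d k = (if m = 5 then [16, 30, 42, 30, 16, 22] else if m = 6 then [34, 66, 96, 75, 52, 27, 49]
       else [92, 182, 270, 220, 168, 114, 58, 136]) ! k" for k
  have less: "k < 8 \<longleftrightarrow> k \<in> {0, 1, 2, 3, 4, 5, 6, 7}" "k < 7 \<longleftrightarrow> k \<in> {0, 1, 2, 3, 4, 5, 6}"
      "k < 6 \<longleftrightarrow> k \<in> {0, 1, 2, 3, 4, 5}" "k < 5 \<longleftrightarrow> k \<in> {0, 1, 2, 3, 4}" for k :: nat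
    by auto
  have pos: "d k > 0" if "k < n" for k
    using that n by (auto simp: d_def less)
  have F: "F = insert {2, m} (path_edges m)" using E n(2) by simp
  show ?thesis
  proof (rule that)
    show "d k > 0" if "k < n" for k by (rule pos[OF that])
    show "2 * (\<Sum>e\<in>F. \<Prod>v\<in>e. x v) \<le> (\<Sum>k<n. (2 - 1 / d k) * (x k)\<^sup>2)" for x
      unfolding F n(1)
    proof (rule pendant_bound)
      show "path_sum m d k + (if k = 2 then d m else 0) + 1 \<le> 2 * d k" if "k < m" for k
        using that n(3) by (auto simp: d_def less path_sum_def)
      show "d 2 + 1 \<le> 2 * d m" using n(3) by (auto simp: d_def)
    qed (use pos n in auto)
  qed
qed

lemma ade_diagram_edge:
  assumes "ade_diagram n F"
  shows "finite F" "\<And>e. e \<in> F \<Longrightarrow> \<exists>u v. u < n \<and> v < n \<and> u \<noteq> v \<and> e = {u, v}"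
proof -
  have path: "finite (path_edges m)"
    "\<And>e. e \<in> path_edges m \<Longrightarrow> \<exists>u v. u < m \<and> v < m \<and> u \<noteq> v \<and> e = {u, v}" for m
  proof -
    show "finite (path_edges m)" by (simp add: path_edges_eq)
    show "\<exists>u v. u < m \<and> v < m \<and> u \<noteq> v \<and> e = {u, v}" if "e \<in> path_edges m" for e
    proof -
      obtain k where "Suc k < m" "e = {k, Suc k}" using \<open>e \<in> path_edges m\<close> by (auto simp: path_edges_def)
      then show ?thesis by (intro exI[of _ k] exI[of _ "Suc k"]) auto
    qed
  qed
  show "finite F" using assms by cases (auto simp: path)
  fix e assume e: "e \<in> F"
  show "\<exists>u v. u < n \<and> v < n \<and> u \<noteq> v \<and> e = {u, v}"
    using assms
  proof cases
    case A
    then show ?thesis using path e by blast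
  next
    case D
    then consider "e = {n - 3, n - 1}" | "e \<in> path_edges (n - 1)" using e by blast
    then show ?thesis
    proof cases
      case 1
      then show ?thesis using D by (intro exI[of _ "n - 3"] exI[of _ "n - 1"]) auto
    next
      case 2
      then obtain u v where "u < n - 1" "v < n - 1" "u \<noteq> v" "e = {u, v}" using path(2) by blast
      then show ?thesis by (intro exI[of _ u] exI[of _ v]) auto
    qed
  next
    case E
    then consider "e = {2, n - 1}" | "e \<in> path_edges (n - 1)" using e by blast
    then show ?thesis
    proof cases
      case 1
      then show ?thesis using E by (intro exI[of _ 2] exI[of _ "n - 1"]) auto
    next
      case 2
      then obtain u v where "u < n - 1" "v < n - 1" "u \<noteq> v" "e = {u, v}" using path(2) by blast
      then show ?thesis by (intro exI[of _ u] exI[of _ v]) auto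
    qed
  qed
qed

lemma ade_quiver_loopfree:
  assumes "ade_quiver Q" shows "loopfree_quiver Q"
proof -
  obtain n F \<phi> where F: "ade_diagram n F" and \<phi>: "bij_betw \<phi> (verts Q) {..<n}"
    and bij: "bij_betw (\<lambda>a. {\<phi> (tail Q a), \<phi> (head Q a)}) (arcs Q) F" and V: "verts Q = UNIV"
    using assms unfolding ade_quiver_def by auto
  show ?thesis
  proof
    show "finite (arcs Q)" using bij ade_diagram_edge(1)[OF F] bij_betw_finite by blast
    fix a assume "a \<in> arcs Q"
    then have "{\<phi> (tail Q a), \<phi> (head Q a)} \<in> F" using bij by (auto simp: bij_betw_def)
    then obtain u v where "u \<noteq> v" "{\<phi> (tail Q a), \<phi> (head Q a)} = {u, v}"
      using ade_diagram_edge(2)[OF F] by metis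
    then show "tail Q a \<noteq> head Q a" by (auto simp: doubleton_eq_iff)
  qed (fact V)
qed

text \<open>The estimate is quantitative because \<open>conjugate_antidominant\<close> bounds a
  whole orbit with it; an integer \<open>c\<close> keeps that argument inside the integers.\<close>

lemma ade_quiver_coercive:
  assumes Q: "ade_quiver Q"
  obtains c :: int where "c > 0" "\<And>x. (\<Sum>j\<in>UNIV. (x j)\<^sup>2) \<le> c * root_form Q x x"
proof -
  interpret loopfree_quiver Q by (rule ade_quiver_loopfree[OF Q])
  obtain n F \<phi> where F: "ade_diagram n F" and \<phi>: "bij_betw \<phi> UNIV {..<n}"
    and bij: "bij_betw (\<lambda>a. {\<phi> (tail Q a), \<phi> (head Q a)}) (arcs Q) F"
    using Q unfolding ade_quiver_def by auto
  obtain d :: "nat \<Rightarrow> real" where d: "\<And>k. k < n \<Longrightarrow> d k > 0"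
    "\<And>x. 2 * (\<Sum>e\<in>F. \<Prod>v\<in>e. x v) \<le> (\<Sum>k<n. (2 - 1 / d k) * (x k)\<^sup>2)"
    using ade_diagram_bound[OF F] by blast
  \<comment> \<open>Any integer that is positive and at least every \<open>d k\<close> does: by
    \<open>d(2)\<close> the form is at least the sum of the squares of the entries divided by the
    \<open>d k\<close>.\<close>
  define c where "c = \<lceil>\<Sum>k<n. d k\<rceil> + 1"
  have c0: "(\<Sum>k<n. d k) \<ge> 0" using d(1) by (intro sum_nonneg) (auto simp: less_imp_le)
  then have c: "c > 0" by (simp add: c_def add_nonneg_pos)
  have dc: "d k \<le> c" if "k < n" for k
  proof -
    have "d k \<le> (\<Sum>k<n. d k)" using that d(1) by (intro member_le_sum) (auto simp: less_imp_le)
    then show ?thesis unfolding c_def by linarith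
  qed
  have "(\<Sum>j\<in>UNIV. (x j)\<^sup>2) \<le> c * root_form Q x x" for x
  proof -
    define y where "y k = real_of_int (x (inv \<phi> k))" for k
    have inv: "inv \<phi> (\<phi> i) = i" for i using \<phi> by (simp add: bij_betw_def)
    have arcs: "(\<Sum>a\<in>arcs H. x (tail H a) * x (head H a)) = 2 * (\<Sum>a\<in>arcs Q. x (tail Q a) * x (head Q a))"
      by (simp add: double_quiver_def sum.Plus finite_arcs mult.commute)
    have "(\<Sum>e\<in>F. \<Prod>v\<in>e. y v) = (\<Sum>a\<in>arcs Q. \<Prod>v\<in>{\<phi> (tail Q a), \<phi> (head Q a)}. y v)"
      using bij by (simp add: sum.reindex_bij_betw[symmetric])
    also have "\<dots> = (\<Sum>a\<in>arcs Q. real_of_int (x (tail Q a) * x (head Q a)))"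
    proof (rule sum.cong)
      fix a assume "a \<in> arcs Q"
      then have "\<phi> (tail Q a) \<noteq> \<phi> (head Q a)" using no_loops inv by metis
      then show "(\<Prod>v\<in>{\<phi> (tail Q a), \<phi> (head Q a)}. y v) = real_of_int (x (tail Q a) * x (head Q a))"
        by (simp add: y_def inv)
    qed simp
    finally have F': "2 * (\<Sum>e\<in>F. \<Prod>v\<in>e. y v) = real_of_int (\<Sum>a\<in>arcs H. x (tail H a) * x (head H a))"
      by (simp add: arcs)
    have sq: "(\<Sum>k<n. (y k)\<^sup>2) = real_of_int (\<Sum>j\<in>UNIV. (x j)\<^sup>2)"
      using sum.reindex_bij_betw[OF \<phi>, of "\<lambda>k. (y k)\<^sup>2"] by (simp add: y_def inv)
    have "(\<Sum>k<n. (y k)\<^sup>2) \<le> c * (\<Sum>k<n. (1 / d k) * (y k)\<^sup>2)"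
      unfolding sum_distrib_left
    proof (rule sum_mono)
      fix k assume "k \<in> {..<n}"
      then have "1 \<le> c * (1 / d k)" using d(1)[of k] dc[of k] by simp
      then show "(y k)\<^sup>2 \<le> c * ((1 / d k) * (y k)\<^sup>2)"
        using mult_right_mono[of 1 "c * (1 / d k)" "(y k)\<^sup>2"] by simp
    qed
    also have "\<dots> \<le> c * (2 * (\<Sum>k<n. (y k)\<^sup>2) - 2 * (\<Sum>e\<in>F. \<Prod>v\<in>e. y v))"
    proof (rule mult_left_mono)
      have "(\<Sum>k<n. (2 - 1 / d k) * (y k)\<^sup>2) = 2 * (\<Sum>k<n. (y k)\<^sup>2) - (\<Sum>k<n. (1 / d k) * (y k)\<^sup>2)"
        by (simp add: left_diff_distrib sum_subtractf sum_distrib_left)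
      then show "(\<Sum>k<n. (1 / d k) * (y k)\<^sup>2) \<le> 2 * (\<Sum>k<n. (y k)\<^sup>2) - 2 * (\<Sum>e\<in>F. \<Prod>v\<in>e. y v)"
        using d(2)[of y] by linarith
    qed (use c in simp)
    also have "\<dots> = real_of_int (c * root_form Q x x)"
      by (simp add: sq F' root_form_def verts_UNIV power2_eq_square[symmetric])
    finally show ?thesis unfolding sq of_int_le_iff .
  qed
  then show ?thesis using that c by blast
qed

section \<open>Representations\<close>

lemma arrow_sign_star: "arrow_sign (star a) = - (arrow_sign a :: 'k::field)"
  by (cases a) auto

lemma arrow_sign_mult_self [simp]: "arrow_sign a * arrow_sign a = (1 :: 'k::field)"
  by (cases a) auto

lemma sum_const_fun: "(\<Sum>a\<in>A. (\<lambda>_. f a)) = (\<lambda>_. \<Sum>a\<in>A. f a :: 'a::comm_monoid_add)"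
  by (induction A rule: infinite_finite_induct) (auto simp: fun_eq_iff)

context loopfree_quiver
begin

lemma is_rep_iff:
  "is_rep H M \<longleftrightarrow> vector_space (scalar M) \<and> (\<forall>i. fin_dim (scalar M) (vspace M i)) \<and>
    (\<forall>a\<in>arcs H. linear_between (scalar M) (vspace M (tail H a)) (scalar M) (vspace M (head H a)) (act M a))"
  by (simp add: is_rep_def fin_dim_def)

lemmas no_loops_double = tail_neq_head tail_neq_head[symmetric]

lemma rep_isomorphicI:
  assumes "\<And>i. linear_between (scalar M) (vspace M i) (scalar N) (vspace N i) (f i)"
    "\<And>a x. a \<in> arcs H \<Longrightarrow> x \<in> vspace M (tail H a) \<Longrightarrow> f (head H a) (act M a x) = act N a (f (tail H a) x)"
    "\<And>i. bij_betw (f i) (vspace M i) (vspace N i)"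
  shows "rep_isomorphic H M N"
  using assms unfolding rep_isomorphic_def rep_hom_def by blast

lemma rep_isomorphicE:
  assumes "rep_isomorphic H M N"
  obtains f where "\<And>i. linear_between (scalar M) (vspace M i) (scalar N) (vspace N i) (f i)"
    "\<And>a x. a \<in> arcs H \<Longrightarrow> x \<in> vspace M (tail H a) \<Longrightarrow> f (head H a) (act M a x) = act N a (f (tail H a) x)"
    "\<And>i. bij_betw (f i) (vspace M i) (vspace N i)"
  using assms unfolding rep_isomorphic_def rep_hom_def by auto

lemma rep_isomorphic_trans:
  assumes "rep_isomorphic H M N" "rep_isomorphic H N L"
  shows "rep_isomorphic H M L"
proof -
  obtain f where f: "\<And>i. linear_between (scalar M) (vspace M i) (scalar N) (vspace N i) (f i)"
    "\<And>a x. a \<in> arcs H \<Longrightarrow> x \<in> vspace M (tail H a) \<Longrightarrow> f (head H a) (act M a x) = act N a (f (tail H a) x)"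
    "\<And>i. bij_betw (f i) (vspace M i) (vspace N i)"
    using rep_isomorphicE[OF assms(1)] by blast
  obtain g where g: "\<And>i. linear_between (scalar N) (vspace N i) (scalar L) (vspace L i) (g i)"
    "\<And>a x. a \<in> arcs H \<Longrightarrow> x \<in> vspace N (tail H a) \<Longrightarrow> g (head H a) (act N a x) = act L a (g (tail H a) x)"
    "\<And>i. bij_betw (g i) (vspace N i) (vspace L i)"
    using rep_isomorphicE[OF assms(2)] by blast
  show ?thesis
  proof (rule rep_isomorphicI[where f = "\<lambda>i x. g i (f i x)"])
    show "bij_betw (\<lambda>x. g i (f i x)) (vspace M i) (vspace L i)" for i
      using bij_betw_trans[OF f(3) g(3)] by (simp add: o_def)
    show "linear_between (scalar M) (vspace M i) (scalar L) (vspace L i) (\<lambda>x. g i (f i x))" for i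
      by (rule linear_between_compose[OF f(1) g(1)])
    show "g (head H a) (f (head H a) (act M a x)) = act L a (g (tail H a) (f (tail H a) x))"
      if "a \<in> arcs H" "x \<in> vspace M (tail H a)" for a x
      using that f(2) g(2) linear_betweenD(1)[OF f(1)] by simp
  qed
qed

lemma rep_isomorphic_sym:
  assumes M: "is_rep H M" and N: "is_rep H N" and iso: "rep_isomorphic H M N"
  shows "rep_isomorphic H N M"
proof -
  obtain f where f: "\<And>i. linear_between (scalar M) (vspace M i) (scalar N) (vspace N i) (f i)"
    "\<And>a x. a \<in> arcs H \<Longrightarrow> x \<in> vspace M (tail H a) \<Longrightarrow> f (head H a) (act M a x) = act N a (f (tail H a) x)"
    "\<And>i. bij_betw (f i) (vspace M i) (vspace N i)"
    using rep_isomorphicE[OF iso] by blast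
  define g where "g i = inv_into (vspace M i) (f i)" for i
  have gf: "g i (f i x) = x" if "x \<in> vspace M i" for i x
    unfolding g_def by (rule bij_betw_inv_into_left[OF f(3) that])
  have fg: "f i (g i x) = x" if "x \<in> vspace N i" for i x
    unfolding g_def by (rule bij_betw_inv_into_right[OF f(3) that])
  have g: "linear_between (scalar N) (vspace N i) (scalar M) (vspace M i) (g i)" for i
  proof -
    interpret sub_hom "scalar M" "scalar N" "vspace M i" "vspace N i" "f i"
      using M N f(1) by (intro sub_homI) (auto simp: is_rep_iff fin_dim_subspace)
    show ?thesis unfolding g_def by (rule inverse[OF f(3)])
  qed
  show ?thesis
  proof (rule rep_isomorphicI[where f = g])
    show "bij_betw (g i) (vspace N i) (vspace M i)" for i
      unfolding g_def by (rule bij_betw_inv_into[OF f(3)])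
    show "g (head H a) (act N a x) = act M a (g (tail H a) x)"
      if a: "a \<in> arcs H" and x: "x \<in> vspace N (tail H a)" for a x
    proof -
      have *: "g (tail H a) x \<in> vspace M (tail H a)" using x linear_betweenD(1)[OF g] by blast
      moreover have "linear_between (scalar M) (vspace M (tail H a)) (scalar M) (vspace M (head H a)) (act M a)"
        using M a by (simp add: is_rep_iff)
      ultimately have "act M a (g (tail H a) x) \<in> vspace M (head H a)"
        using linear_betweenD(1) by blast
      from gf[OF this] show ?thesis by (simp add: f(2)[OF a *] fg[OF x])
    qed
  qed (rule g)
qed

lemma dim_vector_iso:
  assumes M: "is_rep H M" and N: "is_rep H N" and iso: "rep_isomorphic H M N"
  shows "dim_vector N = dim_vector M"
proof
  fix i
  obtain f where f: "\<forall>i. linear_between (scalar M) (vspace M i) (scalar N) (vspace N i) (f i)"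
    "\<forall>i. bij_betw (f i) (vspace M i) (vspace N i)"
    using iso unfolding rep_isomorphic_def rep_hom_def by auto
  interpret sub_hom "scalar M" "scalar N" "vspace M i" "vspace N i" "f i"
    using M N f by (intro sub_homI) (simp_all add: is_rep_iff fin_dim_subspace)
  have "fin_dim (scalar M) (vspace M i)" using M by (simp add: is_rep_iff)
  from dim_img_inj[OF this] show "dim_vector N i = dim_vector M i"
    using f(2) by (simp add: dim_vector_def bij_betw_def)
qed

text \<open>With \<open>J\<close> the unprimed vertices of the framed quiver this is stability
  (\<open>stable_iff\<close>); with \<open>J = UNIV\<close> it says that no one-dimensional module
  concentrated at a vertex embeds into \<open>M\<close>; with \<open>J = {}\<close> it leaves the
  relations only.\<close>

definition stab :: "'i set \<Rightarrow> ('k::field, 'v::ab_group_add, 'i, 'e + 'e) rep \<Rightarrow> bool" where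
  "stab J M \<longleftrightarrow> preprojective_module G M \<and>
    (\<forall>i\<in>J. \<forall>x\<in>vspace M i. (\<forall>a\<in>out_arcs H i. act M a x = 0) \<longrightarrow> x = 0)"

definition out_map :: "('k::field, 'v::ab_group_add, 'i, 'e + 'e) rep \<Rightarrow> 'i \<Rightarrow> 'v \<Rightarrow> 'e + 'e \<Rightarrow> 'v" where
  "out_map M i x = (\<lambda>a. if a \<in> out_arcs H i then act M a x else 0)"

text \<open>The sum runs over the arrows leaving \<open>i\<close>, so each sign is opposite to the
  one that the relation at \<open>i\<close> attaches to the incoming arrow \<open>star a\<close>.
  Hence \<open>in_map\<close> after \<open>out_map\<close> is minus the relation, which is the
  content of \<open>preprojective_iff\<close>.\<close>

definition in_map :: "('k::field, 'v::ab_group_add, 'i, 'e + 'e) rep \<Rightarrow> 'i \<Rightarrow> ('e + 'e \<Rightarrow> 'v) \<Rightarrow> 'v" where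
  "in_map M i y = (\<Sum>a\<in>out_arcs H i. scalar M (arrow_sign a) (act M (star a) (y a)))"

definition nbh :: "('k::field, 'v::ab_group_add, 'i, 'e + 'e) rep \<Rightarrow> 'i \<Rightarrow> ('e + 'e \<Rightarrow> 'v) set" where
  "nbh M i = pi_space (out_arcs H i) (\<lambda>a. vspace M (head H a))"

end

locale quiver_rep = loopfree_quiver G
  for G :: "('i::finite, 'e) pre_digraph" +
  fixes M :: "('k::field, 'v::ab_group_add, 'i, 'e + 'e) rep"
  assumes rep: "is_rep H M"
begin

sublocale vector_space "scalar M"
  using rep by (simp add: is_rep_iff)

lemma fin_dim_vspace: "fin_dim (scalar M) (vspace M i)"
  using rep by (simp add: is_rep_iff)

lemma subspace_vspace: "subspace (vspace M i)"
  using fin_dim_vspace by (rule fin_dim_subspace)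

lemma linear_act: "a \<in> arcs H \<Longrightarrow>
    linear_between (scalar M) (vspace M (tail H a)) (scalar M) (vspace M (head H a)) (act M a)"
  using rep by (simp add: is_rep_iff)

sublocale fs: vector_space "fun_scale (scalar M) :: 'k \<Rightarrow> ('e + 'e \<Rightarrow> 'v) \<Rightarrow> _"
  by (rule vector_space_fun_scale) unfold_locales

lemma zero_vspace [simp]: "0 \<in> vspace M i"
  by (rule subspace_0[OF subspace_vspace])

lemma act_closed: "a \<in> arcs H \<Longrightarrow> tail H a = i \<Longrightarrow> head H a = j \<Longrightarrow> x \<in> vspace M i \<Longrightarrow> act M a x \<in> vspace M j"
  using linear_betweenD(1)[OF linear_act] by blast

lemma act_zero: "a \<in> arcs H \<Longrightarrow> act M a 0 = 0"
  using linear_betweenD(3)[OF linear_act, of a 0 0] by simp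

lemma linear_out_map:
  "linear_between (scalar M) (vspace M i) (fun_scale (scalar M)) (nbh M i) (out_map M i)"
proof (rule linear_betweenI)
  show "out_map M i x \<in> nbh M i" if "x \<in> vspace M i" for x
    using that by (auto simp: out_map_def nbh_def pi_space_def out_arcs_def intro: act_closed)
  show "out_map M i (x + y) = out_map M i x + out_map M i y" if "x \<in> vspace M i" "y \<in> vspace M i" for x y
    using that linear_betweenD(2)[OF linear_act] by (auto simp: out_map_def fun_eq_iff out_arcs_def)
  show "out_map M i (scalar M c x) = fun_scale (scalar M) c (out_map M i x)" if "x \<in> vspace M i" for c x
    using that linear_betweenD(3)[OF linear_act] by (auto simp: out_map_def fun_eq_iff out_arcs_def fun_scale_def)
qed

lemma linear_in_map:
  "linear_between (fun_scale (scalar M)) (nbh M i) (scalar M) (vspace M i) (in_map M i)"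
proof (rule linear_betweenI)
  have c: "act M (star a) (y a) \<in> vspace M i" if "y \<in> nbh M i" "a \<in> out_arcs H i" for y a
    using that by (auto simp: nbh_def pi_space_def out_arcs_def intro: act_closed)
  show "in_map M i y \<in> vspace M i" if "y \<in> nbh M i" for y
    unfolding in_map_def by (intro subspace_sum subspace_scale subspace_vspace c that)
  have l: "act M (star a) (x a + y a) = act M (star a) (x a) + act M (star a) (y a)"
    "act M (star a) (scalar M d (x a)) = scalar M d (act M (star a) (x a))"
    if "x \<in> nbh M i" "y \<in> nbh M i" "a \<in> out_arcs H i" for x y a d
    using that linear_betweenD(2,3)[OF linear_act, of "star a"]
    by (auto simp: nbh_def pi_space_def out_arcs_def)
  show "in_map M i (x + y) = in_map M i x + in_map M i y" if "x \<in> nbh M i" "y \<in> nbh M i" for x y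
    using that by (simp add: in_map_def l scale_right_distrib sum.distrib)
  show "in_map M i (fun_scale (scalar M) d x) = scalar M d (in_map M i x)" if "x \<in> nbh M i" for d x
    unfolding in_map_def scale_sum_right
    by (rule sum.cong) (use that in \<open>auto simp: fun_scale_def l scale_left_commute\<close>)
qed

lemma subspace_nbh: "fs.subspace (nbh M i)"
  unfolding nbh_def by (intro subspace_pi_space subspace_vspace) unfold_locales

lemma fin_dim_nbh: "fin_dim (fun_scale (scalar M)) (nbh M i)"
  and dim_nbh: "fs.dim (nbh M i) = (\<Sum>a\<in>out_arcs H i. dim (vspace M (head H a)))"
  unfolding nbh_def
  using fin_dim_pi_space[OF vector_space_axioms finite_out_arcs_double fin_dim_vspace] by blast+

sublocale outm: sub_hom "scalar M" "fun_scale (scalar M)" "vspace M i" "nbh M i" "out_map M i" for i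
  by (rule sub_homI[OF vector_space_axioms fs.vector_space_axioms linear_out_map subspace_vspace])

sublocale inm: sub_hom "fun_scale (scalar M)" "scalar M" "nbh M i" "vspace M i" "in_map M i" for i
  by (rule sub_homI[OF fs.vector_space_axioms vector_space_axioms linear_in_map subspace_nbh])

lemma out_map_eq_0_iff: "out_map M i x = 0 \<longleftrightarrow> (\<forall>a\<in>out_arcs H i. act M a x = 0)"
  by (auto simp: out_map_def fun_eq_iff)

lemma preprojective_iff:
  "preprojective_module G M \<longleftrightarrow> (\<forall>i. \<forall>x\<in>vspace M i. in_map M i (out_map M i x) = 0)"
proof -
  have "(\<Sum>a\<in>in_arcs H i. scalar M (arrow_sign a) (act M a (act M (star a) x))) =
      - in_map M i (out_map M i x)" for i x
    unfolding in_arcs_double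
    by (simp add: sum.reindex[OF inj_star] arrow_sign_star in_map_def out_map_def sum_negf)
  then show ?thesis by (simp add: preprojective_module_def rep verts_UNIV)
qed

lemma stab_iff:
  "stab J M \<longleftrightarrow> preprojective_module G M \<and> (\<forall>i\<in>J. inj_on (out_map M i) (vspace M i))"
  by (auto simp: stab_def outm.inj_iff out_map_eq_0_iff)

text \<open>The image of \<open>in_map\<close> absorbs every incoming arrow, which is what makes
  \<open>shrink_at\<close> a subrepresentation. The preimage is the tuple concentrated at
  \<open>star a\<close>, with a sign that squares to 1.\<close>

lemma act_in_range:
  assumes a: "a \<in> arcs H" and x: "x \<in> vspace M (tail H a)"
  shows "act M a x \<in> in_map M (head H a) ` nbh M (head H a)"
proof
  let ?b = "star a"
  define y where "y = (\<lambda>c. if c = ?b then scalar M (arrow_sign ?b) x else 0)"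
  have b: "?b \<in> out_arcs H (head H a)" using a by (simp add: out_arcs_def)
  have xs: "scalar M (arrow_sign ?b) x \<in> vspace M (tail H a)"
    using x by (simp add: subspace_scale subspace_vspace)
  show "y \<in> nbh M (head H a)"
    using x b a xs by (auto simp: nbh_def pi_space_def y_def)
  have "in_map M (head H a) y =
      (\<Sum>c\<in>out_arcs H (head H a). if c = ?b then act M a x else 0)"
    unfolding in_map_def
  proof (rule sum.cong)
    fix c assume c: "c \<in> out_arcs H (head H a)"
    show "scalar M (arrow_sign c) (act M (star c) (y c)) = (if c = ?b then act M a x else 0)"
    proof (cases "c = ?b")
      case True
      then show ?thesis using linear_betweenD(3)[OF linear_act[OF a] x] by (simp add: y_def)
    next
      case False
      then show ?thesis using c act_zero by (simp add: y_def out_arcs_def)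
    qed
  qed simp
  then show "act M a x = in_map M (head H a) y" using b by simp
qed

end

context loopfree_quiver
begin

lemma quiver_repI: "is_rep H M \<Longrightarrow> quiver_rep G M"
  by (simp add: quiver_rep_def quiver_rep_axioms_def loopfree_quiver_axioms)

lemma stab_rep: "stab J M \<Longrightarrow> is_rep H M"
  by (simp add: stab_def preprojective_module_def)

lemma stab_quiver_rep: "stab J M \<Longrightarrow> quiver_rep G M"
  by (rule quiver_repI[OF stab_rep])

lemma stab_iso:
  assumes M: "stab J M" and N: "is_rep H N" and iso: "rep_isomorphic H M N"
  shows "stab J N"
proof -
  interpret M: quiver_rep G M using M by (rule stab_quiver_rep)
  interpret N: quiver_rep G N using N by (rule quiver_repI)
  have "rep_isomorphic H N M" by (rule rep_isomorphic_sym[OF M.rep N iso])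
  then obtain f where f: "\<And>i. linear_between (scalar N) (vspace N i) (scalar M) (vspace M i) (f i)"
    "\<And>a x. a \<in> arcs H \<Longrightarrow> x \<in> vspace N (tail H a) \<Longrightarrow> f (head H a) (act N a x) = act M a (f (tail H a) x)"
    "\<And>i. bij_betw (f i) (vspace N i) (vspace M i)"
    using rep_isomorphicE by blast
  have sub: "sub_hom (scalar N) (scalar M) (vspace N i) (vspace M i) (f i)" for i
    by (rule sub_homI[OF N.vector_space_axioms M.vector_space_axioms f(1) N.subspace_vspace])
  have f0: "x = 0" if "x \<in> vspace N i" "f i x = 0" for i x
    using sub_hom.inj_iff[OF sub, of i] f(3)[of i] that by (simp add: bij_betw_def)
  have in_map: "f i (in_map N i (out_map N i x)) = in_map M i (out_map M i (f i x))"
    if x: "x \<in> vspace N i" for i x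
  proof -
    have c: "act N (star a) (act N a x) \<in> vspace N i" if "a \<in> out_arcs H i" for a
      using that x by (auto simp: out_arcs_def intro: N.act_closed)
    have "f i (in_map N i (out_map N i x)) =
        (\<Sum>a\<in>out_arcs H i. f i (scalar N (arrow_sign a) (act N (star a) (act N a x))))"
      unfolding in_map_def out_map_def
      using c by (subst sub_hom.map_sum[OF sub]) (auto intro!: N.subspace_scale N.subspace_vspace)
    also have "\<dots> = (\<Sum>a\<in>out_arcs H i. scalar M (arrow_sign a) (act M (star a) (act M a (f i x))))"
    proof (rule sum.cong)
      fix a assume a: "a \<in> out_arcs H i"
      then have "f i (act N (star a) (act N a x)) = act M (star a) (act M a (f i x))"
        using f(2)[of a x] f(2)[of "star a" "act N a x"] x N.act_closed[of a i "head H a" x]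
        by (simp add: out_arcs_def)
      then show "f i (scalar N (arrow_sign a) (act N (star a) (act N a x))) =
          scalar M (arrow_sign a) (act M (star a) (act M a (f i x)))"
        using linear_betweenD(3)[OF f(1) c[OF a]] by simp
    qed simp
    finally show ?thesis by (simp add: in_map_def out_map_def)
  qed
  have "in_map N i (out_map N i x) = 0" if x: "x \<in> vspace N i" for i x
  proof (rule f0)
    show "in_map N i (out_map N i x) \<in> vspace N i"
      using linear_betweenD(1)[OF N.linear_in_map] linear_betweenD(1)[OF N.linear_out_map] x by blast
    have "f i x \<in> vspace M i" using linear_betweenD(1)[OF f(1) x] .
    then show "f i (in_map N i (out_map N i x)) = 0"
      using M in_map[OF x] by (simp add: M.stab_iff M.preprojective_iff)
  qed
  moreover have "x = 0" if i: "i \<in> J" and x: "x \<in> vspace N i" and 0: "\<forall>a\<in>out_arcs H i. act N a x = 0" for i x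
  proof (rule f0[OF x])
    have "act M a (f i x) = 0" if a: "a \<in> out_arcs H i" for a
    proof -
      have "act M a (f i x) = f (head H a) (act N a x)"
        using f(2)[of a x] a x by (simp add: out_arcs_def)
      then show ?thesis using 0 a sub_hom.map_zero[OF sub] by simp
    qed
    moreover have "f i x \<in> vspace M i" using linear_betweenD(1)[OF f(1) x] .
    ultimately show "f i x = 0" using M i by (simp add: stab_def)
  qed
  ultimately show ?thesis by (simp add: stab_def N.preprojective_iff)
qed

text \<open>Each space receives coordinates of its own, since the spaces of a representation need
  not be independent inside the ambient space.\<close>

lemma rep_transport:
  fixes M :: "('k::field, 'v::ab_group_add, 'i, 'e + 'e) rep"
  assumes M: "is_rep H M"
  obtains N :: "('k, nat \<Rightarrow> 'k, 'i, 'e + 'e) rep" where "is_rep H N" "rep_isomorphic H M N"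
proof -
  interpret M: quiver_rep G M using M by (rule quiver_repI)
  let ?t = "fun_scale (*) :: 'k \<Rightarrow> (nat \<Rightarrow> 'k) \<Rightarrow> _"
  have t: "vector_space ?t" by (rule vector_space_fun_scale[OF vector_space_times])
  have "\<exists>V f. fin_dim ?t V \<and> linear_between (scalar M) (vspace M i) ?t V f \<and> bij_betw f (vspace M i) V" for i
  proof -
    obtain V where V: "fin_dim ?t V" "vector_space.dim ?t V = M.dim (vspace M i)"
      by (rule coordinate_space_exists)
    obtain f where "linear_between (scalar M) (vspace M i) ?t V f" "bij_betw f (vspace M i) V"
      by (rule fin_dim_isomorphic[OF M.vector_space_axioms t M.fin_dim_vspace V(1) V(2)[symmetric]])
    then show ?thesis using V by blast
  qed
  then obtain V f where V: "\<And>i. fin_dim ?t (V i)"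
    and f: "\<And>i. linear_between (scalar M) (vspace M i) ?t (V i) (f i)"
    and bij: "\<And>i. bij_betw (f i) (vspace M i) (V i)" by metis
  define g where "g i = inv_into (vspace M i) (f i)" for i
  have g: "linear_between ?t (V i) (scalar M) (vspace M i) (g i)" for i
  proof -
    interpret sub_hom "scalar M" ?t "vspace M i" "V i" "f i"
      by (rule sub_homI[OF M.vector_space_axioms t f M.subspace_vspace])
    show ?thesis unfolding g_def by (rule inverse[OF bij])
  qed
  define N :: "('k, nat \<Rightarrow> 'k, 'i, 'e + 'e) rep" where
    "N = \<lparr>scalar = ?t, vspace = V, act = \<lambda>a y. f (head H a) (act M a (g (tail H a) y))\<rparr>"
  show ?thesis
  proof
    show "is_rep H N"
      unfolding is_rep_iff N_def rep.simps
    proof (intro conjI ballI allI t V)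
      fix a assume "a \<in> arcs H"
      then show "linear_between ?t (V (tail H a)) ?t (V (head H a))
          (\<lambda>y. f (head H a) (act M a (g (tail H a) y)))"
        by (intro linear_between_compose[OF g linear_between_compose[OF M.linear_act f]])
    qed
    have "g i (f i x) = x" if "x \<in> vspace M i" for i x
      unfolding g_def by (rule bij_betw_inv_into_left[OF bij that])
    then show "rep_isomorphic H M N"
      by (intro rep_isomorphicI[where f = f]) (use f bij in \<open>simp_all add: N_def\<close>)
  qed
qed

subsection \<open>Reflecting stable representations\<close>

text \<open>
  Replacing the space at \<open>i\<close> by a space \<open>X\<close> between the image of \<open>out \<circ> in\<close> and the
  kernel of \<open>in\<close>, with new maps the inclusion of \<open>X\<close> and \<open>out \<circ> in\<close>, does not change any
  composition through \<open>i\<close> of maps between neighbours of \<open>i\<close>.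
\<close>

definition replace_at :: "('k::field, 'v::ab_group_add, 'i, 'e + 'e) rep \<Rightarrow> 'i \<Rightarrow> ('e + 'e \<Rightarrow> 'v) set \<Rightarrow>
    ('k, 'e + 'e \<Rightarrow> 'v, 'i, 'e + 'e) rep" where
  "replace_at M i X = \<lparr>scalar = fun_scale (scalar M),
     vspace = \<lambda>j. if j = i then X else (\<lambda>x _. x) ` vspace M j,
     act = \<lambda>a y. if head H a = i then out_map M i (act M a (y undefined))
       else if tail H a = i then (\<lambda>_. y a) else (\<lambda>_. act M a (y undefined))\<rparr>"

text \<open>The upper bound on \<open>X\<close> gives the relation at \<open>i\<close>, and the
  lower bound makes the new incoming maps land in \<open>X\<close>. The new outgoing map at
  \<open>i\<close> is an inclusion, hence injective. At a neighbour, a vector sent to 0 in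
  \<open>X\<close> was already sent to 0 in \<open>M\<close>, because \<open>out_map M i\<close> is
  injective.\<close>

lemma stab_replace_at:
  fixes M :: "('k::field, 'v::ab_group_add, 'i, 'e + 'e) rep"
  assumes M: "stab J M" and i: "i \<in> J"
    and X: "module.subspace (fun_scale (scalar M)) X" "X \<subseteq> {y \<in> nbh M i. in_map M i y = 0}"
      "out_map M i ` in_map M i ` nbh M i \<subseteq> X"
  shows "stab J (replace_at M i X)"
    "dim_vector (replace_at M i X) = (dim_vector M)(i := int (vector_space.dim (fun_scale (scalar M)) X))"
proof -
  interpret M: quiver_rep G M using M by (rule stab_quiver_rep)
  let ?N = "replace_at M i X" and ?s = "scalar M"
  let ?fs = "fun_scale ?s :: 'k \<Rightarrow> ('e + 'e \<Rightarrow> 'v) \<Rightarrow> _"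
  \<comment> \<open>The new space at \<open>i\<close> consists of functions, so at every other
    vertex a vector is stored as a constant function. \<open>replace_at\<close> reads it at the
    arbitrary index \<open>undefined\<close>.\<close>
  let ?c = "\<lambda>x (_ :: 'e + 'e). x :: 'v"
  have sc: "sub_hom ?s ?fs (vspace M j) (?c ` vspace M j) ?c" for j
    by (rule sub_homI[OF M.vector_space_axioms M.fs.vector_space_axioms _ M.subspace_vspace])
      (auto intro!: linear_betweenI simp: fun_scale_def fun_eq_iff)
  have injc: "inj_on ?c A" for A by (auto simp: inj_on_def fun_eq_iff)
  have fX: "fin_dim ?fs X"
    using M.fs.fin_dim_subset(1)[OF M.fin_dim_nbh X(1)] X(2) by blast
  have out0: "out_map M i x = 0 \<Longrightarrow> x \<in> vspace M i \<Longrightarrow> x = 0" for x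
    using M i by (auto simp: M.stab_iff M.outm.inj_iff)
  have into_X: "out_map M i (act M a x) \<in> X" if "a \<in> arcs H" "head H a = i" "x \<in> vspace M (tail H a)" for a x
    using M.act_in_range[OF that(1,3)] that(2) X(3) by blast
  have Xa: "y a \<in> vspace M (head H a)" if "y \<in> X" "a \<in> out_arcs H i" for y a
    using that X(2) by (auto simp: nbh_def pi_space_def)
  have rep: "is_rep H ?N"
    unfolding is_rep_iff
  proof (intro conjI ballI allI)
    show "vector_space (scalar ?N)" by (simp add: replace_at_def M.fs.vector_space_axioms)
    show "fin_dim (scalar ?N) (vspace ?N j)" for j
      using fX sub_hom.fin_dim_img[OF sc M.fin_dim_vspace] by (simp add: replace_at_def)
    fix a assume a: "a \<in> arcs H"
    note lin = linear_betweenD[OF M.linear_act[OF a]]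
    consider "head H a = i" "tail H a \<noteq> i" | "head H a \<noteq> i" "tail H a = i" | "head H a \<noteq> i" "tail H a \<noteq> i"
      using tail_neq_head[OF a] by metis
    then show "linear_between (scalar ?N) (vspace ?N (tail H a)) (scalar ?N) (vspace ?N (head H a)) (act ?N a)"
    proof cases
      case 1
      then show ?thesis
        using into_X[OF a] lin linear_betweenD(2,3)[OF M.linear_out_map, of _ i]
        by (intro linear_betweenI) (auto simp: replace_at_def fun_scale_def)
    next
      case 2
      then have "a \<in> out_arcs H i" using a by (simp add: out_arcs_def)
      with 2 show ?thesis
        using Xa by (intro linear_betweenI) (auto simp: replace_at_def fun_scale_def fun_eq_iff)
    next
      case 3
      then show ?thesis
        using lin by (intro linear_betweenI) (auto simp: replace_at_def fun_scale_def fun_eq_iff)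
    qed
  qed
  interpret N: quiver_rep G ?N using rep by (rule quiver_repI)
  have "in_map ?N j (out_map ?N j y) = 0" if y: "y \<in> vspace ?N j" for j y
  proof (cases "j = i")
    case True
    then have yX: "y \<in> X" using y by (simp add: replace_at_def)
    have *: "act M (star a) (y a) \<in> vspace M i" if "a \<in> out_arcs H i" for a
      using Xa[OF yX that] that by (auto simp: out_arcs_def intro: M.act_closed)
    have "in_map ?N i (out_map ?N i y) =
        (\<Sum>a\<in>out_arcs H i. out_map M i (?s (arrow_sign a) (act M (star a) (y a))))"
      unfolding in_map_def out_map_def[of ?N]
    proof (rule sum.cong)
      fix a assume a: "a \<in> out_arcs H i"
      then have "head H a \<noteq> i" "tail H a = i" using no_loops_double by (auto simp: out_arcs_def)
      then show "scalar ?N (arrow_sign a) (act ?N (star a) (if a \<in> out_arcs H i then act ?N a y else 0)) =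
          out_map M i (?s (arrow_sign a) (act M (star a) (y a)))"
        using a linear_betweenD(3)[OF M.linear_out_map *[OF a]] by (simp add: replace_at_def)
    qed simp
    also have "\<dots> = out_map M i (in_map M i y)"
      unfolding in_map_def
      by (rule M.outm.map_sum[symmetric]) (simp add: * M.subspace_scale M.subspace_vspace)
    also have "\<dots> = 0" using yX X(2) M.outm.map_zero by auto
    finally show ?thesis using True by simp
  next
    case False
    then obtain x where x: "y = ?c x" "x \<in> vspace M j" using y by (auto simp: replace_at_def)
    have "in_map ?N j (out_map ?N j y) =
        (\<Sum>a\<in>out_arcs H j. ?c (?s (arrow_sign a) (act M (star a) (act M a x))))"
      unfolding in_map_def out_map_def[of ?N]
    proof (rule sum.cong)
      fix a assume a: "a \<in> out_arcs H j"
      then have "star a \<in> out_arcs H (head H a)" "tail H a = j" by (auto simp: out_arcs_def)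
      then show "scalar ?N (arrow_sign a) (act ?N (star a) (if a \<in> out_arcs H j then act ?N a y else 0)) =
          ?c (?s (arrow_sign a) (act M (star a) (act M a x)))"
        using a False by (auto simp: replace_at_def x fun_scale_def out_map_def)
    qed simp
    also have "\<dots> = ?c (in_map M j (out_map M j x))"
      by (simp add: in_map_def out_map_def sum_const_fun)
    also have "\<dots> = 0" using M x by (simp add: M.stab_iff M.preprojective_iff zero_fun_def)
    finally show ?thesis .
  qed
  moreover have "y = 0" if j: "j \<in> J" and y: "y \<in> vspace ?N j" and 0: "\<forall>a\<in>out_arcs H j. act ?N a y = 0" for j y
  proof (cases "j = i")
    case True
    then have yX: "y \<in> X" using y by (simp add: replace_at_def)
    have "y a = 0" for a
    proof (cases "a \<in> out_arcs H i")
      case a: True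
      then have "act ?N a y = ?c (y a)" using no_loops_double by (auto simp: out_arcs_def replace_at_def)
      then show ?thesis using 0 a True by (auto simp: fun_eq_iff)
    next
      case False
      then show ?thesis using yX X(2) by (auto simp: nbh_def pi_space_def)
    qed
    then show ?thesis by (simp add: fun_eq_iff)
  next
    case False
    then obtain x where x: "y = ?c x" "x \<in> vspace M j" using y by (auto simp: replace_at_def)
    have "act M a x = 0" if a: "a \<in> out_arcs H j" for a
    proof (cases "head H a = i")
      case True
      then have "act ?N a y = out_map M i (act M a x)" by (simp add: replace_at_def x)
      then have "out_map M i (act M a x) = 0" using 0 a by simp
      moreover have "act M a x \<in> vspace M i" using a x True by (auto simp: out_arcs_def intro: M.act_closed)
      ultimately show ?thesis by (rule out0)
    next
      case head: False
      have "act ?N a y = ?c (act M a x)" using head False a by (auto simp: replace_at_def x out_arcs_def)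
      then show ?thesis using 0 a by (auto simp: fun_eq_iff)
    qed
    then have "x = 0" using M j x(2) by (simp add: stab_def)
    then show ?thesis by (simp add: x fun_eq_iff)
  qed
  ultimately show "stab J ?N" by (simp add: stab_def N.preprojective_iff)
  show "dim_vector ?N = (dim_vector M)(i := int (M.fs.dim X))"
    using sub_hom.dim_img_inj[OF sc M.fin_dim_vspace injc]
    by (auto simp: dim_vector_def replace_at_def fun_eq_iff)
qed

end

context quiver_rep
begin

lemma dim_in_ker:
  assumes M: "stab J M" and i: "i \<in> J"
  shows "dim (in_map M i ` nbh M i) \<le> dim (vspace M i)"
    "dim (vspace M i) \<le> fs.dim {y \<in> nbh M i. in_map M i y = 0}"
    "dim (in_map M i ` nbh M i) + fs.dim {y \<in> nbh M i. in_map M i y = 0} =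
      (\<Sum>a\<in>out_arcs H i. dim (vspace M (head H a)))"
    "out_map M i ` vspace M i \<subseteq> {y \<in> nbh M i. in_map M i y = 0}"
    "fin_dim (fun_scale (scalar M)) {y \<in> nbh M i. in_map M i y = 0}"
proof -
  have "in_map M i ` nbh M i \<subseteq> vspace M i" using linear_betweenD(1)[OF linear_in_map] by blast
  then show "dim (in_map M i ` nbh M i) \<le> dim (vspace M i)"
    by (rule fin_dim_subset(2)[OF fin_dim_vspace inm.subspace_img[OF subspace_nbh subset_refl]])
  show *: "out_map M i ` vspace M i \<subseteq> {y \<in> nbh M i. in_map M i y = 0}"
    using M linear_betweenD(1)[OF linear_out_map] by (auto simp: stab_iff preprojective_iff)
  show fk: "fin_dim (fun_scale (scalar M)) {y \<in> nbh M i. in_map M i y = 0}"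
    by (rule fs.fin_dim_subset(1)[OF fin_dim_nbh inm.subspace_ker]) auto
  have "fs.dim (out_map M i ` vspace M i) = dim (vspace M i)"
    using M i by (intro outm.dim_img_inj fin_dim_vspace) (auto simp: stab_iff)
  then show "dim (vspace M i) \<le> fs.dim {y \<in> nbh M i. in_map M i y = 0}"
    using fs.fin_dim_subset(2)[OF fk _ *] outm.subspace_img[OF subspace_vspace] by simp
  show "dim (in_map M i ` nbh M i) + fs.dim {y \<in> nbh M i. in_map M i y = 0} =
      (\<Sum>a\<in>out_arcs H i. dim (vspace M (head H a)))"
    using inm.rank_nullity[OF fin_dim_nbh, of i] dim_nbh[of i] by simp
qed

end

context loopfree_quiver
begin

lemma stab_transport:
  fixes M :: "('k::field, 'v::ab_group_add, 'i, 'e + 'e) rep"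
  assumes M: "stab J M"
  obtains N :: "('k, nat \<Rightarrow> 'k, 'i, 'e + 'e) rep" where "stab J N" "dim_vector N = dim_vector M"
proof -
  obtain N :: "('k, nat \<Rightarrow> 'k, 'i, 'e + 'e) rep" where N: "is_rep H N" "rep_isomorphic H M N"
    using rep_transport[OF stab_rep[OF M]] by blast
  then show ?thesis using that stab_iso[OF M] dim_vector_iso[OF stab_rep[OF M]] by blast
qed

lemma stab_change_dim:
  fixes M :: "('k::field, 'v::ab_group_add, 'i, 'e + 'e) rep"
  assumes M: "stab J M" and i: "i \<in> J"
    and m: "vector_space.dim (scalar M) (in_map M i ` nbh M i) \<le> m"
      "m \<le> vector_space.dim (fun_scale (scalar M)) {y \<in> nbh M i. in_map M i y = 0}"
  obtains N :: "('k, nat \<Rightarrow> 'k, 'i, 'e + 'e) rep"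
  where "stab J N" "dim_vector N = (dim_vector M)(i := int m)"
proof -
  interpret quiver_rep G M using M by (rule stab_quiver_rep)
  note dims = dim_in_ker[OF M i]
  have im: "in_map M i ` nbh M i \<subseteq> vspace M i" "subspace (in_map M i ` nbh M i)"
    using linear_betweenD(1)[OF linear_in_map] inm.subspace_img[OF subspace_nbh] by auto
  have sub: "sub_hom (scalar M) (fun_scale (scalar M)) (in_map M i ` nbh M i) (nbh M i) (out_map M i)"
    using linear_betweenD(1)[OF linear_out_map] im
    by (intro sub_homI vector_space_axioms fs.vector_space_axioms linear_between_mono[OF linear_out_map]) auto
  let ?A = "out_map M i ` in_map M i ` nbh M i"
  \<comment> \<open>Since \<open>out_map\<close> is injective, the lower end of the admissible range
    for the new space has the dimension of the image of \<open>in_map\<close>.\<close>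
  have "inj_on (out_map M i) (in_map M i ` nbh M i)"
    using M i im(1) by (auto simp: stab_iff intro: inj_on_subset)
  then have "fs.dim ?A = dim (in_map M i ` nbh M i)"
    by (rule sub_hom.dim_img_inj[OF sub fin_dim_subset(1)[OF fin_dim_vspace im(2,1)]])
  then have A1: "fs.dim ?A \<le> m" using m(1) by simp
  have A2: "?A \<subseteq> {y \<in> nbh M i. in_map M i y = 0}" using dims(4) im(1) by blast
  have A3: "fs.subspace ?A" by (rule sub_hom.subspace_img[OF sub im(2) subset_refl])
  obtain X where X: "fs.subspace X" "?A \<subseteq> X" "X \<subseteq> {y \<in> nbh M i. in_map M i y = 0}" "fs.dim X = m"
    by (rule fs.fin_dim_between[OF dims(5) A3 A2 A1 m(2)])
  obtain N :: "('k, nat \<Rightarrow> 'k, 'i, 'e + 'e) rep"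
    where "stab J N" "dim_vector N = dim_vector (replace_at M i X)"
    using stab_transport[OF stab_replace_at(1)[OF M i X(1,3,2)]] by blast
  then show ?thesis using that stab_replace_at(2)[OF M i X(1,3,2)] X(4) by simp
qed

text \<open>By \<open>dim_in_ker\<close> the dimension at \<open>i\<close> lies between that of the
  image and that of the kernel of \<open>in_map\<close>, and these two add up to the dimension of
  the product of the neighbouring spaces. So the admissible range is symmetric under subtraction
  from that total, which is the effect of the reflection.\<close>

lemma stab_refl:
  fixes M :: "('k::field, 'v::ab_group_add, 'i, 'e + 'e) rep"
  assumes M: "stab J M" and i: "i \<in> J"
  obtains N :: "('k, nat \<Rightarrow> 'k, 'i, 'e + 'e) rep"
  where "stab J N" "dim_vector N = refl i (dim_vector M)"
proof -
  interpret quiver_rep G M using M by (rule stab_quiver_rep)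
  note dims = dim_in_ker[OF M i]
  define m where "m = (\<Sum>a\<in>out_arcs H i. dim (vspace M (head H a))) - dim (vspace M i)"
  have m: "dim (in_map M i ` nbh M i) \<le> m" "m \<le> fs.dim {y \<in> nbh M i. in_map M i y = 0}"
    using dims(1-3) unfolding m_def by linarith+
  obtain N :: "('k, nat \<Rightarrow> 'k, 'i, 'e + 'e) rep"
    where N: "stab J N" "dim_vector N = (dim_vector M)(i := int m)"
    using stab_change_dim[OF M i m] by blast
  have "int m = refl i (dim_vector M) i"
    using dims(1-3) unfolding refl_self dim_vector_def m_def by (simp add: of_nat_diff)
  then have "dim_vector N = refl i (dim_vector M)" by (auto simp: N(2) refl_def fun_eq_iff)
  then show ?thesis using that N(1) by blast
qed

lemma dim_vector_nonneg: "dim_vector M i \<ge> 0"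
  by (simp add: dim_vector_def)

lemma stab_refls:
  fixes M :: "('k::field, nat \<Rightarrow> 'k, 'i, 'e + 'e) rep"
  assumes M: "stab J M" and "set is \<subseteq> J"
  shows "\<exists>N :: ('k, nat \<Rightarrow> 'k, 'i, 'e + 'e) rep. stab J N \<and> dim_vector N = refls is (dim_vector M)"
  using assms(2)
proof (induction "is")
  case (Cons i "is")
  then obtain N :: "('k, nat \<Rightarrow> 'k, 'i, 'e + 'e) rep"
    where "stab J N" "dim_vector N = refls is (dim_vector M)" by auto
  moreover obtain L :: "('k, nat \<Rightarrow> 'k, 'i, 'e + 'e) rep"
    where "stab J L" "dim_vector L = refl i (dim_vector N)"
    using stab_refl[OF \<open>stab J N\<close>, of i] Cons.prems by auto
  ultimately show ?case by auto
qed (use M in auto)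

lemma extremal_ker_in:
  fixes M :: "('k::field, 'v::ab_group_add, 'i, 'e + 'e) rep"
  assumes M: "stab J M" and n: "extremal J (dim_vector M)" and i: "i \<in> J"
    and p: "root_to_weight G (dim_vector M) i \<ge> 0"
  shows "out_map M i ` vspace M i = {y \<in> nbh M i. in_map M i y = 0}"
    "int (vector_space.dim (scalar M) (in_map M i ` nbh M i)) = refl i (dim_vector M) i"
proof -
  interpret quiver_rep G M using M by (rule stab_quiver_rep)
  note dims = dim_in_ker[OF M i]
  define k where "k = fs.dim {y \<in> nbh M i. in_map M i y = 0}"
  \<comment> \<open>Modules in one fixed type suffice, since only dimension vectors matter and every
    stable module can be copied into that type.\<close>
  define S where "S = {dim_vector N | N :: ('k, nat \<Rightarrow> 'k, 'i, 'e + 'e) rep. stab J N}"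
  have k: "k = dim (vspace M i)"
  proof (rule ccontr)
    assume "k \<noteq> dim (vspace M i)"
    then have c: "int k - dim_vector M i > 0" using dims(2) by (simp add: k_def dim_vector_def)
    \<comment> \<open>Filling the space at \<open>i\<close> up to the whole kernel of
      \<open>in_map\<close> is admissible, and it adds a positive multiple of the simple root at
      \<open>i\<close>.\<close>
    obtain N :: "('k, nat \<Rightarrow> 'k, 'i, 'e + 'e) rep"
      where N: "stab J N" "dim_vector N = (dim_vector M)(i := int k)"
      using stab_change_dim[OF M i, of k] dims(1,2) by (auto simp: k_def)
    have "dim_vector N = dim_vector M + (\<lambda>j. (int k - dim_vector M i) * simple_root i j)"
      unfolding N(2) by (auto simp: simple_root_def)
    then have "dim_vector M + (\<lambda>j. (int k - dim_vector M i) * simple_root i j) \<in> S"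
      using N(1) unfolding S_def by force
    moreover have "refl j x \<in> S" if "x \<in> S" "j \<in> J" for x j
    proof -
      obtain N :: "('k, nat \<Rightarrow> 'k, 'i, 'e + 'e) rep" where N: "stab J N" "x = dim_vector N"
        using \<open>x \<in> S\<close> unfolding S_def by auto
      obtain L :: "('k, nat \<Rightarrow> 'k, 'i, 'e + 'e) rep" where "stab J L" "dim_vector L = refl j x"
        unfolding N(2) using stab_refl[OF N(1) \<open>j \<in> J\<close>] .
      then show ?thesis unfolding S_def by force
    qed
    moreover have "x j \<ge> 0" if "x \<in> S" for x j
      using that by (auto simp: S_def dim_vector_nonneg)
    ultimately show False using extremal_maximal[OF n i c p, of S] by blast
  qed
  have sub: "fs.subspace (out_map M i ` vspace M i)"
    by (rule outm.subspace_img[OF subspace_vspace subset_refl])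
  have "inj_on (out_map M i) (vspace M i)" using M i by (simp add: stab_iff)
  then have "fs.dim (out_map M i ` vspace M i) = k"
    using outm.dim_img_inj[OF fin_dim_vspace] k by simp
  then show "out_map M i ` vspace M i = {y \<in> nbh M i. in_map M i y = 0}"
    unfolding k_def by (intro fs.fin_dim_eqI[OF dims(5) sub dims(4)])
  show "int (dim (in_map M i ` nbh M i)) = refl i (dim_vector M) i"
    using dims(3) k unfolding refl_self dim_vector_def k_def by (simp flip: of_nat_sum)
qed

section \<open>Stable subrepresentations and reconstruction from the smallest space at a
  vertex\<close>

lemma stab_subrep:
  fixes M :: "('k::field, 'v::ab_group_add, 'i, 'e + 'e) rep"
  assumes M: "stab J M" and U: "\<And>j. module.subspace (scalar M) (U j)" "\<And>j. U j \<subseteq> vspace M j"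
    and act: "\<And>a x. a \<in> arcs H \<Longrightarrow> x \<in> U (tail H a) \<Longrightarrow> act M a x \<in> U (head H a)"
  shows "stab J (M\<lparr>vspace := U\<rparr>)"
proof -
  interpret quiver_rep G M using M by (rule stab_quiver_rep)
  have rep: "is_rep H (M\<lparr>vspace := U\<rparr>)"
    unfolding is_rep_iff
  proof (intro conjI ballI allI)
    show "fin_dim (scalar (M\<lparr>vspace := U\<rparr>)) (vspace (M\<lparr>vspace := U\<rparr>) i)" for i
      using fin_dim_subset(1)[OF fin_dim_vspace U] by simp
    fix a assume "a \<in> arcs H"
    then show "linear_between (scalar (M\<lparr>vspace := U\<rparr>)) (vspace (M\<lparr>vspace := U\<rparr>) (tail H a))
        (scalar (M\<lparr>vspace := U\<rparr>)) (vspace (M\<lparr>vspace := U\<rparr>) (head H a)) (act (M\<lparr>vspace := U\<rparr>) a)"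
      using linear_between_mono[OF linear_act U(2), of a "U (head H a)"] act by auto
  qed (simp add: vector_space_axioms)
  interpret N: quiver_rep G "M\<lparr>vspace := U\<rparr>" using rep by (rule quiver_repI)
  have "in_map (M\<lparr>vspace := U\<rparr>) = in_map M" "out_map (M\<lparr>vspace := U\<rparr>) = out_map M"
    by (simp_all add: in_map_def out_map_def fun_eq_iff)
  then show ?thesis
    using M U(2) inj_on_subset[OF _ U(2)]
    unfolding stab_iff N.stab_iff preprojective_iff N.preprojective_iff
    by (simp add: subset_iff) blast
qed

text \<open>For \<open>M\<close> stable at \<open>i\<close> this is, up to isomorphism,
  \<open>replace_at\<close> with the smallest admissible space, but realised inside
  \<open>M\<close>, so that the ambient type is kept.\<close>

definition shrink_at :: "('k::field, 'v::ab_group_add, 'i, 'e + 'e) rep \<Rightarrow> 'i \<Rightarrow> ('k, 'v, 'i, 'e + 'e) rep" where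
  "shrink_at M i = M\<lparr>vspace := (vspace M)(i := in_map M i ` nbh M i)\<rparr>"

lemma stab_shrink_at:
  fixes M :: "('k::field, 'v::ab_group_add, 'i, 'e + 'e) rep"
  assumes M: "stab J M"
  shows "stab J (shrink_at M i)"
proof -
  interpret quiver_rep G M using M by (rule stab_quiver_rep)
  have im: "in_map M i ` nbh M i \<subseteq> vspace M i" "subspace (in_map M i ` nbh M i)"
    using linear_betweenD(1)[OF linear_in_map] inm.subspace_img[OF subspace_nbh] by auto
  show ?thesis
    unfolding shrink_at_def
  proof (rule stab_subrep[OF M])
    show sub: "((vspace M)(i := in_map M i ` nbh M i)) j \<subseteq> vspace M j" for j using im by simp
    show "subspace (((vspace M)(i := in_map M i ` nbh M i)) j)" for j
      using im subspace_vspace by simp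
    fix a x assume a: "a \<in> arcs H" and x: "x \<in> ((vspace M)(i := in_map M i ` nbh M i)) (tail H a)"
    then have "x \<in> vspace M (tail H a)" using sub by blast
    then show "act M a x \<in> ((vspace M)(i := in_map M i ` nbh M i)) (head H a)"
      using act_in_range[OF a] act_closed[OF a] by auto
  qed
qed

lemma extremal_shrink_at:
  assumes M: "stab J M" "extremal J (dim_vector M)" "i \<in> J" "root_to_weight G (dim_vector M) i \<ge> 0"
  shows "dim_vector (shrink_at M i) = refl i (dim_vector M)"
  using extremal_ker_in(2)[OF M] by (auto simp: shrink_at_def dim_vector_def refl_def fun_eq_iff)

text \<open>
  When \<open>ker in\<close> and \<open>im out\<close> agree at \<open>i\<close>, the representation is recovered from the
  subrepresentation with the space \<open>im in\<close> at \<open>i\<close>, as the kernel of \<open>in\<close>.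
\<close>

lemma iso_from_shrink_at:
  fixes M :: "('k::field, 'v::ab_group_add, 'i, 'e + 'e) rep"
    and M' :: "('k, 'w::ab_group_add, 'i, 'e + 'e) rep"
  assumes M: "stab J M" and M': "stab J M'" and i: "i \<in> J"
    and dim: "dim_vector M = dim_vector M'"
    and ker: "out_map M' i ` vspace M' i = {y \<in> nbh M' i. in_map M' i y = 0}"
    and iso: "rep_isomorphic H (shrink_at M i) (shrink_at M' i)"
  shows "rep_isomorphic H M M'"
proof -
  interpret M: quiver_rep G M using M by (rule stab_quiver_rep)
  interpret M': quiver_rep G M' using M' by (rule stab_quiver_rep)
  let ?N = "shrink_at M i" and ?N' = "shrink_at M' i"
  interpret N: quiver_rep G ?N using stab_shrink_at[OF M] by (rule stab_quiver_rep)
  interpret N': quiver_rep G ?N' using stab_shrink_at[OF M'] by (rule stab_quiver_rep)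
  have N: "scalar ?N = scalar M" "act ?N = act M" "scalar ?N' = scalar M'" "act ?N' = act M'"
    "\<And>j. vspace ?N j = (if j = i then in_map M i ` nbh M i else vspace M j)"
    "\<And>j. vspace ?N' j = (if j = i then in_map M' i ` nbh M' i else vspace M' j)"
    by (auto simp: shrink_at_def)
  obtain f where f: "\<And>j. linear_between (scalar M) (vspace ?N j) (scalar M') (vspace ?N' j) (f j)"
    "\<And>a x. a \<in> arcs H \<Longrightarrow> x \<in> vspace ?N (tail H a) \<Longrightarrow> f (head H a) (act M a x) = act M' a (f (tail H a) x)"
    "\<And>j. bij_betw (f j) (vspace ?N j) (vspace ?N' j)"
    using rep_isomorphicE[OF iso] unfolding N(1-4) by blast
  have sub: "sub_hom (scalar M) (scalar M') (vspace ?N j) (vspace ?N' j) (f j)" for j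
    using N.subspace_vspace[of j] unfolding N(1)
    by (intro sub_homI M.vector_space_axioms M'.vector_space_axioms f(1))
  have out: "head H a \<noteq> i" "tail H a = i" "a \<in> arcs H" if "a \<in> out_arcs H i" for a
    using that no_loops_double by (auto simp: out_arcs_def)
  have f': "linear_between (scalar M) (vspace M j) (scalar M') (vspace M' j) (f j)"
    "bij_betw (f j) (vspace M j) (vspace M' j)" if "j \<noteq> i" for j
    using f(1,3)[of j] that unfolding N by auto
  have N'_sub: "vspace ?N' j \<subseteq> vspace M' j" and N_sub: "vspace ?N j \<subseteq> vspace M j" for j
    unfolding N using linear_betweenD(1)[OF M.linear_in_map] linear_betweenD(1)[OF M'.linear_in_map] by auto
  have inj': "x = y" if "x \<in> vspace M' i" "y \<in> vspace M' i" "out_map M' i x = out_map M' i y" for x y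
    using that M' i by (auto simp: M'.stab_iff inj_on_def)
  \<comment> \<open>The isomorphism \<open>f\<close> on the neighbours of \<open>i\<close> induces
    \<open>F\<close> on the products of their spaces; by \<open>in_F\<close> it maps the kernel of
    \<open>in_map\<close> for \<open>M\<close> into that for \<open>M'\<close>.\<close>
  define F where "F y = (\<lambda>a. if a \<in> out_arcs H i then f (head H a) (y a) else 0)" for y
  have F_nbh: "F y \<in> nbh M' i" if "y \<in> nbh M i" for y
  proof -
    have "f (head H a) (y a) \<in> vspace M' (head H a)" if a: "a \<in> out_arcs H i" for a
    proof (rule linear_betweenD(1)[OF f'(1)[OF out(1)[OF a]]])
      show "y a \<in> vspace M (head H a)" using \<open>y \<in> nbh M i\<close> a by (simp add: nbh_def pi_space_def)
    qed
    then show ?thesis by (simp add: F_def nbh_def pi_space_def)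
  qed
  have in_F: "in_map M' i (F y) = f i (in_map M i y)" if y: "y \<in> nbh M i" for y
  proof -
    have ya: "y a \<in> vspace M (head H a)" if "a \<in> out_arcs H i" for a
      using that y by (auto simp: nbh_def pi_space_def)
    have c: "act M (star a) (y a) \<in> vspace ?N i" if a: "a \<in> out_arcs H i" for a
      using M.act_in_range[of "star a" "y a"] ya[OF a] out[OF a] by (simp add: N)
    have "f i (in_map M i y) = (\<Sum>a\<in>out_arcs H i. f i (scalar M (arrow_sign a) (act M (star a) (y a))))"
      unfolding in_map_def
      using N.subspace_vspace[of i] c
      by (intro sub_hom.map_sum[OF sub]) (auto simp: N(1) intro: M.subspace_scale)
    also have "\<dots> = in_map M' i (F y)"
      unfolding in_map_def
    proof (rule sum.cong)
      fix a assume a: "a \<in> out_arcs H i"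
      have "f i (act M (star a) (y a)) = act M' (star a) (f (head H a) (y a))"
        using f(2)[of "star a" "y a"] out[OF a] ya[OF a] by (simp add: N)
      then show "f i (scalar M (arrow_sign a) (act M (star a) (y a))) =
          scalar M' (arrow_sign a) (act M' (star a) (F y a))"
        using linear_betweenD(3)[OF f(1) c[OF a]] a by (simp add: F_def)
    qed simp
    finally show ?thesis ..
  qed
  \<comment> \<open>By \<open>ker\<close> every element of the kernel of \<open>in_map\<close> for
    \<open>M'\<close> comes from the space of \<open>M'\<close> at \<open>i\<close>; this defines
    the missing component \<open>g\<close> there.\<close>
  have "\<exists>x'. x' \<in> vspace M' i \<and> out_map M' i x' = F (out_map M i x)" if x: "x \<in> vspace M i" for x
  proof -
    have "out_map M i x \<in> nbh M i" using linear_betweenD(1)[OF M.linear_out_map x] .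
    moreover have "in_map M i (out_map M i x) = 0" using M x by (simp add: M.stab_iff M.preprojective_iff)
    ultimately have "F (out_map M i x) \<in> {y \<in> nbh M' i. in_map M' i y = 0}"
      using F_nbh in_F sub_hom.map_zero[OF sub] by simp
    then show ?thesis unfolding ker[symmetric] by auto
  qed
  then obtain g where g: "\<And>x. x \<in> vspace M i \<Longrightarrow> g x \<in> vspace M' i"
    "\<And>x. x \<in> vspace M i \<Longrightarrow> out_map M' i (g x) = F (out_map M i x)" by metis
  have act_g: "act M' a (g x) = f (head H a) (act M a x)" if "a \<in> out_arcs H i" "x \<in> vspace M i" for a x
    using fun_cong[OF g(2)[OF that(2)], of a] that(1) by (simp add: F_def out_map_def)
  have lin_g: "linear_between (scalar M) (vspace M i) (scalar M') (vspace M' i) g"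
  proof (rule linear_betweenI)
    note linM = linear_betweenD[OF M.linear_act] and linM' = linear_betweenD[OF M'.linear_act]
    show "g (x + y) = g x + g y" if "x \<in> vspace M i" "y \<in> vspace M i" for x y
    proof (rule inj')
      have xy: "x + y \<in> vspace M i" using that by (simp add: M.subspace_add M.subspace_vspace)
      show "g (x + y) \<in> vspace M' i" "g x + g y \<in> vspace M' i"
        using that xy by (auto intro: g(1) M'.subspace_add M'.subspace_vspace)
      show "out_map M' i (g (x + y)) = out_map M' i (g x + g y)"
      proof
        fix a show "out_map M' i (g (x + y)) a = out_map M' i (g x + g y) a"
        proof (cases "a \<in> out_arcs H i")
          case True
          note a = out[OF True]
          have "act M' a (g x + g y) = act M' a (g x) + act M' a (g y)"
            using linM'(2)[OF a(3)] that a g(1) by simp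
          moreover have "act M a (x + y) = act M a x + act M a y"
            using linM(2)[OF a(3)] that a by simp
          moreover have "f (head H a) (act M a x + act M a y) = f (head H a) (act M a x) + f (head H a) (act M a y)"
            using linear_betweenD(2)[OF f'(1)[OF a(1)]] linM(1)[OF a(3)] that a by simp
          ultimately show ?thesis using True that xy by (simp add: out_map_def act_g)
        qed (simp only: out_map_def if_False)
      qed
    qed
    show "g (scalar M c x) = scalar M' c (g x)" if "x \<in> vspace M i" for c x
    proof (rule inj')
      have xy: "scalar M c x \<in> vspace M i" using that by (simp add: M.subspace_scale M.subspace_vspace)
      show "g (scalar M c x) \<in> vspace M' i" "scalar M' c (g x) \<in> vspace M' i"
        using that xy by (auto intro: g(1) M'.subspace_scale M'.subspace_vspace)
      show "out_map M' i (g (scalar M c x)) = out_map M' i (scalar M' c (g x))"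
      proof
        fix a show "out_map M' i (g (scalar M c x)) a = out_map M' i (scalar M' c (g x)) a"
        proof (cases "a \<in> out_arcs H i")
          case True
          note a = out[OF True]
          have "act M' a (scalar M' c (g x)) = scalar M' c (act M' a (g x))"
            using linM'(3)[OF a(3)] that a g(1) by simp
          moreover have "act M a (scalar M c x) = scalar M c (act M a x)"
            using linM(3)[OF a(3)] that a by simp
          moreover have "f (head H a) (scalar M c (act M a x)) = scalar M' c (f (head H a) (act M a x))"
            using linear_betweenD(3)[OF f'(1)[OF a(1)]] linM(1)[OF a(3)] that a by simp
          ultimately show ?thesis using True that xy by (simp add: out_map_def act_g)
        qed (simp only: out_map_def if_False)
      qed
    qed
  qed (rule g(1))
  interpret g: sub_hom "scalar M" "scalar M'" "vspace M i" "vspace M' i" g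
    by (rule sub_homI[OF M.vector_space_axioms M'.vector_space_axioms lin_g M.subspace_vspace])
  have inj_g: "inj_on g (vspace M i)"
    unfolding g.inj_iff
  proof (intro ballI impI)
    fix x assume x: "x \<in> vspace M i" and 0: "g x = 0"
    have "act M a x = 0" if a: "a \<in> out_arcs H i" for a
    proof -
      note a' = out[OF a]
      have "f (head H a) (act M a x) = 0" using act_g[OF a x] 0 M'.act_zero[OF a'(3)] by simp
      moreover have "act M a x \<in> vspace ?N (head H a)"
        using M.act_closed[OF a'(3,2) refl x] a' by (simp add: N)
      ultimately show ?thesis
        using sub_hom.inj_iff[OF sub, of "head H a"] f(3)[of "head H a"] by (auto simp: bij_betw_def)
    qed
    then show "x = 0" using M i x by (simp add: stab_def)
  qed
  have "M'.dim (g ` vspace M i) = M'.dim (vspace M' i)"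
    using g.dim_img_inj[OF M.fin_dim_vspace inj_g] fun_cong[OF dim, of i] by (simp add: dim_vector_def)
  then have "g ` vspace M i = vspace M' i"
    using g.subspace_img[OF M.subspace_vspace subset_refl] g(1)
    by (intro M'.fin_dim_eqI[OF M'.fin_dim_vspace]) auto
  then have bij_g: "bij_betw g (vspace M i) (vspace M' i)" using inj_g by (simp add: bij_betw_def)
  \<comment> \<open>For an arrow into \<open>i\<close>, compatibility is known with
    \<open>f i\<close> only. Its image lies in the image of \<open>in_map\<close>, where
    \<open>g\<close> and \<open>f i\<close> agree because \<open>out_map M' i\<close> is
    injective.\<close>
  have g_f: "g z = f i z" if z: "z \<in> vspace ?N i" for z
  proof (rule inj')
    have zM: "z \<in> vspace M i" using z N_sub by blast
    show "g z \<in> vspace M' i" by (rule g(1)[OF zM])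
    show "f i z \<in> vspace M' i" using linear_betweenD(1)[OF f(1) z] N'_sub by blast
    show "out_map M' i (g z) = out_map M' i (f i z)"
    proof
      fix a show "out_map M' i (g z) a = out_map M' i (f i z) a"
      proof (cases "a \<in> out_arcs H i")
        case True
        note a = out[OF True]
        have "f (head H a) (act M a z) = act M' a (f i z)"
          using f(2)[OF a(3)] z a(2) by simp
        then show ?thesis using True act_g[OF True zM] by (simp add: out_map_def)
      qed (simp only: out_map_def if_False)
    qed
  qed
  show ?thesis
  proof (rule rep_isomorphicI[where f = "f(i := g)"])
    show "linear_between (scalar M) (vspace M j) (scalar M') (vspace M' j) ((f(i := g)) j)"
      "bij_betw ((f(i := g)) j) (vspace M j) (vspace M' j)" for j
      using lin_g bij_g f' by auto
    fix a x assume a: "a \<in> arcs H" and x: "x \<in> vspace M (tail H a)"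
    consider "head H a = i" "tail H a \<noteq> i" | "head H a \<noteq> i" "tail H a = i" | "head H a \<noteq> i" "tail H a \<noteq> i"
      using tail_neq_head[OF a] by metis
    then show "(f(i := g)) (head H a) (act M a x) = act M' a ((f(i := g)) (tail H a) x)"
    proof cases
      case 1
      then have "act M a x \<in> vspace ?N i" using M.act_in_range[OF a x] by (simp add: N)
      then show ?thesis using 1 g_f f(2)[OF a] x by (simp add: N)
    next
      case 2
      then have "a \<in> out_arcs H i" using a by (simp add: out_arcs_def)
      then show ?thesis using 2 act_g x by simp
    next
      case 3
      then show ?thesis using f(2)[OF a] x by (simp add: N)
    qed
  qed
qed

end

section \<open>Descent on the total dimension, and uniqueness\<close>

context loopfree_quiver
begin

lemma sum_refl:
  assumes "i \<in> J"
  shows "(\<Sum>j\<in>J. refl i n j) = (\<Sum>j\<in>J. n j) - root_to_weight G n i"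
proof -
  have "(\<Sum>j\<in>J. root_to_weight G n i * simple_root i j) = root_to_weight G n i"
    using assms by (simp add: simple_root_def sum.delta' flip: sum_distrib_left)
  then show ?thesis by (simp add: refl_eq sum_subtractf)
qed

lemma dim_vector_eq_0_iff:
  assumes "is_rep H M" shows "dim_vector M i = 0 \<longleftrightarrow> vspace M i = {0}"
proof -
  interpret quiver_rep G M using assms by (rule quiver_repI)
  show ?thesis by (simp add: dim_vector_def dim_eq_0_iff[OF fin_dim_vspace])
qed

text \<open>Every arrow starts or ends in a zero space, so any family of linear isomorphisms is
  compatible with the arrows.\<close>

lemma iso_if_zero_on:
  fixes M :: "('k::field, 'v::ab_group_add, 'i, 'e + 'e) rep"
    and M' :: "('k, 'w::ab_group_add, 'i, 'e + 'e) rep"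
  assumes M: "is_rep H M" "is_rep H M'" and dim: "dim_vector M' = dim_vector M"
    and 0: "\<And>j. j \<in> J \<Longrightarrow> dim_vector M j = 0"
    and arcs: "\<And>a. a \<in> arcs H \<Longrightarrow> tail H a \<in> J \<or> head H a \<in> J"
  shows "rep_isomorphic H M M'"
proof -
  interpret M: quiver_rep G M using M(1) by (rule quiver_repI)
  interpret M': quiver_rep G M' using M(2) by (rule quiver_repI)
  have z: "vspace M j = {0}" "vspace M' j = {0}" if "j \<in> J" for j
    using 0[OF that] dim_vector_eq_0_iff[OF M(1)] dim_vector_eq_0_iff[OF M(2)] dim by auto
  have "\<exists>f. linear_between (scalar M) (vspace M j) (scalar M') (vspace M' j) f \<and>
      bij_betw f (vspace M j) (vspace M' j)" for j
  proof -
    have "M.dim (vspace M j) = M'.dim (vspace M' j)"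
      using fun_cong[OF dim, of j] by (simp add: dim_vector_def)
    then show ?thesis
      using fin_dim_isomorphic[OF M.vector_space_axioms M'.vector_space_axioms
          M.fin_dim_vspace M'.fin_dim_vspace] by metis
  qed
  then obtain f where f: "\<And>j. linear_between (scalar M) (vspace M j) (scalar M') (vspace M' j) (f j)"
    "\<And>j. bij_betw (f j) (vspace M j) (vspace M' j)" by metis
  have f0: "f j 0 = 0" for j
    by (rule sub_hom.map_zero[OF sub_homI[OF M.vector_space_axioms M'.vector_space_axioms f(1) M.subspace_vspace]])
  show ?thesis
  proof (rule rep_isomorphicI[OF f(1) _ f(2)])
    fix a x assume a: "a \<in> arcs H" and x: "x \<in> vspace M (tail H a)"
    have m: "act M a x \<in> vspace M (head H a)" "act M' a (f (tail H a) x) \<in> vspace M' (head H a)"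
      using M.act_closed[OF a refl refl x] M'.act_closed[OF a refl refl linear_betweenD(1)[OF f(1) x]] .
    consider "tail H a \<in> J" | "head H a \<in> J" using arcs[OF a] by blast
    then show "f (head H a) (act M a x) = act M' a (f (tail H a) x)"
    proof cases
      case 1
      then have "x = 0" using x z by auto
      then show ?thesis using M.act_zero[OF a] M'.act_zero[OF a] f0 by simp
    next
      case 2
      then show ?thesis using m z f0 by auto
    qed
  qed
qed

text \<open>A positive pairing at \<open>i\<close> makes the total dimension of
  \<open>shrink_at M i\<close> on \<open>J\<close> smaller by that amount (\<open>sum_refl\<close>).
  The descent stops at modules that vanish on \<open>J\<close>, where the hypothesis
  \<open>arcs\<close> forces all maps to be zero.\<close>

theorem stab_unique:
  fixes M :: "('k::field, 'v::ab_group_add, 'i, 'e + 'e) rep"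
    and M' :: "('k, 'w::ab_group_add, 'i, 'e + 'e) rep"
  assumes J: "pos_def J" and arcs: "\<And>a. a \<in> arcs H \<Longrightarrow> tail H a \<in> J \<or> head H a \<in> J"
    and M: "stab J M" and M': "stab J M'"
    and n: "extremal J (dim_vector M)" and dim: "dim_vector M' = dim_vector M"
  shows "rep_isomorphic H M M'"
  using M M' n dim
proof (induction "nat (\<Sum>j\<in>J. dim_vector M j)" arbitrary: M M' rule: less_induct)
  case less
  show ?case
  proof (cases "\<forall>j\<in>J. dim_vector M j = 0")
    case True
    then show ?thesis
      using less.prems(4) arcs
      by (intro iso_if_zero_on[where J = J, OF stab_rep[OF less.prems(1)] stab_rep[OF less.prems(2)]]) auto
  next
    case False
    then obtain i where i: "i \<in> J" and p: "root_to_weight G (dim_vector M) i > 0"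
      using extremal_descent[OF J less.prems(3)] dim_vector_nonneg by metis
    have n': "extremal J (dim_vector M')" "root_to_weight G (dim_vector M') i \<ge> 0"
      using less.prems p by auto
    have d: "dim_vector (shrink_at M i) = refl i (dim_vector M)"
      using extremal_shrink_at[OF less.prems(1,3) i] p by simp
    have d': "dim_vector (shrink_at M' i) = refl i (dim_vector M)"
      using extremal_shrink_at[OF less.prems(2) n'(1) i n'(2)] less.prems(4) by simp
    have "(\<Sum>j\<in>J. dim_vector M j) \<ge> 0" by (intro sum_nonneg dim_vector_nonneg)
    moreover have "(\<Sum>j\<in>J. dim_vector (shrink_at M i) j) \<ge> 0" by (intro sum_nonneg dim_vector_nonneg)
    ultimately have "nat (\<Sum>j\<in>J. dim_vector (shrink_at M i) j) < nat (\<Sum>j\<in>J. dim_vector M j)"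
      using p unfolding d sum_refl[OF i] by linarith
    then have "rep_isomorphic H (shrink_at M i) (shrink_at M' i)"
      using less.hyps[of "shrink_at M i" "shrink_at M' i"] stab_shrink_at[OF less.prems(1)]
        stab_shrink_at[OF less.prems(2)] extremal_refl[OF less.prems(3) i] d d' by simp
    then show ?thesis
      using extremal_ker_in(1)[OF less.prems(2) n'(1) i n'(2)] less.prems(4)
      by (intro iso_from_shrink_at[OF less.prems(1,2) i]) auto
  qed
qed

text \<open>Shrinking alters neither the maps nor the spaces at frozen vertices. So \<open>x\<close>
  survives to the end of the descent, where the space at the head of \<open>a\<close> is
  zero.\<close>

lemma act_frozen_eq_0:
  fixes M :: "('k::field, 'v::ab_group_add, 'i, 'e + 'e) rep"
  assumes J: "pos_def J" and a: "a \<in> arcs H" "tail H a \<notin> J" "head H a \<in> J"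
    and M: "stab J M" and n: "extremal J (dim_vector M)" and x: "x \<in> vspace M (tail H a)"
  shows "act M a x = 0"
  using M n x
proof (induction "nat (\<Sum>j\<in>J. dim_vector M j)" arbitrary: M rule: less_induct)
  case less
  show ?case
  proof (cases "\<forall>j\<in>J. dim_vector M j = 0")
    case True
    then have "vspace M (head H a) = {0}"
      using a(3) dim_vector_eq_0_iff[OF stab_rep[OF less.prems(1)]] by blast
    then show ?thesis
      using quiver_rep.act_closed[OF stab_quiver_rep[OF less.prems(1)] a(1) refl refl less.prems(3)] by simp
  next
    case False
    then obtain i where i: "i \<in> J" and p: "root_to_weight G (dim_vector M) i > 0"
      using extremal_descent[OF J less.prems(2)] dim_vector_nonneg by metis
    have d: "dim_vector (shrink_at M i) = refl i (dim_vector M)"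
      using extremal_shrink_at[OF less.prems(1,2) i] p by simp
    have "(\<Sum>j\<in>J. dim_vector M j) \<ge> 0" by (intro sum_nonneg dim_vector_nonneg)
    moreover have "(\<Sum>j\<in>J. dim_vector (shrink_at M i) j) \<ge> 0" by (intro sum_nonneg dim_vector_nonneg)
    ultimately have "nat (\<Sum>j\<in>J. dim_vector (shrink_at M i) j) < nat (\<Sum>j\<in>J. dim_vector M j)"
      using p unfolding d sum_refl[OF i] by linarith
    moreover have "tail H a \<noteq> i" using a i by blast
    ultimately have "act (shrink_at M i) a x = 0"
      using less.hyps[of "shrink_at M i"] stab_shrink_at[OF less.prems(1)]
        extremal_refl[OF less.prems(2) i] d less.prems(3) by (simp add: shrink_at_def)
    then show ?thesis by (simp add: shrink_at_def)
  qed
qed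

lemma refl_zero: "refl i (\<lambda>_. 0) = (\<lambda>_. 0)"
  using refl_cmult[of i 0 "\<lambda>_. 0"] by simp

text \<open>Nothing is frozen, so positive definiteness applies to the dimension vector itself and
  finds a positive pairing. Since the vector is not known to be extremal, the descent uses
  \<open>stab_refl\<close> instead of \<open>shrink_at\<close>; when the reflected vector is 0, so
  is the original.\<close>

lemma stab_UNIV_dim_eq_0:
  fixes M :: "('k::field, nat \<Rightarrow> 'k, 'i, 'e + 'e) rep"
  assumes J: "pos_def UNIV" and M: "stab UNIV M"
  shows "dim_vector M = (\<lambda>_. 0)"
  using M
proof (induction "nat (\<Sum>j\<in>UNIV. dim_vector M j)" arbitrary: M rule: less_induct)
  case less
  let ?n = "dim_vector M"
  show ?case
  proof (rule ccontr)
    assume "?n \<noteq> (\<lambda>_. 0)"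
    then have "root_form G ?n ?n > 0"
      using J unfolding pos_def_def by (simp add: restr_def zero_fun_def)
    moreover have "root_form G ?n ?n \<le> 0" if "\<And>i. root_to_weight G ?n i \<le> 0"
      unfolding root_form_eq
      by (intro sum_nonpos mult_nonneg_nonpos dim_vector_nonneg that)
    ultimately obtain i where p: "root_to_weight G ?n i > 0" by (meson linorder_not_le)
    obtain N :: "('k, nat \<Rightarrow> 'k, 'i, 'e + 'e) rep"
      where N: "stab UNIV N" "dim_vector N = refl i ?n"
      using stab_refl[OF less.prems UNIV_I] .
    have "(\<Sum>j\<in>UNIV. ?n j) \<ge> 0" by (intro sum_nonneg dim_vector_nonneg)
    moreover have "(\<Sum>j\<in>UNIV. dim_vector N j) \<ge> 0" by (intro sum_nonneg dim_vector_nonneg)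
    ultimately have "nat (\<Sum>j\<in>UNIV. dim_vector N j) < nat (\<Sum>j\<in>UNIV. ?n j)"
      using p unfolding N(2) sum_refl[OF UNIV_I] by linarith
    then have "refl i ?n = (\<lambda>_. 0)" using less.hyps[of N] N by simp
    then have "refl i (refl i ?n) = (\<lambda>_. 0)" using refl_zero by simp
    then show False using \<open>?n \<noteq> (\<lambda>_. 0)\<close> by simp
  qed
qed

section \<open>Socles of modules over the preprojective algebra\<close>

definition soc :: "('k::field, 'v::ab_group_add, 'i, 'e + 'e) rep \<Rightarrow> 'i \<Rightarrow> 'v set" where
  "soc M i = {x \<in> vspace M i. \<forall>a\<in>out_arcs H i. act M a x = 0}"

text \<open>
  Modules over the preprojective algebra are nilpotent: a module without socle would be stable
  for the framing zero.
\<close>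

lemma soc_nonzero:
  fixes M :: "('k::field, 'v::ab_group_add, 'i, 'e + 'e) rep"
  assumes J: "pos_def UNIV" and M: "preprojective_module G M" and nz: "vspace M i \<noteq> {0}"
  obtains j x where "x \<in> soc M j" "x \<noteq> 0"
proof -
  have "is_rep H M" using M by (simp add: preprojective_module_def)
  have "\<not> stab UNIV M"
  proof
    assume "stab UNIV M"
    then obtain N :: "('k, nat \<Rightarrow> 'k, 'i, 'e + 'e) rep" where "stab UNIV N" "dim_vector N = dim_vector M"
      by (rule stab_transport)
    then have "dim_vector M = (\<lambda>_. 0)" using stab_UNIV_dim_eq_0[OF J, of N] by simp
    then have "dim_vector M i = 0" by (rule fun_cong)
    then show False using nz dim_vector_eq_0_iff[OF \<open>is_rep H M\<close>] by blast
  qed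
  then show ?thesis using that M unfolding stab_def soc_def by blast
qed

lemma subspace_soc:
  assumes "is_rep H M" shows "module.subspace (scalar M) (soc M i)"
proof -
  interpret quiver_rep G M using assms by (rule quiver_repI)
  have "soc M i = {x \<in> vspace M i. out_map M i x = 0}" by (auto simp: soc_def out_map_eq_0_iff)
  then show ?thesis using outm.subspace_ker by simp
qed

lemma subrep_iff:
  "subrep H M U \<longleftrightarrow> (\<forall>i. module.subspace (scalar M) (U i) \<and> U i \<subseteq> vspace M i) \<and>
    (\<forall>a\<in>arcs H. act M a ` U (tail H a) \<subseteq> U (head H a))"
  by (simp add: subrep_def)

text \<open>A simple subrepresentation is itself a module over the preprojective algebra, so by
  \<open>soc_nonzero\<close> it contains a nonzero vector killed by all arrows; the line through
  that vector is a subrepresentation, hence everything. Conversely every such line is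
  simple.\<close>

lemma socle_eq_soc:
  fixes M :: "('k::field, 'v::ab_group_add, 'i, 'e + 'e) rep"
  assumes J: "pos_def UNIV" and M: "preprojective_module G M"
  shows "vspace (socle H M) i = soc M i"
proof -
  have rep: "is_rep H M" using M by (simp add: preprojective_module_def)
  interpret quiver_rep G M using rep by (rule quiver_repI)
  define L where "L i x = (\<lambda>j::'i. if j = i then span {x} else {0 :: 'v})" for i x
  have span_soc: "span {x} \<subseteq> soc M j" if "x \<in> soc M j" for x j
    using that by (intro span_minimal subspace_soc[OF rep]) auto
  have L: "subrep H M (L j x)" if x: "x \<in> soc M j" for j x
    unfolding subrep_iff
  proof (intro conjI allI ballI)
    show "subspace (L j x k)" "L j x k \<subseteq> vspace M k" for k
      using span_soc[OF x] by (auto simp: L_def soc_def)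
    fix a assume a: "a \<in> arcs H"
    have "act M a z = 0" if "z \<in> L j x (tail H a)" for z
      using that span_soc[OF x] act_zero[OF a] a
      by (auto simp: L_def soc_def out_arcs_def split: if_splits)
    then show "act M a ` L j x (tail H a) \<subseteq> L j x (head H a)"
      by (auto simp: L_def span_zero)
  qed
  have "U i \<subseteq> soc M i" if U: "simple_subrep H M U" for U
  proof -
    have "subrep H M U" using U unfolding simple_subrep_def by (rule conjunct1)
    then have sub: "\<And>k. subspace (U k)" "\<And>k. U k \<subseteq> vspace M k"
      "\<And>a x. a \<in> arcs H \<Longrightarrow> x \<in> U (tail H a) \<Longrightarrow> act M a x \<in> U (head H a)"
      unfolding subrep_iff by (auto simp: image_subset_iff)
    obtain k where k: "U k \<noteq> {0}" using U unfolding simple_subrep_def by auto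
    \<comment> \<open>With \<open>J = {}\<close>, \<open>stab_subrep\<close> merely says that the
      relations pass to subrepresentations.\<close>
    have "stab {} M" using M by (simp add: stab_def)
    then have "stab {} (M\<lparr>vspace := U\<rparr>)" using sub by (rule stab_subrep)
    then have "preprojective_module G (M\<lparr>vspace := U\<rparr>)" by (simp add: stab_def)
    moreover have "vspace (M\<lparr>vspace := U\<rparr>) k \<noteq> {0}" using k by simp
    ultimately obtain j x where x: "x \<in> soc (M\<lparr>vspace := U\<rparr>) j" "x \<noteq> 0"
      by (rule soc_nonzero[OF J])
    then have xs: "x \<in> soc M j" "x \<in> U j" using sub(2) by (auto simp: soc_def)
    have "L j x m \<subseteq> U m" for m
      using span_minimal[of "{x}" "U j"] xs sub(1) subspace_0[OF sub(1)] by (auto simp: L_def)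
    then have "(\<forall>m. L j x m = {0}) \<or> (\<forall>m. L j x m = U m)"
      using U L[OF xs(1)] unfolding simple_subrep_def by simp
    moreover have "L j x j \<noteq> {0}" using x(2) span_base[of x "{x}"] by (auto simp: L_def)
    ultimately have "U i = L j x i" by metis
    then show ?thesis
      using span_soc[OF xs(1)] subspace_0[OF subspace_soc[OF rep]] by (auto simp: L_def)
  qed
  then have "span (\<Union>{U i | U. simple_subrep H M U}) \<subseteq> soc M i"
    by (intro span_minimal subspace_soc[OF rep]) blast
  moreover have "soc M i \<subseteq> span (\<Union>{U i | U. simple_subrep H M U})"
  proof
    fix x assume x: "x \<in> soc M i"
    show "x \<in> span (\<Union>{U i | U. simple_subrep H M U})"
    proof (cases "x = 0")
      case False
      have "simple_subrep H M (L i x)"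
        unfolding simple_subrep_def
      proof (intro conjI allI impI L[OF x])
        show "\<exists>j\<in>verts H. L i x j \<noteq> {0}"
          using False span_base[of x "{x}"] by (intro bexI[of _ i]) (auto simp: L_def)
        fix V assume V: "subrep H M V \<and> (\<forall>j\<in>verts H. V j \<subseteq> L i x j)"
        then have sV: "subspace (V j)" "V j \<subseteq> L i x j" for j by (auto simp: subrep_iff)
        have other: "V j = {0}" if "j \<noteq> i" for j
          using sV[of j] subspace_0[OF sV(1)] that by (auto simp: L_def)
        show "(\<forall>j\<in>verts H. V j = {0}) \<or> (\<forall>j\<in>verts H. V j = L i x j)"
        proof (cases "V i = {0}")
          case True
          then show ?thesis using other by metis
        next
          case nz: False
          then obtain y where y: "y \<in> V i" "y \<noteq> 0" using subspace_0[OF sV(1)] by blast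
          then have "y \<in> span {x}" using sV(2)[of i] by (auto simp: L_def)
          then obtain c where c: "y = scalar M c x" by (auto simp: span_singleton)
          then have "c \<noteq> 0" using y(2) by auto
          then have "x = scalar M (inverse c) y" by (simp add: c)
          then have "x \<in> V i" using y(1) sV(1) by (simp add: subspace_scale)
          then have "span {x} \<subseteq> V i" using sV(1) by (intro span_minimal) auto
          then have "V i = L i x i" using sV(2)[of i] by (auto simp: L_def)
          then have "V j = L i x j" for j using other by (cases "j = i") (auto simp: L_def)
          then show ?thesis by blast
        qed
      qed
      moreover have "x \<in> L i x i" by (simp add: L_def span_base)
      ultimately show ?thesis by (intro span_base) blast
    qed (simp add: span_zero)
  qed
  ultimately show ?thesis by (simp add: socle_def)
qed

text \<open>All arrows act by zero on both sides, so an isomorphism is a matter of dimensions at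
  each vertex.\<close>

lemma socle_simple_iff:
  fixes M :: "('k::field, 'v::ab_group_add, 'i, 'e + 'e) rep"
  assumes J: "pos_def UNIV" and M: "preprojective_module G M"
  shows "rep_isomorphic H (socle H M) (simple_module i) \<longleftrightarrow>
    (\<forall>j. vector_space.dim (scalar M) (soc M j) = (if j = i then 1 else 0))"
proof -
  have rep: "is_rep H M" using M by (simp add: preprojective_module_def)
  interpret quiver_rep G M using rep by (rule quiver_repI)
  interpret k: vector_space "(*) :: 'k \<Rightarrow> 'k \<Rightarrow> 'k" by (rule vector_space_times)
  let ?V = "\<lambda>j. if j = i then UNIV else {0 :: 'k}"
  have V: "fin_dim (*) (?V j)" "k.dim (?V j) = (if j = i then 1 else 0)" for j
    using fin_dim_UNIV_times[where ?'k = 'k] k.fin_dim_zero k.dim_eq_0_iff by auto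
  have soc: "fin_dim (scalar M) (soc M j)" for j
    by (rule fin_dim_subset(1)[OF fin_dim_vspace[of j] subspace_soc[OF rep]]) (auto simp: soc_def)
  have fields: "scalar (socle H M) = scalar M" "act (socle H M) = act M"
    by (simp_all add: socle_def)
  note vsp = socle_eq_soc[OF J M]
  show ?thesis
  proof
    assume "rep_isomorphic H (socle H M) (simple_module i)"
    then obtain f where f: "\<forall>j. linear_between (scalar M) (soc M j) (*) (?V j) (f j)"
      "\<forall>j. bij_betw (f j) (soc M j) (?V j)"
      unfolding rep_isomorphic_def rep_hom_def fields vsp by (auto simp: simple_module_def)
    show "\<forall>j. dim (soc M j) = (if j = i then 1 else 0)"
    proof
      fix j
      interpret f: sub_hom "scalar M" "(*)" "soc M j" "?V j" "f j"
        using f by (intro sub_homI vector_space_axioms k.vector_space_axioms subspace_soc[OF rep]) auto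
      have "inj_on (f j) (soc M j)" "f j ` soc M j = ?V j"
        using f(2) by (auto simp: bij_betw_def)
      then show "dim (soc M j) = (if j = i then 1 else 0)"
        using f.dim_img_inj[OF soc] V(2)[of j] by simp
    qed
  next
    assume *: "\<forall>j. dim (soc M j) = (if j = i then 1 else 0)"
    have "\<exists>f. linear_between (scalar M) (soc M j) (*) (?V j) f \<and> bij_betw f (soc M j) (?V j)" for j
    proof -
      have "dim (soc M j) = k.dim (?V j)" unfolding V(2) using * by blast
      then show ?thesis
        using fin_dim_isomorphic[OF vector_space_axioms k.vector_space_axioms soc V(1)] by metis
    qed
    then obtain f where f: "\<And>j. linear_between (scalar M) (soc M j) (*) (?V j) (f j)"
      "\<And>j. bij_betw (f j) (soc M j) (?V j)" by metis
    show "rep_isomorphic H (socle H M) (simple_module i)"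
    proof (rule rep_isomorphicI[where f = f])
      show "linear_between (scalar (socle H M)) (vspace (socle H M) j) (scalar (simple_module i)) (vspace (simple_module i) j) (f j)"
        "bij_betw (f j) (vspace (socle H M) j) (vspace (simple_module i) j)" for j
        using f[of j] unfolding fields vsp by (auto simp: simple_module_def)
      fix a x assume a: "a \<in> arcs H" and x: "x \<in> vspace (socle H M) (tail H a)"
      then have "act M a x = 0" unfolding vsp by (auto simp: soc_def out_arcs_def)
      moreover have "f (head H a) 0 = 0"
        by (rule sub_hom.map_zero[OF sub_homI[OF vector_space_axioms k.vector_space_axioms f(1) subspace_soc[OF rep]]])
      ultimately show "f (head H a) (act (socle H M) a x) = act (simple_module i) a (f (tail H a) x)"
        by (simp add: fields simple_module_def)
    qed
  qed
qed

end

section \<open>The framed quiver\<close>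

context loopfree_quiver
begin

lemma stab_empty: "stab {} M \<longleftrightarrow> preprojective_module G M"
  by (simp add: stab_def)

lemma stab_direct_sum:
  fixes M :: "('k::field, 'v::ab_group_add, 'i, 'e + 'e) rep"
    and M' :: "('k, 'w::ab_group_add, 'i, 'e + 'e) rep"
  assumes M: "stab J M" and M': "stab J M'"
  shows "stab J (direct_sum M M')" "dim_vector (direct_sum M M') = dim_vector M + dim_vector M'"
proof -
  let ?N = "direct_sum M M'"
  interpret M: quiver_rep G M using M by (rule stab_quiver_rep)
  interpret M': quiver_rep G M' using M' by (rule stab_quiver_rep)
  note prod = fin_dim_Times[OF M.vector_space_axioms M'.vector_space_axioms M.fin_dim_vspace M'.fin_dim_vspace]
  have rep: "is_rep H ?N"
    unfolding is_rep_iff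
  proof (intro conjI ballI allI)
    show "vector_space (scalar ?N)"
      unfolding direct_sum_def rep.simps
      by (rule vector_space_map_prod[OF M.vector_space_axioms M'.vector_space_axioms])
    show "fin_dim (scalar ?N) (vspace ?N i)" for i
      using prod(1) by (simp add: direct_sum_def)
    fix a assume a: "a \<in> arcs H"
    show "linear_between (scalar ?N) (vspace ?N (tail H a)) (scalar ?N) (vspace ?N (head H a)) (act ?N a)"
      using linear_betweenD[OF M.linear_act[OF a]] linear_betweenD[OF M'.linear_act[OF a]]
      by (intro linear_betweenI) (auto simp: direct_sum_def)
  qed
  interpret N: quiver_rep G ?N using rep by (rule quiver_repI)
  have vs: "vspace ?N i = vspace M i \<times> vspace M' i" for i by (simp add: direct_sum_def)
  have "in_map ?N i (out_map ?N i (x, y)) = (in_map M i (out_map M i x), in_map M' i (out_map M' i y))" for i x y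
    by (simp add: in_map_def out_map_def direct_sum_def sum_prod)
  moreover have "in_map M i (out_map M i x) = 0" if "x \<in> vspace M i" for x i
    using M that by (simp add: M.stab_iff M.preprojective_iff)
  moreover have "in_map M' i (out_map M' i x) = 0" if "x \<in> vspace M' i" for x i
    using M' that by (simp add: M'.stab_iff M'.preprojective_iff)
  ultimately have "preprojective_module G ?N"
    unfolding N.preprojective_iff vs by (auto simp: zero_prod_def)
  moreover have "z = 0" if i: "i \<in> J" and z: "z \<in> vspace ?N i" and 0: "\<forall>a\<in>out_arcs H i. act ?N a z = 0" for i z
  proof -
    obtain x y where xy: "z = (x, y)" "x \<in> vspace M i" "y \<in> vspace M' i"
      using z by (auto simp: direct_sum_def)
    have "\<forall>a\<in>out_arcs H i. act M a x = 0" "\<forall>a\<in>out_arcs H i. act M' a y = 0"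
      using 0 by (auto simp: xy(1) direct_sum_def zero_prod_def)
    then have "x = 0" "y = 0" using M M' i xy unfolding stab_def by blast+
    then show ?thesis by (simp add: xy zero_prod_def)
  qed
  ultimately show "stab J ?N" unfolding stab_def by blast
  show "dim_vector ?N = dim_vector M + dim_vector M'"
    using prod(2) by (auto simp: dim_vector_def direct_sum_def fun_eq_iff)
qed

lemma rep_isomorphic_direct_sum:
  assumes "rep_isomorphic H M N" "rep_isomorphic H M' N'"
  shows "rep_isomorphic H (direct_sum M M') (direct_sum N N')"
proof -
  obtain f where f: "\<And>i. linear_between (scalar M) (vspace M i) (scalar N) (vspace N i) (f i)"
    "\<And>a x. a \<in> arcs H \<Longrightarrow> x \<in> vspace M (tail H a) \<Longrightarrow> f (head H a) (act M a x) = act N a (f (tail H a) x)"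
    "\<And>i. bij_betw (f i) (vspace M i) (vspace N i)"
    using rep_isomorphicE[OF assms(1)] by blast
  obtain g where g: "\<And>i. linear_between (scalar M') (vspace M' i) (scalar N') (vspace N' i) (g i)"
    "\<And>a x. a \<in> arcs H \<Longrightarrow> x \<in> vspace M' (tail H a) \<Longrightarrow> g (head H a) (act M' a x) = act N' a (g (tail H a) x)"
    "\<And>i. bij_betw (g i) (vspace M' i) (vspace N' i)"
    using rep_isomorphicE[OF assms(2)] by blast
  show ?thesis
  proof (rule rep_isomorphicI[where f = "\<lambda>i. map_prod (f i) (g i)"])
    show "linear_between (scalar (direct_sum M M')) (vspace (direct_sum M M') i)
        (scalar (direct_sum N N')) (vspace (direct_sum N N') i) (map_prod (f i) (g i))" for i
      using linear_betweenD[OF f(1)[of i]] linear_betweenD[OF g(1)[of i]]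
      by (intro linear_betweenI) (auto simp: direct_sum_def)
    show "bij_betw (map_prod (f i) (g i)) (vspace (direct_sum M M') i) (vspace (direct_sum N N') i)" for i
      using f(3)[of i] g(3)[of i]
      by (auto simp: bij_betw_def direct_sum_def map_prod_inj_on map_prod_surj_on)
    show "map_prod (f (head H a)) (g (head H a)) (act (direct_sum M M') a x) =
        act (direct_sum N N') a (map_prod (f (tail H a)) (g (tail H a)) x)"
      if "a \<in> arcs H" "x \<in> vspace (direct_sum M M') (tail H a)" for a x
      using that f(2)[of a "fst x"] g(2)[of a "snd x"] by (auto simp: direct_sum_def)
  qed
qed

end

locale ade =
  fixes Q :: "('i::finite, 'e) pre_digraph"
  assumes ade: "ade_quiver Q"
begin

sublocale loopfree_quiver Q
  by (rule ade_quiver_loopfree[OF ade])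

sublocale fr: loopfree_quiver "framed_quiver Q"
proof
  show "verts (framed_quiver Q) = UNIV"
    by (simp add: framed_quiver_def verts_UNIV)
  show "finite (arcs (framed_quiver Q))"
    by (simp add: framed_quiver_def verts_UNIV finite_arcs)
  show "tail (framed_quiver Q) a \<noteq> head (framed_quiver Q) a" if "a \<in> arcs (framed_quiver Q)" for a
    using that no_loops by (auto simp: framed_quiver_def)
qed

lemma pos_def_UNIV: "pos_def UNIV"
  unfolding pos_def_def
proof (intro allI impI)
  fix x :: "'i \<Rightarrow> int" assume "restr UNIV x = x \<and> x \<noteq> 0"
  then obtain j where j: "x j \<noteq> 0" by (auto simp: fun_eq_iff)
  obtain c :: int where c: "c > 0" "(\<Sum>j\<in>UNIV. (x j)\<^sup>2) \<le> c * root_form Q x x"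
    using ade_quiver_coercive[OF ade] by metis
  have "0 < (\<Sum>j\<in>UNIV. (x j)\<^sup>2)"
    using j by (intro sum_pos2[of _ j]) auto
  then have "0 < c * root_form Q x x" using c(2) by linarith
  then show "root_form Q x x > 0" using c(1) by (simp add: zero_less_mult_iff)
qed

lemma root_to_weight_inj:
  assumes "root_to_weight Q x = root_to_weight Q y" shows "x = y"
proof (rule ccontr)
  assume "x \<noteq> y"
  then have "root_form Q (x - y) (x - y) > 0"
    using pos_def_UNIV unfolding pos_def_def by (simp add: restr_def)
  moreover have "root_form Q (x - y) (x - y) = 0"
    unfolding root_form_eq root_to_weight_diff using assms by simp
  ultimately show False by simp
qed

lemma out_arcs_framed:
  "out_arcs fr.H (Inl i) = insert (Inl (Inr i)) (map_sum Inl Inl ` out_arcs H i)"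
proof -
  have "out_arcs H i = Inl ` {e \<in> arcs Q. tail Q e = i} \<union> Inr ` {e \<in> arcs Q. head Q e = i}"
    by (auto simp: out_arcs_def double_quiver_def)
  then show ?thesis
    by (auto simp: out_arcs_def double_quiver_def framed_quiver_def verts_UNIV image_Un image_image)
qed

lemma inj_map_sum_Inl: "inj_on (map_sum Inl Inl) (A :: ('x + 'y) set)"
  by (auto intro!: inj_onI simp: map_sum_def split: sum.splits)

lemma framed_ends [simp]:
  "head fr.H (map_sum Inl Inl a) = Inl (head H a)" "tail fr.H (map_sum Inl Inl a) = Inl (tail H a)"
  "map_sum Inl Inl a \<in> arcs fr.H \<longleftrightarrow> a \<in> arcs H"
  by (cases a; auto simp: double_quiver_def framed_quiver_def)+

lemma framed_ends_d [simp]: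
  "head fr.H (Inl (Inr i)) = Inr i" "tail fr.H (Inl (Inr i)) = Inl i" "Inl (Inr i) \<in> arcs fr.H"
  "head fr.H (Inr (Inr i)) = Inl i" "tail fr.H (Inr (Inr i)) = Inr i" "Inr (Inr i) \<in> arcs fr.H"
  by (auto simp: double_quiver_def framed_quiver_def verts_UNIV)

lemma framed_arc_cases:
  assumes "b \<in> arcs fr.H"
  obtains a where "b = map_sum Inl Inl a" "a \<in> arcs H" | i where "b = Inl (Inr i)" | i where "b = Inr (Inr i)"
proof -
  consider e where "b = Inl (Inl e)" | i where "b = Inl (Inr i)" | e where "b = Inr (Inl e)" | i where "b = Inr (Inr i)"
    by (metis sum.exhaust)
  then show ?thesis
  proof cases
    case (1 e)
    then show ?thesis using that(1)[of "Inl e"] assms framed_ends(3)[of "Inl e"] by simp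
  next
    case (3 e)
    then show ?thesis using that(1)[of "Inr e"] assms framed_ends(3)[of "Inr e"] by simp
  qed (use that in blast)+
qed

lemma framed_arc_end:
  assumes "b \<in> arcs fr.H" shows "tail fr.H b \<in> range Inl \<or> head fr.H b \<in> range Inl"
  using assms by (rule framed_arc_cases) auto

section \<open>Weights and dimension vectors of the framed quiver\<close>

lemma root_to_weight_framed:
  "root_to_weight (framed_quiver Q) n (Inl i) = root_to_weight Q (\<lambda>j. n (Inl j)) i - n (Inr i)"
proof -
  have "Inl (Inr i) \<notin> map_sum Inl Inl ` out_arcs H i"
    by (auto simp: map_sum_def split: sum.splits)
  moreover have "finite (map_sum Inl Inl ` out_arcs H i)" by simp
  ultimately have "(\<Sum>a\<in>out_arcs fr.H (Inl i). n (head fr.H a)) =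
      n (head fr.H (Inl (Inr i))) + (\<Sum>a\<in>map_sum Inl Inl ` out_arcs H i. n (head fr.H a))"
    unfolding out_arcs_framed by (rule sum.insert[rotated])
  then show ?thesis
    unfolding fr.root_to_weight_eq root_to_weight_eq
    by (simp add: sum.reindex[OF inj_map_sum_Inl])
qed

lemma sum_UNIV_Plus:
  "(\<Sum>x\<in>UNIV. g (x :: 'i + 'i)) = (\<Sum>i\<in>UNIV. g (Inl i)) + (\<Sum>i\<in>UNIV. g (Inr i) :: int)"
  unfolding UNIV_Plus_UNIV[symmetric] by (simp add: sum.Plus del: UNIV_Plus_UNIV)

lemma root_form_framed:
  assumes "fr.restr (range Inl) x = x"
  shows "root_form (framed_quiver Q) x x = root_form Q (\<lambda>i. x (Inl i)) (\<lambda>i. x (Inl i))"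
proof -
  have "x (Inr i) = 0" for i using fun_cong[OF assms, of "Inr i"] by (auto simp: fr.restr_def split: if_splits)
  then show ?thesis
    by (simp add: fr.root_form_eq root_form_eq sum_UNIV_Plus root_to_weight_framed)
qed

lemma pos_def_framed: "fr.pos_def (range Inl)"
  unfolding fr.pos_def_def
proof (intro allI impI)
  fix x :: "'i + 'i \<Rightarrow> int" assume x: "fr.restr (range Inl) x = x \<and> x \<noteq> 0"
  have 0: "x (Inr i) = 0" for i using fun_cong[OF conjunct1[OF x], of "Inr i"] by (auto simp: fr.restr_def split: if_splits)
  have "(\<lambda>i. x (Inl i)) \<noteq> 0"
  proof
    assume "(\<lambda>i. x (Inl i)) = 0"
    then have "x j = 0" for j using 0 by (cases j) (auto simp: fun_eq_iff)
    then show False using x by (auto simp: fun_eq_iff)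
  qed
  then show "root_form (framed_quiver Q) x x > 0"
    using pos_def_UNIV x unfolding pos_def_def by (simp add: root_form_framed restr_def)
qed

text \<open>For \<open>n\<close> the pair \<open>(\<nu>, \<lambda>)\<close> this is
  \<open>\<nu> + \<lambda>\<close> in the weight lattice: the entries at the primed vertices are
  minus the coordinates of \<lambda>.\<close>

definition weight :: "('i + 'i \<Rightarrow> int) \<Rightarrow> 'i weight" where
  "weight n = (\<lambda>i. root_to_weight (framed_quiver Q) n (Inl i))"

definition framing :: "'i weight \<Rightarrow> 'i + 'i \<Rightarrow> int" where
  "framing \<kappa> = case_sum (\<lambda>_. 0) (\<lambda>i. - \<kappa> i)"

abbreviation "sreflects is \<equiv> foldr (simple_reflection Q) is"
text \<open>The pair \<open>(w \<kappa> - \<kappa>, \<kappa>)\<close> for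
  \<open>w = sreflects is\<close>, obtained by reflecting the framing. It makes sense for every
  weight, antidominant or not.\<close>

abbreviation "extr is \<kappa> \<equiv> fr.refls (map Inl is) (framing \<kappa>)"

lemma weight_refl: "weight (fr.refl (Inl i) n) = simple_reflection Q i (weight n)"
proof -
  have "(\<lambda>k. simple_root (Inl i) (Inl k :: 'i + 'i) :: int) = simple_root i"
    by (simp add: simple_root_def)
  moreover have "simple_root (Inl i) (Inr j :: 'i + 'i) = (0 :: int)" for j
    by (simp add: simple_root_def)
  ultimately have "root_to_weight (framed_quiver Q) (simple_root (Inl i)) (Inl j) = root_to_weight Q (simple_root i) j" for j
    unfolding root_to_weight_framed by simp
  then show ?thesis
    by (simp add: weight_def simple_reflection_def fr.refl_eq fr.root_to_weight_diff fr.root_to_weight_cmult)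
qed

lemma weight_refls: "weight (fr.refls (map Inl is) n) = sreflects is (weight n)"
  by (induction "is") (simp_all add: weight_refl)

lemma weight_framing [simp]: "weight (framing \<kappa>) = \<kappa>"
  by (auto simp: weight_def framing_def root_to_weight_framed root_to_weight_eq)

lemma extr_Inr: "extr is \<kappa> (Inr i) = - \<kappa> i"
proof -
  have "extr is \<kappa> (Inr i) = framing \<kappa> (Inr i)" by (rule fr.refls_outside) auto
  then show ?thesis by (simp add: framing_def)
qed

lemma root_to_weight_extr: "root_to_weight Q (\<lambda>i. extr is \<kappa> (Inl i)) = sreflects is \<kappa> - \<kappa>"
proof
  fix i
  have "weight (extr is \<kappa>) i = sreflects is \<kappa> i" by (simp add: weight_refls)
  then show "root_to_weight Q (\<lambda>i. extr is \<kappa> (Inl i)) i = (sreflects is \<kappa> - \<kappa>) i"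
    by (simp add: weight_def root_to_weight_framed extr_Inr)
qed

lemma extr_eqI:
  assumes "root_to_weight Q (\<lambda>i. n (Inl i)) = sreflects is \<kappa> - \<kappa>" "\<And>i. n (Inr i) = - \<kappa> i"
  shows "n = extr is \<kappa>"
proof
  fix j
  have "(\<lambda>i. n (Inl i)) = (\<lambda>i. extr is \<kappa> (Inl i))"
    by (rule root_to_weight_inj) (simp add: assms(1) root_to_weight_extr)
  then show "n j = extr is \<kappa> j"
    using assms(2) by (cases j) (auto simp: extr_Inr dest: fun_cong)
qed

lemma extremal_extr: "fr.extremal (range Inl) (extr is \<kappa>)"
  unfolding fr.extremal_def
  by (intro exI[of _ "map Inl is"] exI[of _ "framing \<kappa>"]) (auto simp: framing_def)

lemma sreflects_rev: "sreflects (rev is) (sreflects is \<kappa>) = \<kappa>"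
proof -
  have "weight (fr.refls (map Inl (rev is)) (extr is \<kappa>)) = \<kappa>" by (simp flip: rev_map)
  then show ?thesis by (simp add: weight_refls)
qed

lemma sreflects_add: "sreflects is (\<kappa> + \<mu>) = sreflects is \<kappa> + sreflects is \<mu>"
proof (induction "is")
  case (Cons i "is")
  have "simple_reflection Q i (x + y) = simple_reflection Q i x + simple_reflection Q i y" for x y
    by (auto simp: simple_reflection_def fun_eq_iff algebra_simps)
  then show ?case by (simp only: foldr.simps o_apply Cons.IH)
qed simp

lemma weyl_group_iff: "w \<in> weyl_group Q \<longleftrightarrow> (\<exists>is. w = sreflects is)"
proof
  show "w \<in> weyl_group Q \<Longrightarrow> \<exists>is. w = sreflects is"
  proof (induction rule: weyl_group.induct)
    case 1
    then show ?case by (intro exI[of _ "[]"]) auto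
  next
    case (2 w i)
    then obtain "is" where "w = sreflects is" by blast
    then show ?case by (intro exI[of _ "i # is"]) auto
  qed
  have "sreflects is \<in> weyl_group Q" for "is"
  proof (induction "is")
    case Nil
    show ?case unfolding foldr.simps by (rule weyl_group.intros(1))
  next
    case (Cons i "is")
    then show ?case unfolding foldr.simps by (rule weyl_group.intros(2)) (simp add: verts_UNIV)
  qed
  then show "\<exists>is. w = sreflects is \<Longrightarrow> w \<in> weyl_group Q" by blast
qed

text \<open>The vectors \<open>extr is \<gamma>\<close> have unprimed entries bounded below. Where
  the sum of these is least the weight is antidominant, since a positive coordinate would allow a
  reflection that lowers the sum. As \<gamma> is arbitrary, no module stands behind these vectors
  and their entries may be negative.\<close>

lemma conjugate_antidominant:
  obtains "is" \<kappa> where "antidominant \<kappa>" "\<gamma> = sreflects is \<kappa>"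
proof -
  obtain c :: int where c: "c > 0" "\<And>x. (\<Sum>j\<in>UNIV. (x j)\<^sup>2) \<le> c * root_form Q x x"
    using ade_quiver_coercive[OF ade] by metis
  \<comment> \<open>Since the defect vanishes, \<open>(\<nu>, \<nu>) = - 2 (\<nu>, \<gamma>)\<close>
    for the unprimed part \<nu>. With coercivity and a completed square, the sum of the squares of
    \<open>\<nu> j + c * \<gamma> j\<close> is at most \<open>R\<close>, and an integer
    \<open>z\<close> satisfies \<open>- z <= z^2\<close>.\<close>
  define R where "R = (\<Sum>j\<in>UNIV. (c * \<gamma> j)\<^sup>2)"
  have lower: "extr is \<gamma> (Inl i) \<ge> - R - c * \<gamma> i" for "is" i
  proof -
    define \<nu> where "\<nu> j = extr is \<gamma> (Inl j)" for j
    let ?x = "fr.restr (range Inl) (extr is \<gamma>)" and ?y = "fr.restr (- range Inl) (extr is \<gamma>)"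
    have xy: "?x (Inl j) = \<nu> j" "?x (Inr j) = 0" "?y (Inl j) = 0" "?y (Inr j) = - \<gamma> j" for j
      by (auto simp: fr.restr_def \<nu>_def extr_Inr)
    have "fr.defect (range Inl) (framing \<gamma>) = 0"
    proof -
      have "fr.restr (range Inl) (framing \<gamma>) = (\<lambda>k. 0 * framing \<gamma> k)"
        by (auto simp: fr.restr_def framing_def fun_eq_iff)
      then show ?thesis unfolding fr.defect_def by (simp only: fr.root_form_linear)
    qed
    moreover have "fr.defect (range Inl) (extr is \<gamma>) = fr.defect (range Inl) (framing \<gamma>)"
      by (rule fr.defect_refls) auto
    ultimately have d: "root_form (framed_quiver Q) ?x ?x + 2 * root_form (framed_quiver Q) ?x ?y = 0"
      by (simp add: fr.defect_alt)
    have "root_form (framed_quiver Q) ?x ?x = root_form Q \<nu> \<nu>"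
    proof -
      have "fr.restr (range Inl) ?x = ?x" by (auto simp: fr.restr_def)
      from root_form_framed[OF this] show ?thesis by (simp only: xy)
    qed
    moreover have "root_form (framed_quiver Q) ?x ?y = (\<Sum>j\<in>UNIV. \<nu> j * \<gamma> j)"
      unfolding fr.root_form_commute[of ?x ?y] fr.root_form_eq[of ?y ?x] sum_UNIV_Plus root_to_weight_framed
      by (simp add: xy root_to_weight_eq)
    ultimately have "root_form Q \<nu> \<nu> = - 2 * (\<Sum>j\<in>UNIV. \<nu> j * \<gamma> j)" using d by simp
    then have "(\<Sum>j\<in>UNIV. (\<nu> j)\<^sup>2) \<le> c * (- 2 * (\<Sum>j\<in>UNIV. \<nu> j * \<gamma> j))" using c(2)[of \<nu>] by simp
    moreover have "(\<Sum>j\<in>UNIV. (\<nu> j + c * \<gamma> j)\<^sup>2) =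
        (\<Sum>j\<in>UNIV. (\<nu> j)\<^sup>2) + c * (2 * (\<Sum>j\<in>UNIV. \<nu> j * \<gamma> j)) + R"
      unfolding R_def power2_sum sum.distrib sum_distrib_left by (simp add: algebra_simps)
    ultimately have "(\<Sum>j\<in>UNIV. (\<nu> j + c * \<gamma> j)\<^sup>2) \<le> R" by simp
    moreover have "(\<nu> i + c * \<gamma> i)\<^sup>2 \<le> (\<Sum>j\<in>UNIV. (\<nu> j + c * \<gamma> j)\<^sup>2)"
      by (rule member_le_sum) auto
    moreover have "- z \<le> z\<^sup>2" for z :: int
    proof (cases "z \<ge> 0")
      case True
      then have "- z \<le> 0" by simp
      also have "0 \<le> z\<^sup>2" by simp
      finally show ?thesis .
    next
      case False
      then have "(- z) * 1 \<le> (- z) * (- z)" by (intro mult_left_mono) auto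
      then show ?thesis by (simp add: power2_eq_square)
    qed
    then have "- (\<nu> i + c * \<gamma> i) \<le> (\<nu> i + c * \<gamma> i)\<^sup>2" .
    ultimately show ?thesis unfolding \<nu>_def by linarith
  qed
  define h where "h is = (\<Sum>i\<in>UNIV. extr is \<gamma> (Inl i))" for "is"
  define B where "B = (\<Sum>i\<in>UNIV. - R - c * \<gamma> i)"
  have hB: "h is \<ge> B" for "is" unfolding h_def B_def by (intro sum_mono lower)
  \<comment> \<open>Subtracting the lower bound \<open>B\<close> turns the sums into natural
    numbers, so that a least one exists.\<close>
  obtain "is" where min: "\<And>js. nat (h is - B) \<le> nat (h js - B)"
    using ex_has_least_nat[of "\<lambda>_. True" "[]" "\<lambda>is. nat (h is - B)"] by auto
  have "antidominant (sreflects is \<gamma>)"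
    unfolding antidominant_def
  proof (intro allI, rule ccontr)
    fix i assume "\<not> sreflects is \<gamma> i \<le> 0"
    then have p: "weight (extr is \<gamma>) i > 0" by (simp add: weight_refls)
    have "h (i # is) = h is - weight (extr is \<gamma>) i"
    proof -
      have "h js = (\<Sum>x\<in>range Inl. extr js \<gamma> x)" for js
        by (simp add: h_def sum.reindex)
      then show ?thesis
        using fr.sum_refl[of "Inl i" "range Inl" "extr is \<gamma>"] by (simp add: weight_def)
    qed
    then show False using p min[of "i # is"] hB[of "i # is"] by linarith
  qed
  then show ?thesis using that[of "sreflects is \<gamma>" "rev is"] sreflects_rev[of "is" \<gamma>] by simp
qed

section \<open>Existence of stable modules and independence of the choices in
  \<open>N_hat\<close>\<close>

lemma stable_iff:
  assumes "is_rep fr.H M"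
  shows "fr.stab (range Inl) M \<longleftrightarrow> preprojective_module (framed_quiver Q) M \<and> stable Q M"
proof -
  interpret M: quiver_rep "framed_quiver Q" M using assms by (rule fr.quiver_repI)
  have "restrict (\<lambda>a. act M a x) (out_arcs fr.H i) = restrict (\<lambda>a. act M a y) (out_arcs fr.H i) \<longleftrightarrow>
      fr.out_map M i x = fr.out_map M i y" for i x y
    unfolding fr.out_map_def restrict_def fun_eq_iff by (rule iff_allI) (simp del: in_out_arcs_conv)
  then show ?thesis
    unfolding M.stab_iff stable_def inj_on_def verts_UNIV by simp
qed

text \<open>\<open>is_N_hat\<close> gives the unprimed dimensions by an equation between weights; it
  determines them because \<open>root_to_weight\<close> is injective, by positive
  definiteness.\<close>

lemma is_N_hat_iff:
  "is_N_hat Q \<gamma> M \<longleftrightarrow> (\<exists>is \<kappa>. antidominant \<kappa> \<and> \<gamma> = sreflects is \<kappa> \<and>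
     fr.stab (range Inl) M \<and> dim_vector M = extr is \<kappa>)"
proof -
  have stab: "fr.stab (range Inl) M \<longleftrightarrow> preprojective_module (framed_quiver Q) M \<and> stable Q M"
  proof (cases "is_rep fr.H M")
    case False
    then show ?thesis by (simp add: fr.stab_def preprojective_module_def)
  qed (rule stable_iff)
  have dim: "dim_vector M = extr is \<kappa> \<longleftrightarrow>
      root_to_weight Q (\<lambda>i. dim_vector M (Inl i)) = sreflects is \<kappa> - \<kappa> \<and> - (\<lambda>i. dim_vector M (Inr i)) = \<kappa>"
    for "is" \<kappa>
  proof
    show "root_to_weight Q (\<lambda>i. dim_vector M (Inl i)) = sreflects is \<kappa> - \<kappa> \<and> - (\<lambda>i. dim_vector M (Inr i)) = \<kappa>"
      if "dim_vector M = extr is \<kappa>"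
      unfolding that by (simp add: root_to_weight_extr extr_Inr fun_eq_iff)
    show "dim_vector M = extr is \<kappa>"
      if "root_to_weight Q (\<lambda>i. dim_vector M (Inl i)) = sreflects is \<kappa> - \<kappa> \<and> - (\<lambda>i. dim_vector M (Inr i)) = \<kappa>"
    proof (rule extr_eqI)
      show "root_to_weight Q (\<lambda>i. dim_vector M (Inl i)) = sreflects is \<kappa> - \<kappa>" using that by blast
      show "dim_vector M (Inr i) = - \<kappa> i" for i
        using fun_cong[OF conjunct2[OF that], of i] by simp
    qed
  qed
  show ?thesis unfolding is_N_hat_def stab dim Bex_def weyl_group_iff by blast
qed

text \<open>The module with zero maps concentrated at the primed vertices is stable for lack of
  vectors at the unprimed ones; reflecting it gives all the others. Antidominance makes its
  dimensions nonnegative.\<close>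

lemma stab_exists:
  assumes "antidominant \<kappa>"
  obtains M :: "('k::field, nat \<Rightarrow> 'k, 'i + 'i, ('e + 'i) + ('e + 'i)) rep"
  where "fr.stab (range Inl) M" "dim_vector M = extr is \<kappa>"
proof -
  let ?t = "fun_scale (*) :: 'k \<Rightarrow> (nat \<Rightarrow> 'k) \<Rightarrow> _"
  interpret t: vector_space ?t by (rule vector_space_fun_scale[OF vector_space_times])
  have "\<exists>V. fin_dim ?t V \<and> t.dim V = nat (framing \<kappa> j)" for j
    using coordinate_space_exists by metis
  then obtain V where V: "\<And>j. fin_dim ?t (V j)" "\<And>j. t.dim (V j) = nat (framing \<kappa> j)" by metis
  define M :: "('k, nat \<Rightarrow> 'k, 'i + 'i, ('e + 'i) + ('e + 'i)) rep"
    where "M = \<lparr>scalar = ?t, vspace = V, act = \<lambda>_ _. 0\<rparr>"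
  have 0: "0 \<in> V j" for j by (rule t.subspace_0[OF fin_dim_subspace[OF V(1)]])
  have rep: "is_rep fr.H M"
    unfolding fr.is_rep_iff using V 0 t.vector_space_axioms by (auto simp: M_def intro: linear_betweenI)
  interpret M: quiver_rep "framed_quiver Q" M using rep by (rule fr.quiver_repI)
  have "preprojective_module (framed_quiver Q) M"
    unfolding M.preprojective_iff by (simp add: fr.in_map_def M_def)
  moreover have "V (Inl i) = {0}" for i
    using V(2)[of "Inl i"] t.dim_0_imp_eq_0[OF V(1)] by (simp add: framing_def)
  ultimately have "fr.stab (range Inl) M" by (auto simp: fr.stab_def M_def)
  then obtain N :: "('k, nat \<Rightarrow> 'k, 'i + 'i, ('e + 'i) + ('e + 'i)) rep"
    where N: "fr.stab (range Inl) N" "dim_vector N = fr.refls (map Inl is) (dim_vector M)"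
    using fr.stab_refls[of "range Inl" M "map Inl is"] by auto
  have "dim_vector M = framing \<kappa>"
    using assms by (auto simp: fun_eq_iff dim_vector_def M_def V(2) framing_def antidominant_def split: sum.split)
  then show ?thesis using that N by simp
qed

text \<open>Two antidominant weights that are conjugate are equal. A stable module over some field,
  here \<open>rat\<close>, makes the entries of \<open>extr is \<kappa>\<close> nonnegative; if an
  unprimed one were nonzero, \<open>extremal_descent\<close> would give the weight a positive
  coordinate.\<close>

lemma antidominant_extr_eq_0:
  assumes "antidominant \<kappa>" "antidominant (sreflects is \<kappa>)"
  shows "extr is \<kappa> (Inl i) = 0" "sreflects is \<kappa> = \<kappa>"
proof -
  obtain M :: "(rat, nat \<Rightarrow> rat, 'i + 'i, ('e + 'i) + ('e + 'i)) rep"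
    where M: "fr.stab (range Inl) M" "dim_vector M = extr is \<kappa>"
    using stab_exists[OF assms(1)] by blast
  show *: "extr is \<kappa> (Inl i) = 0" for i
  proof (rule ccontr)
    have nonneg: "extr is \<kappa> j \<ge> 0" for j using fr.dim_vector_nonneg[of M j] M(2) by simp
    assume "extr is \<kappa> (Inl i) \<noteq> 0"
    then obtain j where "j \<in> range Inl" "root_to_weight (framed_quiver Q) (extr is \<kappa>) j > 0"
      using fr.extremal_descent[OF pos_def_framed extremal_extr nonneg rangeI] by blast
    then obtain k where "weight (extr is \<kappa>) k > 0" by (auto simp: weight_def)
    then show False using assms(2) by (auto simp: weight_refls antidominant_def not_le[symmetric])
  qed
  have "root_to_weight Q (\<lambda>i. extr is \<kappa> (Inl i)) = (\<lambda>_. 0)"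
    unfolding * by (simp add: root_to_weight_eq fun_eq_iff)
  then show "sreflects is \<kappa> = \<kappa>" unfolding root_to_weight_extr by (auto simp: fun_eq_iff)
qed

text \<open>\<open>is_N_hat\<close> admits every antidominant \<kappa> and every \<open>w\<close>
  with \<open>\<gamma> = w \<kappa>\<close>; this makes the dimension vector depend on \<gamma>
  alone.\<close>

lemma extr_unique:
  assumes "antidominant \<kappa>" "antidominant \<mu>" "sreflects is \<kappa> = sreflects js \<mu>"
  shows "extr is \<kappa> = extr js \<mu>"
proof -
  have "sreflects (rev js @ is) \<kappa> = \<mu>" using sreflects_rev[of js \<mu>] assms(3) by simp
  then have "\<mu> = \<kappa>" using antidominant_extr_eq_0(2)[OF assms(1), of "rev js @ is"] assms(2) by simp
  then show ?thesis using assms(3) by (intro extr_eqI) (simp_all add: root_to_weight_extr extr_Inr)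
qed

lemma N_hat_stab:
  assumes "antidominant \<kappa>" "\<gamma> = sreflects is \<kappa>"
  shows "fr.stab (range Inl) (N_hat Q \<gamma> :: ('k::field, _, _, _) rep)"
    "dim_vector (N_hat Q \<gamma> :: ('k, _, _, _) rep) = extr is \<kappa>"
proof -
  obtain M :: "('k, nat \<Rightarrow> 'k, 'i + 'i, ('e + 'i) + ('e + 'i)) rep"
    where "fr.stab (range Inl) M" "dim_vector M = extr is \<kappa>"
    using stab_exists[OF assms(1)] by blast
  then have "is_N_hat Q \<gamma> M" using assms unfolding is_N_hat_iff by blast
  then have "is_N_hat Q \<gamma> (N_hat Q \<gamma> :: ('k, _, _, _) rep)"
    unfolding N_hat_def by (rule someI)
  then show "fr.stab (range Inl) (N_hat Q \<gamma> :: ('k, _, _, _) rep)"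
    "dim_vector (N_hat Q \<gamma> :: ('k, _, _, _) rep) = extr is \<kappa>"
    using extr_unique[OF assms(1)] assms(2) unfolding is_N_hat_iff by metis+
qed

lemma iso_N_hat:
  fixes M :: "('k::field, 'v::ab_group_add, 'i + 'i, ('e + 'i) + ('e + 'i)) rep"
  assumes "antidominant \<kappa>" "\<gamma> = sreflects is \<kappa>" "fr.stab (range Inl) M" "dim_vector M = extr is \<kappa>"
  shows "rep_isomorphic fr.H M (N_hat Q \<gamma> :: ('k, _, _, _) rep)"
  using fr.stab_unique[OF pos_def_framed framed_arc_end assms(3) N_hat_stab(1)[OF assms(1,2)]]
    extremal_extr N_hat_stab(2)[OF assms(1,2)] assms(4) by metis

end

section \<open>From \<open>N_hat\<close> to \<open>N_module\<close>\<close>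

context ade
begin

lemma is_rep_unprimed:
  assumes "is_rep fr.H M" shows "is_rep H (unprimed_rep M)"
proof -
  interpret quiver_rep "framed_quiver Q" M using assms by (rule fr.quiver_repI)
  show ?thesis
    unfolding is_rep_iff
  proof (intro conjI allI ballI)
    fix a assume "a \<in> arcs H"
    then show "linear_between (scalar (unprimed_rep M)) (vspace (unprimed_rep M) (tail H a))
        (scalar (unprimed_rep M)) (vspace (unprimed_rep M) (head H a)) (act (unprimed_rep M) a)"
      using linear_act[of "map_sum Inl Inl a"] by (simp add: unprimed_rep_def)
  qed (simp_all add: unprimed_rep_def vector_space_axioms fin_dim_vspace)
qed

lemma unprimed_iso:
  assumes "rep_isomorphic fr.H M N"
  shows "rep_isomorphic H (unprimed_rep M) (unprimed_rep N)"
proof -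
  obtain f where f: "\<And>i. linear_between (scalar M) (vspace M i) (scalar N) (vspace N i) (f i)"
    "\<And>a x. a \<in> arcs fr.H \<Longrightarrow> x \<in> vspace M (tail fr.H a) \<Longrightarrow>
      f (head fr.H a) (act M a x) = act N a (f (tail fr.H a) x)"
    "\<And>i. bij_betw (f i) (vspace M i) (vspace N i)"
    using fr.rep_isomorphicE[OF assms] by blast
  show ?thesis
  proof (rule rep_isomorphicI[where f = "\<lambda>i. f (Inl i)"])
    show "f (Inl (head H a)) (act (unprimed_rep M) a x) = act (unprimed_rep N) a (f (Inl (tail H a)) x)"
      if "a \<in> arcs H" "x \<in> vspace (unprimed_rep M) (tail H a)" for a x
      using that f(2)[of "map_sum Inl Inl a" x] by (simp add: unprimed_rep_def)
  qed (use f in \<open>simp_all add: unprimed_rep_def\<close>)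
qed

text \<open>\<open>N_module\<close> picks a quotient by \<open>SOME\<close>, so one must exist over
  the same ambient type: \<open>M\<close> with the primed spaces replaced by zero. The hypothesis
  \<open>d\<close> makes the primed part closed under the arrows that leave it.\<close>

lemma quotient_by_primed_part:
  fixes M :: "('k::field, 'v::ab_group_add, 'i + 'i, ('e + 'i) + ('e + 'i)) rep"
  assumes M: "is_rep fr.H M" and d: "\<And>i x. x \<in> vspace M (Inr i) \<Longrightarrow> act M (Inr (Inr i)) x = 0"
  shows "\<exists>L :: ('k, 'v, 'i + 'i, ('e + 'i) + ('e + 'i)) rep. is_quotient fr.H M (primed_part M) L"
proof -
  interpret quiver_rep "framed_quiver Q" M using M by (rule fr.quiver_repI)
  define L :: "('k, 'v, 'i + 'i, ('e + 'i) + ('e + 'i)) rep" where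
    "L = \<lparr>scalar = scalar M, vspace = case_sum (\<lambda>i. vspace M (Inl i)) (\<lambda>i. {0}),
      act = \<lambda>b x. case b of Inl (Inr i) \<Rightarrow> 0 | Inr (Inr i) \<Rightarrow> 0 | _ \<Rightarrow> act M b x\<rparr>"
  have act_L: "act L (map_sum Inl Inl a) = act M (map_sum Inl Inl a)" for a
    by (cases a) (simp_all add: L_def)
  have sub: "subrep fr.H M (primed_part M)"
    unfolding fr.subrep_iff
  proof (intro conjI allI ballI)
    show "subspace (primed_part M j)" "primed_part M j \<subseteq> vspace M j" for j
      by (cases j; simp add: primed_part_def subspace_vspace)+
    fix b assume b: "b \<in> arcs fr.H"
    then show "act M b ` primed_part M (tail fr.H b) \<subseteq> primed_part M (head fr.H b)"
    proof (cases rule: framed_arc_cases)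
      case (1 a)
      then show ?thesis using act_zero[OF b] by (simp add: primed_part_def)
    next
      case (2 i)
      then show ?thesis using act_zero[OF b] by (simp add: primed_part_def)
    next
      case (3 i)
      then show ?thesis using d by (auto simp: primed_part_def)
    qed
  qed
  have "is_rep fr.H L"
    unfolding fr.is_rep_iff
  proof (intro conjI allI ballI)
    show "vector_space (scalar L)" by (simp add: L_def vector_space_axioms)
    show "fin_dim (scalar L) (vspace L j)" for j
      by (cases j) (simp_all add: L_def fin_dim_vspace fin_dim_zero)
    fix b assume b: "b \<in> arcs fr.H"
    then show "linear_between (scalar L) (vspace L (tail fr.H b)) (scalar L) (vspace L (head fr.H b)) (act L b)"
    proof (cases rule: framed_arc_cases)
      case (1 a)
      then show ?thesis using linear_act[OF b] by (simp add: act_L) (simp add: L_def)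
    qed (auto simp: L_def intro!: linear_betweenI)
  qed
  moreover have "rep_hom fr.H M L (case_sum (\<lambda>i x. x) (\<lambda>i x. 0))" (is "rep_hom _ _ _ ?f")
    unfolding rep_hom_def fr.verts_double
  proof (intro conjI ballI)
    show "linear_between (scalar M) (vspace M j) (scalar L) (vspace L j) (?f j)" for j
      by (cases j) (auto simp: L_def intro!: linear_betweenI)
    fix b x assume b: "b \<in> arcs fr.H" and x: "x \<in> vspace M (tail fr.H b)"
    show "?f (head fr.H b) (act M b x) = act L b (?f (tail fr.H b) x)"
      using b
    proof (cases rule: framed_arc_cases)
      case (1 a)
      then show ?thesis by (simp add: act_L)
    qed (use x d in \<open>auto simp: L_def\<close>)
  qed
  moreover have "\<forall>j\<in>verts fr.H. ?f j ` vspace M j = vspace L j \<and> {x \<in> vspace M j. ?f j x = 0} = primed_part M j"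
  proof
    fix j
    have "(\<lambda>_. 0 :: 'v) ` vspace M k = {0}" for k by (rule image_constant[OF zero_vspace])
    then show "?f j ` vspace M j = vspace L j \<and> {x \<in> vspace M j. ?f j x = 0} = primed_part M j"
      using zero_vspace by (cases j) (auto simp: L_def primed_part_def)
  qed
  ultimately have "is_quotient fr.H M (primed_part M) L"
    using sub unfolding is_quotient_def by blast
  then show ?thesis by blast
qed

text \<open>Whatever quotient is picked, its projection is injective at the unprimed vertices,
  because the primed part vanishes there.\<close>

lemma quotient_unprimed_iso:
  assumes M: "is_rep fr.H M" and L: "is_quotient fr.H M (primed_part M) L"
  shows "rep_isomorphic H (unprimed_rep M) (unprimed_rep L)" "is_rep H (unprimed_rep L)"
proof -
  interpret quiver_rep "framed_quiver Q" M using M by (rule fr.quiver_repI)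
  have rL: "is_rep fr.H L" using L by (simp add: is_quotient_def)
  interpret L: quiver_rep "framed_quiver Q" L using rL by (rule fr.quiver_repI)
  show "is_rep H (unprimed_rep L)" by (rule is_rep_unprimed[OF rL])
  obtain f where f: "rep_hom fr.H M L f"
    and f': "\<And>j. f j ` vspace M j = vspace L j" "\<And>j. {x \<in> vspace M j. f j x = 0} = primed_part M j"
    using L unfolding is_quotient_def by auto
  have lin: "linear_between (scalar M) (vspace M j) (scalar L) (vspace L j) (f j)" for j
    using f unfolding rep_hom_def by simp
  have act: "f (head fr.H b) (act M b x) = act L b (f (tail fr.H b) x)"
    if "b \<in> arcs fr.H" "x \<in> vspace M (tail fr.H b)" for b x
    using f that unfolding rep_hom_def by blast
  have inj: "inj_on (f (Inl i)) (vspace M (Inl i))" for i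
  proof -
    interpret f: sub_hom "scalar M" "scalar L" "vspace M (Inl i)" "vspace L (Inl i)" "f (Inl i)"
      by (rule sub_homI[OF vector_space_axioms L.vector_space_axioms lin subspace_vspace])
    show ?thesis unfolding f.inj_iff using f'(2)[of "Inl i"] by (auto simp: primed_part_def)
  qed
  show "rep_isomorphic H (unprimed_rep M) (unprimed_rep L)"
  proof (rule rep_isomorphicI[where f = "\<lambda>i. f (Inl i)"])
    show "linear_between (scalar (unprimed_rep M)) (vspace (unprimed_rep M) i)
        (scalar (unprimed_rep L)) (vspace (unprimed_rep L) i) (f (Inl i))" for i
      using lin by (simp add: unprimed_rep_def)
    show "bij_betw (f (Inl i)) (vspace (unprimed_rep M) i) (vspace (unprimed_rep L) i)" for i
      using inj f'(1) by (simp add: unprimed_rep_def bij_betw_def)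
    show "f (Inl (head H a)) (act (unprimed_rep M) a x) = act (unprimed_rep L) a (f (Inl (tail H a)) x)"
      if "a \<in> arcs H" "x \<in> vspace (unprimed_rep M) (tail H a)" for a x
      using that act[of "map_sum Inl Inl a" x] by (simp add: unprimed_rep_def)
  qed
qed

lemma N_hat_rep: "is_rep fr.H (N_hat Q \<gamma> :: ('k::field, _, _, _) rep)"
proof -
  obtain "is" \<kappa> where "antidominant \<kappa>" "\<gamma> = sreflects is \<kappa>" by (rule conjugate_antidominant)
  then show ?thesis by (rule fr.stab_rep[OF N_hat_stab(1)])
qed

lemma N_hat_d_star:
  assumes x: "x \<in> vspace (N_hat Q \<gamma> :: ('k::field, _, _, _) rep) (Inr i)"
  shows "act (N_hat Q \<gamma> :: ('k, _, _, _) rep) (Inr (Inr i)) x = 0"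
proof -
  let ?M = "N_hat Q \<gamma> :: ('k, nat \<Rightarrow> 'k, 'i + 'i, ('e + 'i) + ('e + 'i)) rep"
  obtain "is" \<kappa> where \<kappa>: "antidominant \<kappa>" "\<gamma> = sreflects is \<kappa>" by (rule conjugate_antidominant)
  have "fr.stab (range Inl) ?M" by (rule N_hat_stab(1)[OF \<kappa>])
  moreover have "fr.extremal (range Inl) (dim_vector ?M)"
    unfolding N_hat_stab(2)[OF \<kappa>] by (rule extremal_extr)
  ultimately show ?thesis
    using x by (intro fr.act_frozen_eq_0[OF pos_def_framed]) auto
qed

lemma N_module_iso:
  "rep_isomorphic H (unprimed_rep (N_hat Q \<gamma>)) (N_module Q \<gamma> :: ('k::field, _, _, _) rep)"
  "is_rep H (N_module Q \<gamma> :: ('k, _, _, _) rep)"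
proof -
  let ?M = "N_hat Q \<gamma> :: ('k, nat \<Rightarrow> 'k, 'i + 'i, ('e + 'i) + ('e + 'i)) rep"
  have "\<exists>L :: ('k, nat \<Rightarrow> 'k, 'i + 'i, ('e + 'i) + ('e + 'i)) rep. is_quotient fr.H ?M (primed_part ?M) L"
    by (rule quotient_by_primed_part[OF N_hat_rep]) (rule N_hat_d_star)
  then have "is_quotient fr.H ?M (primed_part ?M)
      (SOME L :: ('k, nat \<Rightarrow> 'k, 'i + 'i, ('e + 'i) + ('e + 'i)) rep. is_quotient fr.H ?M (primed_part ?M) L)"
    by (rule someI_ex)
  from quotient_unprimed_iso[OF N_hat_rep this]
  show "rep_isomorphic H (unprimed_rep ?M) (N_module Q \<gamma>)" "is_rep H (N_module Q \<gamma> :: ('k, _, _, _) rep)"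
    unfolding N_module_def by this+
qed

text \<open>The relation of the framed quiver at \<open>i\<close> differs from that of
  \<open>Q\<close> by a term that passes through \<open>i'\<close>, and this term is zero by
  \<open>N_hat_d_star\<close>.\<close>

lemma N_module_preprojective:
  "preprojective_module Q (N_module Q \<gamma> :: ('k::field, _, _, _) rep)"
proof -
  let ?M = "N_hat Q \<gamma> :: ('k, nat \<Rightarrow> 'k, 'i + 'i, ('e + 'i) + ('e + 'i)) rep"
  obtain "is" \<kappa> where \<kappa>: "antidominant \<kappa>" "\<gamma> = sreflects is \<kappa>" by (rule conjugate_antidominant)
  interpret M: quiver_rep "framed_quiver Q" ?M using N_hat_rep by (rule fr.quiver_repI)
  have "preprojective_module (framed_quiver Q) ?M"
  proof -
    have "fr.stab (range Inl) ?M" by (rule N_hat_stab(1)[OF \<kappa>])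
    then show ?thesis unfolding fr.stab_def by blast
  qed
  then have rel: "(\<Sum>a\<in>in_arcs H i. scalar ?M (arrow_sign a)
      (act ?M (map_sum Inl Inl a) (act ?M (map_sum Inl Inl (star a)) x))) =
      act ?M (Inr (Inr i)) (act ?M (Inl (Inr i)) x)" if "x \<in> vspace ?M (Inl i)" for i x
    using that unfolding preprojective_module_framed_iff[OF verts_UNIV finite_arcs] by blast
  have "act ?M (Inr (Inr i)) (act ?M (Inl (Inr i)) x) = 0" if "x \<in> vspace ?M (Inl i)" for i x
    using that by (intro N_hat_d_star M.act_closed[of _ "Inl i"]) auto
  then have "preprojective_module Q (unprimed_rep ?M)"
    unfolding preprojective_module_def using is_rep_unprimed[OF M.rep] rel by (simp add: unprimed_rep_def)
  then show ?thesis
    using stab_iso[OF _ N_module_iso(2,1)] stab_empty by metis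
qed

lemma N_module_dim:
  assumes "antidominant \<kappa>" "\<gamma> = sreflects is \<kappa>"
  shows "dim_vector (N_module Q \<gamma> :: ('k::field, _, _, _) rep) = (\<lambda>i. extr is \<kappa> (Inl i))"
proof -
  let ?M = "N_hat Q \<gamma> :: ('k, nat \<Rightarrow> 'k, 'i + 'i, ('e + 'i) + ('e + 'i)) rep"
  have "dim_vector (N_module Q \<gamma> :: ('k, _, _, _) rep) = dim_vector (unprimed_rep ?M)"
    by (rule dim_vector_iso[OF is_rep_unprimed[OF N_hat_rep] N_module_iso(2,1)])
  also have "\<dots> = (\<lambda>i. dim_vector ?M (Inl i))"
    by (rule ext) (simp add: dim_vector_def unprimed_rep_def)
  finally show ?thesis by (simp add: N_hat_stab(2)[OF assms])
qed

lemma N_module_antidominant: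
  assumes "antidominant \<gamma>"
  shows "zero_rep H (N_module Q \<gamma> :: ('k::field, _, _, _) rep)"
proof -
  have "dim_vector (N_module Q \<gamma> :: ('k, _, _, _) rep) = (\<lambda>i. extr [] \<gamma> (Inl i))"
    by (rule N_module_dim[OF assms]) simp
  then have "dim_vector (N_module Q \<gamma> :: ('k, _, _, _) rep) i = 0" for i
    by (auto simp: framing_def dest: fun_cong)
  then show ?thesis
    unfolding zero_rep_def using dim_vector_eq_0_iff[OF N_module_iso(2)] by blast
qed

lemma iso_N_module:
  fixes M :: "('k::field, 'v::ab_group_add, 'i + 'i, ('e + 'i) + ('e + 'i)) rep"
  assumes "antidominant \<kappa>" "\<gamma> = sreflects is \<kappa>" "fr.stab (range Inl) M" "dim_vector M = extr is \<kappa>"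
  shows "rep_isomorphic H (unprimed_rep M) (N_module Q \<gamma> :: ('k, _, _, _) rep)"
  by (rule rep_isomorphic_trans[OF unprimed_iso[OF iso_N_hat[OF assms]] N_module_iso(1)])

text \<open>One \<open>w\<close> serves both weights and reflections are additive, so the direct sum
  of the two \<open>N_hat\<close> is stable with the dimension vector that belongs to
  \<open>\<gamma> + \<delta>\<close>.\<close>

lemma N_module_add:
  assumes "same_chamber Q \<gamma> \<delta>"
  shows "rep_isomorphic H (N_module Q (\<gamma> + \<delta>) :: ('k::field, _, _, _) rep)
    (direct_sum (N_module Q \<gamma> :: ('k, _, _, _) rep) (N_module Q \<delta> :: ('k, _, _, _) rep))"
proof -
  obtain "is" \<kappa> \<mu> where a: "antidominant \<kappa>" "antidominant \<mu>" and
    \<gamma>: "\<gamma> = sreflects is \<kappa>" and \<delta>: "\<delta> = sreflects is \<mu>"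
    using assms unfolding same_chamber_def Bex_def weyl_group_iff by blast
  let ?M = "N_hat Q \<gamma> :: ('k, nat \<Rightarrow> 'k, 'i + 'i, ('e + 'i) + ('e + 'i)) rep"
  let ?N = "N_hat Q \<delta> :: ('k, nat \<Rightarrow> 'k, 'i + 'i, ('e + 'i) + ('e + 'i)) rep"
  let ?S = "direct_sum (N_module Q \<gamma> :: ('k, _, _, _) rep) (N_module Q \<delta> :: ('k, _, _, _) rep)"
  have \<kappa>\<mu>: "antidominant (\<kappa> + \<mu>)" using a by (auto simp: antidominant_def add_nonpos_nonpos)
  have sum: "\<gamma> + \<delta> = sreflects is (\<kappa> + \<mu>)" by (simp only: \<gamma> \<delta> sreflects_add)
  note ds = fr.stab_direct_sum[OF N_hat_stab(1)[OF a(1) \<gamma>] N_hat_stab(1)[OF a(2) \<delta>]]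
  have "framing (\<kappa> + \<mu>) = framing \<kappa> + framing \<mu>"
    by (auto simp: framing_def fun_eq_iff split: sum.split)
  then have "dim_vector (direct_sum ?M ?N) = extr is (\<kappa> + \<mu>)"
    unfolding ds(2) N_hat_stab(2)[OF a(1) \<gamma>] N_hat_stab(2)[OF a(2) \<delta>] by (simp only: fr.refls_add)
  from iso_N_module[OF \<kappa>\<mu> sum ds(1) this]
  have "rep_isomorphic H (unprimed_rep (direct_sum ?M ?N)) (N_module Q (\<gamma> + \<delta>) :: ('k, _, _, _) rep)" .
  moreover have "is_rep H (unprimed_rep (direct_sum ?M ?N))"
    by (rule is_rep_unprimed[OF fr.stab_rep[OF ds(1)]])
  ultimately have 1: "rep_isomorphic H (N_module Q (\<gamma> + \<delta>) :: ('k, _, _, _) rep) (unprimed_rep (direct_sum ?M ?N))"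
    using rep_isomorphic_sym N_module_iso(2) by blast
  have "unprimed_rep (direct_sum ?M ?N) = direct_sum (unprimed_rep ?M) (unprimed_rep ?N)"
    by (simp add: unprimed_rep_def direct_sum_def)
  then have 2: "rep_isomorphic H (unprimed_rep (direct_sum ?M ?N)) ?S"
    using rep_isomorphic_direct_sum[OF N_module_iso(1) N_module_iso(1)] by metis
  show ?thesis by (rule rep_isomorphic_trans[OF 1 2])
qed

section \<open>The modules attached to a fundamental weight\<close>

lemma antidominant_fundamental: "antidominant (- fundamental_weight i)"
  by (simp add: antidominant_def fundamental_weight_def)

lemma N_module_fundamental_dim:
  assumes "\<gamma> = sreflects is (- fundamental_weight i)"
  shows "root_to_weight Q (dim_vector (N_module Q \<gamma> :: ('k::field, _, _, _) rep)) = \<gamma> + fundamental_weight i"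
  unfolding N_module_dim[OF antidominant_fundamental assms] root_to_weight_extr
  by (simp add: assms)

text \<open>On \<open>soc\<close> at \<open>j\<close> all arrows but \<open>d_j\<close> vanish, so
  stability makes \<open>d_j\<close> injective there. The space at \<open>j'\<close> is a line for
  \<open>j = i\<close> and zero otherwise, which leaves at most a line at \<open>i\<close>; it is
  not zero, since \<open>ne\<close> makes the module nonzero.\<close>

lemma N_module_fundamental_socle:
  assumes \<gamma>: "\<gamma> = sreflects is (- fundamental_weight i)" and ne: "\<gamma> \<noteq> - fundamental_weight i"
  shows "rep_isomorphic H (socle H (N_module Q \<gamma> :: ('k::field, _, _, _) rep)) (simple_module i)"
  unfolding socle_simple_iff[OF pos_def_UNIV N_module_preprojective]
proof -
  let ?N = "N_module Q \<gamma> :: ('k, nat \<Rightarrow> 'k, 'i, 'e + 'e) rep"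
  let ?M = "N_hat Q \<gamma> :: ('k, nat \<Rightarrow> 'k, 'i + 'i, ('e + 'i) + ('e + 'i)) rep"
  have hat: "fr.stab (range Inl) ?M" "dim_vector ?M = extr is (- fundamental_weight i)"
    by (rule N_hat_stab[OF antidominant_fundamental \<gamma>])+
  interpret M: quiver_rep "framed_quiver Q" ?M using N_hat_rep by (rule fr.quiver_repI)
  interpret N: quiver_rep Q ?N using N_module_iso(2) by (rule quiver_repI)
  obtain g where g: "\<And>j. linear_between (scalar ?N) (vspace ?N j) (scalar ?M) (vspace ?M (Inl j)) (g j)"
    "\<And>a x. a \<in> arcs H \<Longrightarrow> x \<in> vspace ?N (tail H a) \<Longrightarrow>
      g (head H a) (act ?N a x) = act ?M (map_sum Inl Inl a) (g (tail H a) x)"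
    "\<And>j. bij_betw (g j) (vspace ?N j) (vspace ?M (Inl j))"
    using rep_isomorphicE[OF rep_isomorphic_sym[OF is_rep_unprimed[OF M.rep] N.rep N_module_iso(1)]]
    by (auto simp: unprimed_rep_def)
  have g0: "g j 0 = 0" for j
    by (rule sub_hom.map_zero[OF sub_homI[OF N.vector_space_axioms M.vector_space_axioms g(1) N.subspace_vspace]])
  have soc_sub: "soc ?N j \<subseteq> vspace ?N j" for j by (auto simp: soc_def)
  have le: "N.dim (soc ?N j) \<le> (if j = i then 1 else 0)" "fin_dim (scalar ?N) (soc ?N j)" for j
  proof -
    let ?h = "\<lambda>x. act ?M (Inl (Inr j)) (g j x)"
    have lin: "linear_between (scalar ?N) (vspace ?N j) (scalar ?M) (vspace ?M (Inr j)) ?h"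
      using linear_between_compose[OF g(1) M.linear_act[of "Inl (Inr j)", simplified]] .
    then have "linear_between (scalar ?N) (soc ?N j) (scalar ?M) (vspace ?M (Inr j)) ?h"
      using linear_betweenD(1)[OF lin] soc_sub by (intro linear_between_mono[OF lin]) auto
    then interpret h: sub_hom "scalar ?N" "scalar ?M" "soc ?N j" "vspace ?M (Inr j)" ?h
      by (rule sub_homI[OF N.vector_space_axioms M.vector_space_axioms _ subspace_soc[OF N.rep]])
    have "inj_on ?h (soc ?N j)"
      unfolding h.inj_iff
    proof (intro ballI impI)
      fix x assume x: "x \<in> soc ?N j" and 0: "?h x = 0"
      have xV: "x \<in> vspace ?N j" using x soc_sub by blast
      have "act ?M b (g j x) = 0" if b: "b \<in> out_arcs fr.H (Inl j)" for b
      proof -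
        consider "b = Inl (Inr j)" | a where "b = map_sum Inl Inl a" "a \<in> out_arcs H j"
          using b unfolding out_arcs_framed by blast
        then show ?thesis
        proof cases
          case (2 a)
          then have "act ?M b (g j x) = g (head H a) (act ?N a x)"
            using g(2)[of a x] xV by (simp add: out_arcs_def)
          also have "act ?N a x = 0" using x 2 by (simp add: soc_def)
          finally show ?thesis by (simp only: g0)
        qed (use 0 in simp)
      qed
      moreover have "g j x \<in> vspace ?M (Inl j)" using linear_betweenD(1)[OF g(1) xV] .
      ultimately have "g j x = 0" using hat(1) unfolding fr.stab_def by blast
      then show "x = 0"
        using g(3)[of j] xV g0 N.zero_vspace[of j] by (metis bij_betw_def inj_onD)
    qed
    from h.fin_dim_inj[OF M.fin_dim_vspace this]
    show "fin_dim (scalar ?N) (soc ?N j)" "N.dim (soc ?N j) \<le> (if j = i then 1 else 0)"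
      using fun_cong[OF hat(2), of "Inr j"] unfolding extr_Inr
      by (auto simp: dim_vector_def fundamental_weight_def split: if_splits)
  qed
  have "\<exists>j. vspace ?N j \<noteq> {0}"
  proof (rule ccontr)
    assume "\<not> (\<exists>j. vspace ?N j \<noteq> {0})"
    then have "dim_vector ?N = (\<lambda>_. 0)" using dim_vector_eq_0_iff[OF N.rep] by auto
    then have "root_to_weight Q (\<lambda>_. 0) = \<gamma> + fundamental_weight i"
      using N_module_fundamental_dim[OF \<gamma>, where 'k = 'k] by simp
    moreover have "root_to_weight Q (\<lambda>_. 0) = (\<lambda>_. 0)" by (simp add: root_to_weight_eq fun_eq_iff)
    ultimately have "\<gamma> = - fundamental_weight i" by (simp add: fun_eq_iff eq_neg_iff_add_eq_0)
    then show False using ne by contradiction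
  qed
  then obtain j x where jx: "x \<in> soc ?N j" "x \<noteq> 0"
    using soc_nonzero[OF pos_def_UNIV N_module_preprojective] by metis
  then have "N.dim (soc ?N j) \<noteq> 0" using N.dim_eq_0_iff[OF le(2)] by blast
  then have "j = i" "N.dim (soc ?N i) = 1" using le(1)[of j] by (auto split: if_splits)
  moreover have "N.dim (soc ?N k) = 0" if "k \<noteq> i" for k using le(1)[of k] that by simp
  ultimately show "\<forall>j. N.dim (soc ?N j) = (if j = i then 1 else 0)" by simp
qed

text \<open>One ambient type has to hold both the spaces of \<open>M\<close> and the line at
  \<open>i'\<close>, hence the product: the former sit in the first factor and the latter in the
  second. The functional \<open>g\<close> becomes the arrow \<open>d_i\<close>.\<close>

definition frame ::
  "('k::field, 'v::ab_group_add, 'i, 'e + 'e) rep \<Rightarrow> 'i \<Rightarrow> ('v \<Rightarrow> 'k) \<Rightarrow>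
    ('k, 'v \<times> 'k, 'i + 'i, ('e + 'i) + ('e + 'i)) rep" where
  "frame M i g = \<lparr>scalar = \<lambda>c. map_prod (scalar M c) ((*) c),
    vspace = case_sum (\<lambda>j. vspace M j \<times> {0}) (\<lambda>j. {0} \<times> (if j = i then UNIV else {0})),
    act = \<lambda>b (x, c). case b of Inl (Inl e) \<Rightarrow> (act M (Inl e) x, 0) | Inr (Inl e) \<Rightarrow> (act M (Inr e) x, 0)
      | Inl (Inr j) \<Rightarrow> (0, if j = i then g x else 0) | Inr (Inr j) \<Rightarrow> 0\<rparr>"

lemma frame_simps [simp]:
  "scalar (frame M i g) = (\<lambda>c. map_prod (scalar M c) ((*) c))"
  "vspace (frame M i g) (Inl j) = vspace M j \<times> {0}"
  "vspace (frame M i g) (Inr j) = {0} \<times> (if j = i then UNIV else {0})"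
  "act (frame M i g) (map_sum Inl Inl a) (x, c) = (act M a x, 0)"
  "act (frame M i g) (Inl (Inr j)) (x, c) = (0, if j = i then g x else 0)"
  "act (frame M i g) (Inr (Inr j)) y = 0"
  by (cases a; auto simp: frame_def)+

text \<open>The arrows back from the primed vertices act by zero, so the relations are those of
  \<open>M\<close>. A vector at \<open>j\<close> killed by all arrows of \<open>M\<close> lies in
  \<open>soc M j\<close>, which is zero unless \<open>j = i\<close>, and there \<open>g\<close>
  detects it.\<close>

lemma stab_frame:
  fixes M :: "('k::field, 'v::ab_group_add, 'i, 'e + 'e) rep"
  assumes M: "preprojective_module Q M" and g: "Vector_Spaces.linear (scalar M) (*) g"
    and soc: "\<And>j x. x \<in> soc M j \<Longrightarrow> j \<noteq> i \<Longrightarrow> x = 0" "\<And>x. x \<in> soc M i \<Longrightarrow> g x = 0 \<Longrightarrow> x = 0"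
  shows "fr.stab (range Inl) (frame M i g)"
    "dim_vector (frame M i g) (Inl j) = dim_vector M j"
    "dim_vector (frame M i g) (Inr j) = fundamental_weight i j"
proof -
  let ?F = "frame M i g"
  have repM: "is_rep H M" using M by (simp add: preprojective_module_def)
  interpret M: quiver_rep Q M using repM by (rule quiver_repI)
  interpret k: vector_space "(*) :: 'k \<Rightarrow> 'k \<Rightarrow> 'k" by (rule vector_space_times)
  interpret g: Vector_Spaces.linear "scalar M" "(*)" g by (rule g)
  have V: "fin_dim (*) (if j = i then UNIV else {0 :: 'k})" "k.dim (if j = i then UNIV else {0 :: 'k}) = (if j = i then 1 else 0)" for j
    using fin_dim_UNIV_times[where ?'k = 'k] k.fin_dim_zero k.dim_eq_0_iff by auto
  note prod = fin_dim_Times[OF M.vector_space_axioms k.vector_space_axioms]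
  have rep: "is_rep fr.H ?F"
    unfolding fr.is_rep_iff
  proof (intro conjI allI ballI)
    show "vector_space (scalar ?F)"
      using vector_space_map_prod[OF M.vector_space_axioms k.vector_space_axioms] by simp
    show "fin_dim (scalar ?F) (vspace ?F j)" for j
      using prod(1)[OF M.fin_dim_vspace k.fin_dim_zero] prod(1)[OF M.fin_dim_zero V(1)]
      by (cases j) simp_all
    fix b assume "b \<in> arcs fr.H"
    then show "linear_between (scalar ?F) (vspace ?F (tail fr.H b)) (scalar ?F) (vspace ?F (head fr.H b)) (act ?F b)"
    proof (cases rule: framed_arc_cases)
      case (1 a)
      then show ?thesis
        using linear_betweenD[OF M.linear_act[OF 1(2)]] by (intro linear_betweenI) auto
    next
      case (2 j)
      then show ?thesis
        by (intro linear_betweenI) (auto simp: g.add g.scale)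
    next
      case (3 j)
      then show ?thesis
        by (intro linear_betweenI) (auto simp: zero_prod_def)
    qed
  qed
  interpret F: quiver_rep "framed_quiver Q" ?F using rep by (rule fr.quiver_repI)
  have pp: "preprojective_module (framed_quiver Q) ?F"
    unfolding preprojective_module_framed_iff[OF verts_UNIV finite_arcs]
  proof (intro conjI allI ballI rep)
    fix j y assume "y \<in> vspace ?F (Inl j)"
    then obtain x where x: "y = (x, 0)" "x \<in> vspace M j" by auto
    have "(\<Sum>a\<in>in_arcs H j. scalar M (arrow_sign a) (act M a (act M (star a) x))) = 0"
      using M x(2) by (simp add: preprojective_module_def verts_UNIV)
    then show "(\<Sum>a\<in>in_arcs H j. scalar ?F (arrow_sign a) (act ?F (map_sum Inl Inl a) (act ?F (map_sum Inl Inl (star a)) y))) =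
        act ?F (Inr (Inr j)) (act ?F (Inl (Inr j)) y)"
      by (simp add: x(1) sum_prod zero_prod_def)
  next
    fix j y assume "y \<in> vspace ?F (Inr j)"
    show "act ?F (Inl (Inr j)) (act ?F (Inr (Inr j)) y) = 0"
      by (simp add: zero_prod_def g.zero)
  qed
  have "y = 0" if y: "y \<in> vspace ?F (Inl j)" and 0: "\<forall>b\<in>out_arcs fr.H (Inl j). act ?F b y = 0" for j y
  proof -
    obtain x where x: "y = (x, 0)" "x \<in> vspace M j" using y by auto
    have "act M a x = 0" if "a \<in> out_arcs H j" for a
    proof -
      have "act ?F (map_sum Inl Inl a) y = 0" using 0 that unfolding out_arcs_framed by blast
      then show ?thesis by (simp add: x(1) zero_prod_def)
    qed
    then have xs: "x \<in> soc M j" using x(2) by (simp add: soc_def)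
    have "act ?F (Inl (Inr j)) y = 0" using 0 unfolding out_arcs_framed by blast
    then have "x = 0" using soc xs by (cases "j = i") (auto simp: x(1) zero_prod_def)
    then show ?thesis by (simp add: x(1) zero_prod_def)
  qed
  with pp show "fr.stab (range Inl) ?F" unfolding fr.stab_def by blast
  have d0: "k.dim {0} = 0" "M.dim {0} = 0"
    using k.dim_eq_0_iff[OF k.fin_dim_zero] M.dim_eq_0_iff[OF M.fin_dim_zero] by auto
  show "dim_vector ?F (Inl j) = dim_vector M j"
    using prod(2)[OF M.fin_dim_vspace[of j] k.fin_dim_zero] d0 by (simp add: dim_vector_def)
  show "dim_vector ?F (Inr j) = fundamental_weight i j"
    using prod(2)[OF M.fin_dim_zero V(1)[of j]] d0 V(2)[of j]
    by (simp add: dim_vector_def fundamental_weight_def)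
qed

lemma unprimed_frame: "rep_isomorphic H M (unprimed_rep (frame M i g))"
proof (rule rep_isomorphicI[where f = "\<lambda>j x. (x, 0)"])
  show "linear_between (scalar M) (vspace M j) (scalar (unprimed_rep (frame M i g)))
      (vspace (unprimed_rep (frame M i g)) j) (\<lambda>x. (x, 0))" for j
    by (rule linear_betweenI) (simp_all add: unprimed_rep_def)
  show "bij_betw (\<lambda>x. (x, 0)) (vspace M j) (vspace (unprimed_rep (frame M i g)) j)" for j
    by (auto simp: bij_betw_def inj_on_def unprimed_rep_def)
qed (simp add: unprimed_rep_def)

lemma N_module_fundamental_unique:
  fixes M :: "('k::field, 'v::ab_group_add, 'i, 'e + 'e) rep"
  assumes \<gamma>: "\<gamma> = sreflects is (- fundamental_weight i)"
    and M: "preprojective_module Q M" and dim: "root_to_weight Q (dim_vector M) = \<gamma> + fundamental_weight i"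
    and soc: "rep_isomorphic H (socle H M) (simple_module i)"
  shows "rep_isomorphic H M (N_module Q \<gamma> :: ('k, _, _, _) rep)"
proof -
  have repM: "is_rep H M" using M by (simp add: preprojective_module_def)
  interpret M: quiver_rep Q M using repM by (rule quiver_repI)
  interpret k: vector_space "(*) :: 'k \<Rightarrow> 'k \<Rightarrow> 'k" by (rule vector_space_times)
  have socd: "M.dim (soc M j) = (if j = i then 1 else 0)" for j
    using soc unfolding socle_simple_iff[OF pos_def_UNIV M] by blast
  have fsoc: "fin_dim (scalar M) (soc M j)" for j
    by (rule M.fin_dim_subset(1)[OF M.fin_dim_vspace[of j] subspace_soc[OF repM]]) (auto simp: soc_def)
  have "M.dim (soc M i) = k.dim (UNIV :: 'k set)" by (simp add: socd fin_dim_UNIV_times)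
  then obtain f where f: "linear_between (scalar M) (soc M i) (*) (UNIV :: 'k set) f" "bij_betw f (soc M i) UNIV"
    using fin_dim_isomorphic[OF M.vector_space_axioms k.vector_space_axioms fsoc fin_dim_UNIV_times(1)] by blast
  interpret f: sub_hom "scalar M" "(*) :: 'k \<Rightarrow> 'k \<Rightarrow> 'k" "soc M i" UNIV f
    by (rule sub_homI[OF M.vector_space_axioms k.vector_space_axioms f(1) subspace_soc[OF repM]])
  \<comment> \<open>\<open>stab_frame\<close> wants a functional on the whole ambient space. Any
    linear extension of \<open>f\<close> will do, since stability tests it on the socle
    only.\<close>
  obtain g where g: "Vector_Spaces.linear (scalar M) (*) g" "\<And>x. x \<in> soc M i \<Longrightarrow> g x = f x"
    using f.extend by blast
  have inj: "x = 0" if "x \<in> soc M i" "g x = 0" for x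
    using that g(2) f(2) f.inj_iff by (auto simp: bij_betw_def)
  have other: "x = 0" if "x \<in> soc M j" "j \<noteq> i" for x j
    using that socd[of j] M.dim_eq_0_iff[OF fsoc[of j]] by auto
  have F: "fr.stab (range Inl) (frame M i g)"
    "\<And>j. dim_vector (frame M i g) (Inl j) = dim_vector M j"
    "\<And>j. dim_vector (frame M i g) (Inr j) = fundamental_weight i j"
    by (rule stab_frame[OF M g(1)]; use other inj in blast)+
  have "dim_vector (frame M i g) = extr is (- fundamental_weight i)"
  proof (rule extr_eqI)
    have "(\<lambda>j. dim_vector (frame M i g) (Inl j)) = dim_vector M" by (rule ext) (rule F(2))
    then show "root_to_weight Q (\<lambda>j. dim_vector (frame M i g) (Inl j)) =
        sreflects is (- fundamental_weight i) - - fundamental_weight i"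
      using dim by (simp add: \<gamma>)
    show "dim_vector (frame M i g) (Inr j) = - (- fundamental_weight i) j" for j
      using F(3)[of j] by simp
  qed
  from iso_N_module[OF antidominant_fundamental \<gamma> F(1) this] unprimed_frame
  show ?thesis by (rule rep_isomorphic_trans[rotated])
qed

end

theorem theorem5:
  fixes Q :: "('i::finite, 'e) pre_digraph"
    and N :: "'i weight \<Rightarrow> ('k::field, nat \<Rightarrow> 'k, 'i, 'e + 'e) rep"
  assumes Q: "ade_quiver Q"
    and N: "N = N_module Q"
  shows "(\<forall>\<gamma>. preprojective_module Q (N \<gamma>)) \<and>
    (\<forall>\<gamma>. antidominant \<gamma> \<longrightarrow> zero_rep (double_quiver Q) (N \<gamma>)) \<and>
    (\<forall>i \<gamma>. (\<exists>w\<in>weyl_group Q. \<gamma> = w (- fundamental_weight i)) \<and> \<gamma> \<noteq> - fundamental_weight i \<longrightarrow>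
       root_to_weight Q (dim_vector (N \<gamma>)) = \<gamma> + fundamental_weight i \<and>
       rep_isomorphic (double_quiver Q) (socle (double_quiver Q) (N \<gamma>)) (simple_module i) \<and>
       (\<forall>M :: ('k, 'v::ab_group_add, 'i, 'e + 'e) rep.
          preprojective_module Q M \<and>
          root_to_weight Q (dim_vector M) = \<gamma> + fundamental_weight i \<and>
          rep_isomorphic (double_quiver Q) (socle (double_quiver Q) M) (simple_module i) \<longrightarrow>
          rep_isomorphic (double_quiver Q) M (N \<gamma>))) \<and>
    (\<forall>\<gamma> \<delta>. same_chamber Q \<gamma> \<delta> \<longrightarrow>
       rep_isomorphic (double_quiver Q) (N (\<gamma> + \<delta>)) (direct_sum (N \<gamma>) (N \<delta>)))"
proof -
  interpret ade Q by (rule ade.intro[OF Q])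
  show ?thesis
    unfolding N
  proof (intro conjI allI impI)
    show "preprojective_module Q (N_module Q \<gamma> :: ('k, _, _, _) rep)" for \<gamma>
      by (rule N_module_preprojective)
    show "zero_rep H (N_module Q \<gamma> :: ('k, _, _, _) rep)" if "antidominant \<gamma>" for \<gamma>
      using that by (rule N_module_antidominant)
    show "rep_isomorphic H (N_module Q (\<gamma> + \<delta>) :: ('k, _, _, _) rep) (direct_sum (N_module Q \<gamma>) (N_module Q \<delta>))"
      if "same_chamber Q \<gamma> \<delta>" for \<gamma> \<delta>
      using that by (rule N_module_add)
  next
    fix i \<gamma>
    assume a: "(\<exists>w\<in>weyl_group Q. \<gamma> = w (- fundamental_weight i)) \<and> \<gamma> \<noteq> - fundamental_weight i"
    then obtain "is" where \<gamma>: "\<gamma> = sreflects is (- fundamental_weight i)"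
      unfolding Bex_def weyl_group_iff by blast
    show "root_to_weight Q (dim_vector (N_module Q \<gamma> :: ('k, _, _, _) rep)) = \<gamma> + fundamental_weight i"
      by (rule N_module_fundamental_dim[OF \<gamma>])
    show "rep_isomorphic H (socle H (N_module Q \<gamma> :: ('k, _, _, _) rep)) (simple_module i)"
      using a by (intro N_module_fundamental_socle[OF \<gamma>]) blast
    fix M :: "('k, 'v, 'i, 'e + 'e) rep"
    assume "preprojective_module Q M \<and> root_to_weight Q (dim_vector M) = \<gamma> + fundamental_weight i \<and>
      rep_isomorphic H (socle H M) (simple_module i)"
    then show "rep_isomorphic H M (N_module Q \<gamma>)"
      by (elim conjE) (rule N_module_fundamental_unique[OF \<gamma>])
  qed
qed

end
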